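(* Let $X=\sum_{m=1}^{M_n}X_m$ be the exponential-family likelihood process with product data-generating law $P_\theta=\bigotimes_{m}P_{\theta,m}$, and let $Y$ be the associated product Gaussian comparison process with common local operators $A_0,\Sigma_0,K_0$, all as defined in the context. Suppose the local exponential-family regularity assumption stated in the context holds, $M_n=\omega(n)$ (i.e. $M_n/n\to\infty$), and $r_n\lesssim\sqrt{n/M_n}$. Then, as $n\to\infty$, $$\sup_{\theta\in\Theta_n}\bigl|F_n(\theta)-F_n^{\mathrm G}(\theta)\bigr|=O(r_n).$$
   Context: For each $n$: $\Theta_n$ is a compact parameter space, $T_n\subseteq\Theta_n$ a compact metric space with a Borel probability measure $\pi$ (prior, may depend on $n$), and $M_n$ a number of local components. Fix $d\ge1$, $\mathcal H_0=\mathbb R^d$ with Euclidean inner product, a measurable space $\Omega_0$, probability measures $\lambda,\gamma$ on $\Omega_0$, and measurable maps $W_0,W_0^\star:\Omega_0\to\mathcal H_0$, all independent of $n$. The sample space is $\Omega=\Omega_0^{M_n}$. There are continuous local feature maps $\eta_m:\Theta_n\to\mathcal H_0$, $m\le M_n$, and the feature radius is $r_n=\max_{m\le M_n}\sup_{u\in\Theta_n}\|\eta_m(u)\|$. Define $$\Lambda(u)=\log\int e^{\langle W_0,u\rangle}\,\mathrm d\lambda,\quad \Gamma(u)=\log\int e^{\langle W_0^\star,u\rangle}\,\mathrm d\gamma,\quad \Xi(v,u)=\log\int e^{\langle W_0,v\rangle+\langle W_0^\star,u\rangle}\,\mathrm d\gamma.$$ Model log-likelihood: $X(t,\omega)=\sum_{m}X_m(t,\omega_m)$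 with $X_m(t,\omega_m)=\langle W_0(\omega_m),\eta_m(t)\rangle-\Lambda(\eta_m(t))$, $t\in T_n$. Data-generating law: $P_\theta=\bigotimes_{m=1}^{M_n}P_{\theta,m}$ with $\log\frac{\mathrm dP_{\theta,m}}{\mathrm d\gamma}(\omega_m)=\langle W_0^\star(\omega_m),\eta_m(\theta)\rangle-\Gamma(\eta_m(\theta))$, $\theta\in\Theta_n$. Local exponential-family regularity assumption: there exists $\rho>0$ such that $\Lambda(u)<\infty$ and $\Gamma(u)<\infty$ for all $\|u\|<\rho$, and $\Xi(v,u)<\infty$ for all $\|v\|<\rho,\|u\|<\rho$; in addition $\int W_0\,\mathrm d\lambda=\int W_0\,\mathrm d\gamma$. Gaussian comparison process: let $A_0=\nabla^2_{vu}\Xi(0,0)$ (entries $(A_0)_{ij}=\partial_{v_i}\partial_{u_j}\Xi(0,0)$), $\Sigma_0=\nabla^2_{vv}\Xi(0,0)$, $K_0=\nabla^2\Lambda(0)$. Under a law $Q_\theta$, $Y(t)=\sum_{m=1}^{M_n}Y_m(t)$, where $Y_1,\dots,Y_{M_n}$ are independent Gaussian processes on $T_n$ with continuous paths and $$\mathbb E_{Q_\theta}[Y_m(t)]=\langle A_0\eta_m(\theta),\eta_m(t)\rangle-\tfrac12\langle K_0\eta_m(t),\eta_m(t)\rangle,\qquad \mathrm{Cov}_{Q_\theta}(Y_m(s),Y_m(t))=\langle\Sigma_0\eta_m(s),\eta_m(t)\rangle.$$ Normalized free energies: $F_n(\theta)=\frac1n\mathbb E_{P_\theta}[\log\int_{T_n}e^{X(t)}\pi(\mathrm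 dt)]$, $F_n^{\mathrm G}(\theta)=\frac1n\mathbb E_{Q_\theta}[\log\int_{T_n}e^{Y(t)}\pi(\mathrm dt)]$. The statements are asymptotic: the hypotheses force $r_n\to0$, and the $O(r_n)$ bound is for all sufficiently large $n$ (so that $r_n<\rho$ and all objects are defined), with a constant independent of $n$ and $\theta$. $a_n\lesssim b_n$ means $a_n\le Cb_n$ with $C$ independent of $n$. *)

theory Defs
  imports "HOL-Probability.Probability" "HOL-Library.Landau_Symbols"
begin

definition cumulant :: "'w measure \<Rightarrow> ('w \<Rightarrow> real ^ 'd) \<Rightarrow> real ^ 'd \<Rightarrow> real" where
  "cumulant \<mu> W u = ln (\<integral>x. exp (W x \<bullet> u) \<partial>\<mu>)"

definition joint_cumulant ::
    "'w measure \<Rightarrow> ('w \<Rightarrow> real ^ 'd) \<Rightarrow> ('w \<Rightarrow> real ^ 'd) \<Rightarrow> real ^ 'd \<Rightarrow> real ^ 'd \<Rightarrow> real" where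
  "joint_cumulant \<mu> W W' v u = ln (\<integral>x. exp (W x \<bullet> v + W' x \<bullet> u) \<partial>\<mu>)"

definition partial_deriv :: "'d \<Rightarrow> (real ^ 'd \<Rightarrow> real) \<Rightarrow> real ^ 'd \<Rightarrow> real" where
  "partial_deriv i f x = deriv (\<lambda>t. f (x + axis i t)) 0"

definition hessian :: "(real ^ 'd \<Rightarrow> real) \<Rightarrow> real ^ 'd \<Rightarrow> real ^ 'd ^ 'd" where
  "hessian f x = (\<chi> i j. partial_deriv i (partial_deriv j f) x)"

(* Row index i: derivative in the first argument v; column index j: derivative in the second, u. *)
definition mixed_hessian ::
    "(real ^ 'd \<Rightarrow> real ^ 'd \<Rightarrow> real) \<Rightarrow> real ^ 'd \<Rightarrow> real ^ 'd \<Rightarrow> real ^ 'd ^ 'd" where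
  "mixed_hessian F v u =
     (\<chi> i j. partial_deriv i (\<lambda>v'. partial_deriv j (\<lambda>u'. F v' u') u) v)"

(* As the integrands are nonnegative and measurable, finiteness of a log-Laplace transform
   at u is integrability of its exponential integrand. *)
definition local_exp_family_regularity ::
    "'w measure \<Rightarrow> 'w measure \<Rightarrow> ('w \<Rightarrow> real ^ 'd) \<Rightarrow> ('w \<Rightarrow> real ^ 'd) \<Rightarrow> bool" where
  "local_exp_family_regularity lam gam W W' \<longleftrightarrow>
     (\<exists>\<rho>>0.
        (\<forall>u. norm u < \<rho> \<longrightarrow>
           integrable lam (\<lambda>x. exp (W x \<bullet> u)) \<and> integrable gam (\<lambda>x. exp (W' x \<bullet> u))) \<and>
        (\<forall>v u. norm v < \<rho> \<longrightarrow> norm u < \<rho> \<longrightarrow>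
           integrable gam (\<lambda>x. exp (W x \<bullet> v + W' x \<bullet> u)))) \<and>
     (\<integral>x. W x \<partial>lam) = (\<integral>x. W x \<partial>gam)"

definition feature_radius :: "'a set \<Rightarrow> nat \<Rightarrow> (nat \<Rightarrow> 'a \<Rightarrow> real ^ 'd) \<Rightarrow> real" where
  "feature_radius Theta M eta = Max ((\<lambda>m. SUP u\<in>Theta. norm (eta m u)) ` {1..M})"

definition model_loglik ::
    "'w measure \<Rightarrow> ('w \<Rightarrow> real ^ 'd) \<Rightarrow> nat \<Rightarrow> (nat \<Rightarrow> 'a \<Rightarrow> real ^ 'd) \<Rightarrow> 'a \<Rightarrow> (nat \<Rightarrow> 'w) \<Rightarrow> real" where
  "model_loglik lam W M eta t w =
     (\<Sum>m\<in>{1..M}. W (w m) \<bullet> eta m t - cumulant lam W (eta m t))"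

definition data_law ::
    "'w measure \<Rightarrow> ('w \<Rightarrow> real ^ 'd) \<Rightarrow> nat \<Rightarrow> (nat \<Rightarrow> 'a \<Rightarrow> real ^ 'd) \<Rightarrow> 'a \<Rightarrow> (nat \<Rightarrow> 'w) measure" where
  "data_law gam W' M eta \<theta> =
     (\<Pi>\<^sub>M m\<in>{1..M}. density gam
        (\<lambda>x. ennreal (exp (W' x \<bullet> eta m \<theta> - cumulant gam W' (eta m \<theta>)))))"

(* Constants count as Gaussian: the covariances of the comparison process may be degenerate. *)
definition gaussian_rv :: "'q measure \<Rightarrow> ('q \<Rightarrow> real) \<Rightarrow> bool" where
  "gaussian_rv Q Z \<longleftrightarrow> Z \<in> borel_measurable Q \<and>
     ((\<exists>\<mu> \<sigma>. \<sigma> > 0 \<and> distributed Q lborel Z (\<lambda>z. ennreal (normal_density \<mu> \<sigma> z))) \<or>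
      (\<exists>\<mu>. AE x in Q. Z x = \<mu>))"

definition gaussian_process :: "'q measure \<Rightarrow> 'a set \<Rightarrow> ('a \<Rightarrow> 'q \<Rightarrow> real) \<Rightarrow> bool" where
  "gaussian_process Q T Y \<longleftrightarrow>
     (\<forall>S c. finite S \<longrightarrow> S \<subseteq> T \<longrightarrow> gaussian_rv Q (\<lambda>x. \<Sum>t\<in>S. c t * Y t x))"

definition covariance :: "'q measure \<Rightarrow> ('q \<Rightarrow> real) \<Rightarrow> ('q \<Rightarrow> real) \<Rightarrow> real" where
  "covariance Q X Y =
     (\<integral>x. (X x - (\<integral>y. X y \<partial>Q)) * (Y x - (\<integral>y. Y y \<partial>Q)) \<partial>Q)"

(* Independence of the component processes: each is a random element of the space of real
   functions on T with the product sigma-algebra. *)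
definition gaussian_comparison ::
    "'q measure \<Rightarrow> (nat \<Rightarrow> 'a::topological_space \<Rightarrow> 'q \<Rightarrow> real) \<Rightarrow> 'a set \<Rightarrow> nat \<Rightarrow>
     (nat \<Rightarrow> 'a \<Rightarrow> real ^ 'd) \<Rightarrow> real ^ 'd ^ 'd \<Rightarrow> real ^ 'd ^ 'd \<Rightarrow> real ^ 'd ^ 'd \<Rightarrow> 'a \<Rightarrow> bool" where
  "gaussian_comparison Q Y T M eta A \<Sigma> K \<theta> \<longleftrightarrow>
     prob_space Q \<and>
     (\<forall>m\<in>{1..M}. gaussian_process Q T (Y m)) \<and>
     (\<forall>m\<in>{1..M}. \<forall>x\<in>space Q. continuous_on T (\<lambda>t. Y m t x)) \<and>
     prob_space.indep_vars Q (\<lambda>m. \<Pi>\<^sub>M t\<in>T. borel) (\<lambda>m x. \<lambda>t\<in>T. Y m t x) {1..M} \<and>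
     (\<forall>m\<in>{1..M}. \<forall>t\<in>T. (\<integral>x. Y m t x \<partial>Q) =
        (A *v eta m \<theta>) \<bullet> eta m t - (1 / 2) * ((K *v eta m t) \<bullet> eta m t)) \<and>
     (\<forall>m\<in>{1..M}. \<forall>s\<in>T. \<forall>t\<in>T. covariance Q (Y m s) (Y m t) = (\<Sigma> *v eta m s) \<bullet> eta m t)"

definition free_energy ::
    "nat \<Rightarrow> 'b measure \<Rightarrow> 'a measure \<Rightarrow> ('a \<Rightarrow> 'b \<Rightarrow> real) \<Rightarrow> real" where
  "free_energy n P prior H = (1 / real n) * (\<integral>x. ln (\<integral>t. exp (H t x) \<partial>prior) \<partial>P)"

end

theory Submission
  imports Defs
begin

text \<open>The proof is Lindeberg replacement, carried out on the log-partition function. Both free energies have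
the form \<open>E ln \<integral> exp (\<Sum>m. z m (v m) t) \<pi>(dt)\<close> with independent site variables \<open>v m\<close>, and the sites of
the one law are exchanged for the sites of the other, one at a time.

While one site is exchanged, the other sites are frozen, and their exponential is absorbed into the
prior, which becomes a Gibbs probability measure \<open>G\<close>. What remains is \<open>ln \<integral> exp z \<partial>G\<close>, and for a
field bounded by \<open>B\<close> this is the \<open>G\<close>-mean plus half the \<open>G\<close>-variance of \<open>z\<close>, up to a constant times
\<open>B\<^sup>3\<close> (\<open>log_partition_expansion\<close>). Mean and variance are linear in the products \<open>z t\<close> and \<open>z s * z t\<close>,
so after averaging over the site variable they only see its first two moments, uniformly in \<open>G\<close>
(\<open>log_partition_swap\<close>). Hence an exchange costs at most a fixed multiple of \<open>e\<close> if the first and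
second moments of the two site fields agree up to \<open>e\<close> and the cubes of their envelopes have mean at
most \<open>e\<close>; summing over the sites gives \<open>lindeberg_log_partition\<close>.

The Gaussian process is chosen so that \<open>e\<close> is of order \<open>r\<^sup>3\<close>, where \<open>r\<close> is the feature radius.
Exponential moments make all expansions in the features legitimate. Tilting \<open>\<gamma>\<close> by the feature \<open>u\<close> of
the true parameter moves the mean of \<open>W\<^sub>0\<close> by \<open>A\<^sub>0 u + O(r\<^sup>2)\<close> and its covariance from \<open>\<Sigma>\<^sub>0\<close> by \<open>O(r)\<close>
(\<open>tilted_moments\<close>), and \<open>\<Lambda>\<close> is its second-order Taylor polynomial up to \<open>O(r\<^sup>3)\<close>
(\<open>cumulant_taylor\<close>); pairing with features of size \<open>r\<close> turns all these errors into \<open>O(r\<^sup>3)\<close>. The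
linear term of \<open>\<Lambda>\<close> cancels the mean of \<open>W\<^sub>0\<close> because \<open>W\<^sub>0\<close> has the same mean under \<open>\<lambda>\<close> and \<open>\<gamma>\<close>.
So the free energies differ by \<open>O(M r\<^sup>3 / n)\<close>, and this is \<open>O(r)\<close> because \<open>r\<^sup>2 = O(n / M)\<close>.

To put both kinds of sites into one product space, each component of the Gaussian process is replaced
by a random vector: since its covariance is bilinear in the features, \<open>Y m t\<close> is almost surely its
mean plus the inner product of the feature \<open>eta m t\<close> with a vector \<open>G m\<close>, simultaneously for all
\<open>t\<close> (\<open>gaussian_comparison_linear\<close>).\<close>

section \<open>Second-order expansion of a log-partition function\<close>

lemma exp_taylor2:
  fixes x :: real
  shows "\<bar>exp x - 1 - x - x\<^sup>2 / 2\<bar> \<le> \<bar>x\<bar> ^ 3 * exp \<bar>x\<bar>"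
proof -
  obtain t where t: "\<bar>t\<bar> \<le> \<bar>x\<bar>" "exp x = (\<Sum>m<3. x ^ m / fact m) + exp t / fact 3 * x ^ 3"
    using Maclaurin_exp_le by blast
  have "(\<Sum>m<3. x ^ m / fact m) = 1 + x + x\<^sup>2 / 2" by (simp add: lessThan_nat_numeral lessThan_Suc)
  moreover have "fact 3 = (6::real)" by (simp add: fact_numeral)
  ultimately have "exp x = 1 + x + x\<^sup>2 / 2 + exp t / 6 * x ^ 3" using t(2) by metis
  then have "\<bar>exp x - 1 - x - x\<^sup>2 / 2\<bar> = \<bar>exp t / 6 * x ^ 3\<bar>" by linarith
  also have "\<dots> = (exp t / 6) * \<bar>x\<bar> ^ 3" by (simp add: abs_mult power_abs)
  also have "\<dots> \<le> exp \<bar>x\<bar> * \<bar>x\<bar> ^ 3"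
    using order_trans[of "exp t / 6" "exp t" "exp \<bar>x\<bar>"] t(1) by (intro mult_right_mono) auto
  finally show ?thesis by (simp add: mult.commute)
qed

lemma exp_taylor1:
  fixes x :: real
  shows "\<bar>exp x - 1 - x\<bar> \<le> \<bar>x\<bar> ^ 2 * exp \<bar>x\<bar>"
proof -
  obtain t where t: "\<bar>t\<bar> \<le> \<bar>x\<bar>" "exp x = (\<Sum>m<2. x ^ m / fact m) + exp t / fact 2 * x ^ 2"
    using Maclaurin_exp_le by blast
  have "(\<Sum>m<2. x ^ m / fact m) = 1 + x" by (simp add: lessThan_nat_numeral lessThan_Suc)
  moreover have "fact 2 = (2::real)" by simp
  ultimately have "exp x = 1 + x + exp t / 2 * x\<^sup>2" using t(2) by metis
  then have "\<bar>exp x - 1 - x\<bar> = \<bar>exp t / 2 * x\<^sup>2\<bar>" by linarith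
  also have "\<dots> = (exp t / 2) * \<bar>x\<bar> ^ 2" by (simp add: abs_mult)
  also have "\<dots> \<le> exp \<bar>x\<bar> * \<bar>x\<bar> ^ 2"
    using order_trans[of "exp t / 2" "exp t" "exp \<bar>x\<bar>"] t(1) by (intro mult_right_mono) auto
  finally show ?thesis by (simp add: mult.commute)
qed

lemma exp_taylor0:
  fixes x :: real
  shows "\<bar>exp x - 1\<bar> \<le> \<bar>x\<bar> * exp \<bar>x\<bar>"
proof -
  obtain t where t: "\<bar>t\<bar> \<le> \<bar>x\<bar>" "exp x = (\<Sum>m<1. x ^ m / fact m) + exp t / fact 1 * x ^ 1"
    using Maclaurin_exp_le by blast
  have e: "exp x - 1 = exp t * x"
    using t(2) by simp
  have "\<bar>x\<bar> * exp t \<le> \<bar>x\<bar> * exp \<bar>x\<bar>"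
    using t(1) by (intro mult_left_mono) auto
  then show ?thesis
    unfolding e by (simp add: abs_mult mult.commute)
qed

lemma power_le_one_plus_power:
  fixes x :: real
  assumes "0 \<le> x" "m \<le> n"
  shows "x ^ m \<le> 1 + x ^ n"
proof (cases "x \<le> 1")
  case True
  then have "x ^ m \<le> 1" using assms by (simp add: power_le_one)
  then show ?thesis using assms by (meson add_increasing2 zero_le_power)
next
  case False
  then have "x ^ m \<le> x ^ n" using assms by (intro power_increasing) auto
  then show ?thesis by simp
qed

lemma integrable_dominated:
  fixes f :: "'a \<Rightarrow> 'b :: {banach, second_countable_topology}" and g :: "'a \<Rightarrow> real"
  assumes "integrable M g" "f \<in> borel_measurable M" "\<And>x. x \<in> space M \<Longrightarrow> norm (f x) \<le> g x"
  shows "integrable M f"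
  by (rule Bochner_Integration.integrable_bound[OF assms(1,2)])
     (auto intro!: AE_I2 order_trans[OF assms(3)])

text \<open>From \<open>2 \<bar>p q\<bar> \<le> p\<^sup>2 + q\<^sup>2\<close>.\<close>

lemma integrable_mult_of_squares:
  fixes f g :: "'a \<Rightarrow> real"
  assumes "f \<in> borel_measurable M" "g \<in> borel_measurable M"
    and "integrable M (\<lambda>x. (f x)\<^sup>2)" "integrable M (\<lambda>x. (g x)\<^sup>2)"
  shows "integrable M (\<lambda>x. f x * g x)"
proof (rule integrable_dominated)
  show "integrable M (\<lambda>x. (f x)\<^sup>2 + (g x)\<^sup>2)" "(\<lambda>x. f x * g x) \<in> borel_measurable M"
    using assms by simp_all
  fix x
  have "0 \<le> (\<bar>f x\<bar> - \<bar>g x\<bar>)\<^sup>2 + (f x)\<^sup>2 + (g x)\<^sup>2" by simp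
  then show "norm (f x * g x) \<le> (f x)\<^sup>2 + (g x)\<^sup>2" by (simp add: power2_diff abs_mult)
qed

lemma (in prob_space) integrable_shifted_square:
  fixes f :: "'a \<Rightarrow> real"
  assumes "integrable M f" "integrable M (\<lambda>x. (f x)\<^sup>2)"
  shows "integrable M (\<lambda>x. (f x - c)\<^sup>2)"
proof -
  have "integrable M (\<lambda>x. (f x)\<^sup>2 - 2 * c * f x + c\<^sup>2)" using assms by simp
  then show ?thesis by (simp add: power2_eq_square algebra_simps)
qed

text \<open>A quantitative form of \<open>ln E exp w = Var w / 2 + O(E \<bar>w\<bar>\<^sup>3)\<close> for centred \<open>w\<close>. Centring is what makes
the linear bound on \<open>ln (1 + y) - y\<close> enough: \<open>y\<close> is then of second order, so its square is of fourth
order. The weight \<open>exp \<bar>w\<bar>\<close> admits unbounded \<open>w\<close>, which is needed for the cumulant function.\<close>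

lemma (in prob_space) ln_mgf_expansion:
  fixes w :: "'a \<Rightarrow> real"
  assumes [measurable]: "w \<in> borel_measurable M"
    and int: "integrable M (\<lambda>x. \<bar>w x\<bar> ^ 3 * exp \<bar>w x\<bar>)"
    and mean: "(\<integral>x. w x \<partial>M) = 0"
    and small: "(\<integral>x. (w x)\<^sup>2 \<partial>M) / 2 + (\<integral>x. \<bar>w x\<bar> ^ 3 * exp \<bar>w x\<bar> \<partial>M) \<le> 1 / 2"
  shows "\<bar>ln (\<integral>x. exp (w x) \<partial>M) - (\<integral>x. (w x)\<^sup>2 \<partial>M) / 2\<bar>
    \<le> (\<integral>x. \<bar>w x\<bar> ^ 3 * exp \<bar>w x\<bar> \<partial>M) +
       2 * ((\<integral>x. (w x)\<^sup>2 \<partial>M) / 2 + (\<integral>x. \<bar>w x\<bar> ^ 3 * exp \<bar>w x\<bar> \<partial>M))\<^sup>2"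
proof -
  define k where "k = (\<integral>x. \<bar>w x\<bar> ^ 3 * exp \<bar>w x\<bar> \<partial>M)"
  define s where "s = (\<integral>x. (w x)\<^sup>2 \<partial>M)"
  have i1: "integrable M (\<lambda>x. 1 + \<bar>w x\<bar> ^ 3 * exp \<bar>w x\<bar>)"
    using int by simp
  have b: "\<bar>w x\<bar> ^ j \<le> 1 + \<bar>w x\<bar> ^ 3 * exp \<bar>w x\<bar>" if "j \<le> 3" for x j
  proof -
    have "\<bar>w x\<bar> ^ j \<le> 1 + \<bar>w x\<bar> ^ 3" using that by (intro power_le_one_plus_power) auto
    also have "\<dots> \<le> 1 + \<bar>w x\<bar> ^ 3 * exp \<bar>w x\<bar>"
      using mult_left_mono[of 1 "exp \<bar>w x\<bar>" "\<bar>w x\<bar> ^ 3"] by simp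
    finally show ?thesis .
  qed
  have iw: "integrable M w"
    by (rule integrable_dominated[OF i1]) (use b[of 1] in auto)
  have iw2: "integrable M (\<lambda>x. (w x)\<^sup>2)"
    by (rule integrable_dominated[OF i1]) (use b[of 2] in auto)
  have iR: "integrable M (\<lambda>x. exp (w x) - 1 - w x - (w x)\<^sup>2 / 2)"
    by (rule integrable_dominated[OF int]) (auto intro!: exp_taylor2)
  define R where "R = (\<integral>x. exp (w x) - 1 - w x - (w x)\<^sup>2 / 2 \<partial>M)"
  have R: "\<bar>R\<bar> \<le> k"
    unfolding R_def k_def
    by (rule order_trans[OF integral_abs_bound]) (intro integral_mono int integrable_abs iR exp_taylor2)
  have "(\<integral>x. exp (w x) \<partial>M) = (\<integral>x. (exp (w x) - 1 - w x - (w x)\<^sup>2 / 2) + (1 + w x + (w x)\<^sup>2 / 2) \<partial>M)"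
    by simp
  also have "\<dots> = R + (1 + 0 + s / 2)"
    using iR iw iw2 unfolding R_def s_def
    by (subst Bochner_Integration.integral_add) (auto simp: mean prob_space)
  finally have E: "(\<integral>x. exp (w x) \<partial>M) = 1 + (s / 2 + R)" by simp
  have s0: "s \<ge> 0" unfolding s_def by simp
  have "\<bar>s / 2 + R\<bar> \<le> s / 2 + k" using R s0 by linarith
  moreover from this have "\<bar>s / 2 + R\<bar> \<le> 1 / 2" using small unfolding s_def k_def by linarith
  then have "\<bar>ln (1 + (s / 2 + R)) - (s / 2 + R)\<bar> \<le> 2 * (s / 2 + R)\<^sup>2"
    by (rule abs_ln_one_plus_x_minus_x_bound)
  moreover have "(s / 2 + R)\<^sup>2 \<le> (s / 2 + k)\<^sup>2"
    using \<open>\<bar>s / 2 + R\<bar> \<le> s / 2 + k\<close> by (intro power2_le_iff_abs_le[THEN iffD2]) auto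
  ultimately show ?thesis unfolding E using R unfolding k_def[symmetric] s_def[symmetric] by linarith
qed

lemma (in prob_space) bounded_integrable:
  fixes f :: "'a \<Rightarrow> real"
  assumes "f \<in> borel_measurable M" "\<And>x. x \<in> space M \<Longrightarrow> \<bar>f x\<bar> \<le> B"
  shows "integrable M f"
  by (rule integrable_const_bound[where B=B]) (use assms in auto)

lemma (in prob_space) abs_integral_le_const:
  fixes f :: "'a \<Rightarrow> real"
  assumes "\<And>x. x \<in> space M \<Longrightarrow> \<bar>f x\<bar> \<le> B" "f \<in> borel_measurable M"
  shows "\<bar>\<integral>x. f x \<partial>M\<bar> \<le> B"
proof -
  have i: "integrable M f" using assms by (intro bounded_integrable)
  have "\<bar>\<integral>x. f x \<partial>M\<bar> \<le> (\<integral>x. \<bar>f x\<bar> \<partial>M)" by (rule integral_abs_bound)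
  also have "\<dots> \<le> (\<integral>x. B \<partial>M)" using i assms by (intro integral_mono) auto
  finally show ?thesis by (simp add: prob_space)
qed

lemma (in prob_space) ln_integral_exp_bound:
  fixes z :: "'a \<Rightarrow> real"
  assumes [measurable]: "z \<in> borel_measurable M" and b: "\<And>x. x \<in> space M \<Longrightarrow> \<bar>z x\<bar> \<le> B"
  shows "\<bar>ln (\<integral>x. exp (z x) \<partial>M)\<bar> \<le> B" "(\<integral>x. exp (z x) \<partial>M) > 0" "integrable M (\<lambda>x. exp (z x))"
proof -
  have i: "integrable M (\<lambda>x. exp (z x))"
    using b by (intro bounded_integrable[of _ "exp B"]) (auto simp: abs_le_iff)
  have "(\<integral>x. exp (- B) \<partial>M) \<le> (\<integral>x. exp (z x) \<partial>M)" "(\<integral>x. exp (z x) \<partial>M) \<le> (\<integral>x. exp B \<partial>M)"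
    using i by (intro integral_mono; use b in \<open>fastforce simp: abs_le_iff\<close>)+
  then have 1: "exp (- B) \<le> (\<integral>x. exp (z x) \<partial>M)" "(\<integral>x. exp (z x) \<partial>M) \<le> exp B"
    by (auto simp: prob_space)
  then show p: "(\<integral>x. exp (z x) \<partial>M) > 0" using exp_gt_zero less_le_trans by blast
  have "- B \<le> ln (\<integral>x. exp (z x) \<partial>M)" "ln (\<integral>x. exp (z x) \<partial>M) \<le> B"
    using 1 p by (auto simp: ln_ge_iff) (metis ln_exp ln_le_cancel_iff exp_gt_zero)
  then show "\<bar>ln (\<integral>x. exp (z x) \<partial>M)\<bar> \<le> B" by linarith
  show "integrable M (\<lambda>x. exp (z x))" by fact
qed

text \<open>For \<open>B \<le> 1 / 4\<close> the centred field satisfies the hypotheses of \<open>ln_mgf_expansion\<close>. For larger \<open>B\<close>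
each of the three terms is of size at most \<open>B\<close> or \<open>B\<^sup>2\<close>, hence at most a multiple of \<open>B\<^sup>3\<close>, so that
the estimate holds without a smallness condition. This is used with a random, unbounded envelope \<open>B\<close>.\<close>

lemma (in prob_space) log_partition_expansion:
  fixes z :: "'a \<Rightarrow> real"
  assumes [measurable]: "z \<in> borel_measurable M" and b: "\<And>x. x \<in> space M \<Longrightarrow> \<bar>z x\<bar> \<le> B"
  shows "\<bar>ln (\<integral>x. exp (z x) \<partial>M) - (\<integral>x. z x \<partial>M)
            - ((\<integral>x. (z x)\<^sup>2 \<partial>M) - (\<integral>x. z x \<partial>M)\<^sup>2) / 2\<bar> \<le> 40 * B ^ 3"
proof -
  obtain x0 where x0: "x0 \<in> space M" using not_empty by blast
  have B0: "B \<ge> 0" using b[OF x0] by linarith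
  define m where "m = (\<integral>x. z x \<partial>M)"
  have m: "\<bar>m\<bar> \<le> B" unfolding m_def using b by (intro abs_integral_le_const) auto
  have iz: "integrable M z" using b by (intro bounded_integrable) auto
  have sq: "(z x)\<^sup>2 \<le> B\<^sup>2" if "x \<in> space M" for x
    using b[OF that] by (intro power2_le_iff_abs_le[THEN iffD2]) (auto simp: B0)
  have iz2: "integrable M (\<lambda>x. (z x)\<^sup>2)" using sq by (intro bounded_integrable[of _ "B\<^sup>2"]) auto
  have v: "(\<integral>x. (z x - m)\<^sup>2 \<partial>M) = (\<integral>x. (z x)\<^sup>2 \<partial>M) - m\<^sup>2"
  proof -
    have "(\<integral>x. (z x - m)\<^sup>2 \<partial>M) = (\<integral>x. (z x)\<^sup>2 - 2 * m * z x + m\<^sup>2 \<partial>M)"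
      by (simp add: power2_diff algebra_simps)
    also have "\<dots> = (\<integral>x. (z x)\<^sup>2 \<partial>M) - 2 * m * m + m\<^sup>2"
      using iz iz2 by (simp add: m_def prob_space)
    finally show ?thesis by (simp add: power2_eq_square)
  qed
  define s where "s = (\<integral>x. (z x - m)\<^sup>2 \<partial>M)"
  have s0: "s \<ge> 0" unfolding s_def by simp
  have sB: "s \<le> B\<^sup>2"
  proof -
    have "(\<integral>x. (z x)\<^sup>2 \<partial>M) \<le> (\<integral>x. B\<^sup>2 \<partial>M)" using iz2 sq by (intro integral_mono) auto
    then show ?thesis unfolding s_def v by (simp add: prob_space) (smt (verit) zero_le_power2)
  qed
  \<comment> \<open>The threshold \<open>1 / 4\<close> bounds the centred field by \<open>1 / 2\<close>, so that \<open>exp \<bar>w\<bar> \<le> 2\<close>.\<close>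
  show ?thesis
  proof (cases "B \<le> 1 / 4")
    case True
    define w where "w x = z x - m" for x
    have [measurable]: "w \<in> borel_measurable M" unfolding w_def by measurable
    have wb: "\<bar>w x\<bar> \<le> 2 * B" if "x \<in> space M" for x using b[OF that] m unfolding w_def by linarith
    have w3: "\<bar>w x\<bar> ^ 3 * exp \<bar>w x\<bar> \<le> 16 * B ^ 3" if "x \<in> space M" for x
    proof -
      have "exp \<bar>w x\<bar> \<le> exp (1 / 2)" using wb[OF that] True by simp
      also have "exp (1 / 2 :: real) \<le> 2"
        using exp_bound[of "1/2 :: real"] by (simp add: power2_eq_square)
      finally have "\<bar>w x\<bar> ^ 3 * exp \<bar>w x\<bar> \<le> (2 * B) ^ 3 * 2"
        using wb[OF that] B0 by (intro mult_mono power_mono) auto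
      then show ?thesis by (simp add: power_mult_distrib)
    qed
    have i3: "integrable M (\<lambda>x. \<bar>w x\<bar> ^ 3 * exp \<bar>w x\<bar>)"
      using w3 by (intro bounded_integrable[of _ "16 * B ^ 3"]) auto
    define k where "k = (\<integral>x. \<bar>w x\<bar> ^ 3 * exp \<bar>w x\<bar> \<partial>M)"
    have k: "k \<le> 16 * B ^ 3" "k \<ge> 0"
    proof -
      have "k \<le> (\<integral>x. 16 * B ^ 3 \<partial>M)" unfolding k_def using i3 w3 by (intro integral_mono) auto
      then show "k \<le> 16 * B ^ 3" by (simp add: prob_space)
      show "k \<ge> 0" unfolding k_def by simp
    qed
    have B3: "16 * B ^ 3 \<le> B\<^sup>2 * 4"
      using True B0 mult_left_mono[of "B" "1/4" "16 * B\<^sup>2"] by (simp add: power2_eq_square power3_eq_cube)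
    have B2: "B\<^sup>2 \<le> 1 / 16"
      using True B0 power_mono[of B "1/4" 2] by (simp add: power2_eq_square)
    have sw: "(\<integral>x. (w x)\<^sup>2 \<partial>M) = s" unfolding w_def s_def ..
    have sk: "s / 2 + k \<le> 9 / 2 * B\<^sup>2" using sB k B3 by simp
    then have "s / 2 + k \<le> 1 / 2" using B2 by simp
    moreover have "(\<integral>x. w x \<partial>M) = 0" unfolding w_def using iz by (simp add: m_def prob_space)
    ultimately have "\<bar>ln (\<integral>x. exp (w x) \<partial>M) - s / 2\<bar> \<le> k + 2 * (s / 2 + k)\<^sup>2"
      using ln_mgf_expansion[OF _ i3] unfolding sw k_def by auto
    also have "\<dots> \<le> 16 * B ^ 3 + 2 * (9 / 2 * B\<^sup>2)\<^sup>2"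
      using k sk s0 by (intro add_mono mult_left_mono power_mono) auto
    also have "(9 / 2 * B\<^sup>2)\<^sup>2 = 81/4 * B * B ^ 3" by (simp add: power2_eq_square power3_eq_cube)
    also have "16 * B ^ 3 + 2 * (81/4 * B * B ^ 3) \<le> 40 * B ^ 3"
    proof -
      have "B * B ^ 3 \<le> 1 / 4 * B ^ 3" using True B0 by (intro mult_right_mono) auto
      moreover have "0 \<le> B ^ 3" using B0 by (rule zero_le_power)
      ultimately show ?thesis by linarith
    qed
    finally have "\<bar>ln (\<integral>x. exp (w x) \<partial>M) - s / 2\<bar> \<le> 40 * B ^ 3" .
    moreover have "(\<integral>x. exp (w x) \<partial>M) = (\<integral>x. exp (z x) \<partial>M) * exp (- m)"
      unfolding w_def by (simp add: exp_diff exp_minus field_simps)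
    moreover have "ln ((\<integral>x. exp (z x) \<partial>M) * exp (- m)) = ln (\<integral>x. exp (z x) \<partial>M) - m"
      using ln_integral_exp_bound(2)[OF assms(1) b] by (simp add: ln_mult)
    ultimately show ?thesis using v unfolding m_def[symmetric] s_def by simp
  next
    case False
    then have "B\<^sup>2 \<le> 4 * B ^ 3"
      using mult_left_mono[of "1/4" B "4 * B\<^sup>2"] B0 by (simp add: power2_eq_square power3_eq_cube)
    moreover from False have "B \<le> 4 * B\<^sup>2"
      using mult_left_mono[of "1/4" B "4 * B"] B0 by (simp add: power2_eq_square)
    moreover have "\<bar>ln (\<integral>x. exp (z x) \<partial>M)\<bar> \<le> B" using ln_integral_exp_bound(1)[OF assms(1) b] .
    ultimately have "\<bar>ln (\<integral>x. exp (z x) \<partial>M) - m - s / 2\<bar> \<le> 40 * B ^ 3"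
      using m sB s0 by linarith
    then show ?thesis using v unfolding m_def[symmetric] s_def by simp
  qed
qed

section \<open>Lindeberg replacement for log-partition functions\<close>

text \<open>Since \<open>R\<close> is a probability measure, an envelope integrable in \<open>v\<close> makes \<open>z\<close> integrable on the product.
The envelope may be unbounded, as it has to be for Gaussian site variables.\<close>

lemma field_fubini:
  fixes z :: "'v \<Rightarrow> 't \<Rightarrow> real"
  assumes N: "prob_space N" and R: "prob_space R"
    and meas: "case_prod z \<in> borel_measurable (N \<Otimes>\<^sub>M R)"
    and bound: "\<And>v t. v \<in> space N \<Longrightarrow> t \<in> space R \<Longrightarrow> \<bar>z v t\<bar> \<le> B v"
    and B: "integrable N B"
  shows "integrable N (\<lambda>v. \<integral>t. z v t \<partial>R)" (is ?A)
    and "integrable R (\<lambda>t. \<integral>v. z v t \<partial>N)" (is ?B)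
    and "(\<integral>v. \<integral>t. z v t \<partial>R \<partial>N) = (\<integral>t. \<integral>v. z v t \<partial>N \<partial>R)" (is ?C)
proof -
  interpret N: prob_space N by fact
  interpret R: prob_space R by fact
  interpret pair_sigma_finite N R ..
  note [measurable] = meas
  have m1: "z v \<in> borel_measurable R" if "v \<in> space N" for v
    using measurable_Pair2[OF meas that] by simp
  have i1: "integrable R (z v)" if "v \<in> space N" for v
    by (rule R.bounded_integrable[OF m1[OF that] bound[OF that]])
  have m2: "(\<lambda>v. \<integral>t. \<bar>z v t\<bar> \<partial>R) \<in> borel_measurable N"
    by measurable
  have i2: "integrable N (\<lambda>v. \<integral>t. \<bar>z v t\<bar> \<partial>R)"
  proof (rule integrable_dominated[OF B m2])
    fix v assume v: "v \<in> space N"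
    have "\<bar>\<integral>t. \<bar>z v t\<bar> \<partial>R\<bar> \<le> B v"
      using bound[OF v] m1[OF v] by (intro R.abs_integral_le_const) auto
    then show "norm (\<integral>t. \<bar>z v t\<bar> \<partial>R) \<le> B v" by simp
  qed
  have "integrable (N \<Otimes>\<^sub>M R) (case_prod z)"
    using i2 i1 meas by (intro Fubini_integrable) auto
  note i = this
  show ?A using integrable_fst'[OF i] by simp
  show ?B using integrable_snd[OF i] by simp
  show ?C using Fubini_integral[OF i] by simp
qed

text \<open>Average of \<open>log_partition_expansion\<close> over the randomness of the field. The square of the \<open>R\<close>-mean is
written as a double integral over \<open>s\<close> and \<open>t\<close>, so that the result involves \<open>z\<close> only through its first
two moments under \<open>N\<close>.\<close>

lemma expected_log_partition_expansion:
  fixes z :: "'v \<Rightarrow> 't \<Rightarrow> real"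
  assumes N: "prob_space N" and R: "prob_space R"
    and meas: "case_prod z \<in> borel_measurable (N \<Otimes>\<^sub>M R)"
    and bound: "\<And>v t. v \<in> space N \<Longrightarrow> t \<in> space R \<Longrightarrow> \<bar>z v t\<bar> \<le> B v"
    and B: "B \<in> borel_measurable N" "integrable N (\<lambda>v. B v ^ 3)"
  shows "integrable N (\<lambda>v. ln (\<integral>t. exp (z v t) \<partial>R))" (is ?i)
    and "integrable R (\<lambda>t. \<integral>v. z v t \<partial>N)" (is ?i1)
    and "integrable R (\<lambda>t. \<integral>v. (z v t)\<^sup>2 \<partial>N)" (is ?i2)
    and "\<And>s. s \<in> space R \<Longrightarrow> integrable R (\<lambda>t. \<integral>v. z v s * z v t \<partial>N)"
    and "integrable R (\<lambda>s. \<integral>t. \<integral>v. z v s * z v t \<partial>N \<partial>R)" (is ?i3)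
    and "\<bar>(\<integral>v. ln (\<integral>t. exp (z v t) \<partial>R) \<partial>N) - (\<integral>t. \<integral>v. z v t \<partial>N \<partial>R)
           - ((\<integral>t. \<integral>v. (z v t)\<^sup>2 \<partial>N \<partial>R) - (\<integral>s. \<integral>t. \<integral>v. z v s * z v t \<partial>N \<partial>R \<partial>R)) / 2\<bar>
         \<le> 40 * (\<integral>v. B v ^ 3 \<partial>N)" (is ?e)
proof -
  interpret N: prob_space N by fact
  interpret R: prob_space R by fact
  note [measurable] = meas B(1)
  obtain t0 where t0: "t0 \<in> space R" using R.not_empty by blast
  have B0: "B v \<ge> 0" if "v \<in> space N" for v using bound[OF that t0] by linarith
  have iB1: "integrable N (\<lambda>v. 1 + B v ^ 3)" using B(2) by simp
  have iB: "integrable N B"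
    by (rule Bochner_Integration.integrable_bound[OF iB1])
       (use B0 power_le_one_plus_power[of _ 1 3] in \<open>auto intro!: AE_I2\<close>)
  have iB2: "integrable N (\<lambda>v. (B v)\<^sup>2)"
    by (rule Bochner_Integration.integrable_bound[OF iB1])
       (use B0 power_le_one_plus_power[of _ 2 3] in \<open>auto intro!: AE_I2\<close>)
  have mv: "z v \<in> borel_measurable R" if "v \<in> space N" for v
    using measurable_Pair2[OF meas that] by simp
  have mt: "(\<lambda>v. z v t) \<in> borel_measurable N" if "t \<in> space R" for t
    using measurable_Pair1[OF meas that] by simp
  define L where "L v = ln (\<integral>t. exp (z v t) \<partial>R)" for v
  have mL: "L \<in> borel_measurable N" unfolding L_def by measurable
  have iL: "integrable N L"
  proof (rule integrable_dominated[OF iB mL])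
    fix v assume v: "v \<in> space N"
    show "norm (L v) \<le> B v"
      using R.ln_integral_exp_bound(1)[OF mv[OF v] bound[OF v]] unfolding L_def by simp
  qed
  then show ?i unfolding L_def .
  define m where "m v = (\<integral>t. z v t \<partial>R)" for v
  have [measurable]: "m \<in> borel_measurable N" unfolding m_def by measurable
  have mB: "\<bar>m v\<bar> \<le> B v" if "v \<in> space N" for v
    unfolding m_def using bound[OF that] mv[OF that] by (intro R.abs_integral_le_const) auto
  note f1 = field_fubini[OF N R meas bound iB]
  have im: "integrable N m" and Em: "(\<integral>v. m v \<partial>N) = (\<integral>t. \<integral>v. z v t \<partial>N \<partial>R)"
    using f1 unfolding m_def by auto
  show ?i1 by (rule f1(2))
  define q where "q v = (\<integral>t. (z v t)\<^sup>2 \<partial>R)" for v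
  have sq: "\<bar>(z v t)\<^sup>2\<bar> \<le> (B v)\<^sup>2" if "v \<in> space N" "t \<in> space R" for v t
    using bound[OF that] B0[OF that(1)] by (simp add: power2_le_iff_abs_le)
  have mm2: "(\<lambda>(v, t). (z v t)\<^sup>2) \<in> borel_measurable (N \<Otimes>\<^sub>M R)" by measurable
  note f2 = field_fubini[OF N R mm2 sq iB2]
  have iq: "integrable N q" and Eq: "(\<integral>v. q v \<partial>N) = (\<integral>t. \<integral>v. (z v t)\<^sup>2 \<partial>N \<partial>R)"
    using f2 unfolding q_def by auto
  show ?i2 by (rule f2(2))
  have mm3: "(\<lambda>(v, t). z v t * m v) \<in> borel_measurable (N \<Otimes>\<^sub>M R)" by measurable
  have sq3: "\<bar>z v t * m v\<bar> \<le> (B v)\<^sup>2" if "v \<in> space N" "t \<in> space R" for v t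
    using bound[OF that] mB[OF that(1)] B0[OF that(1)] by (simp add: abs_mult power2_eq_square mult_mono)
  note f3 = field_fubini[OF N R mm3 sq3 iB2]
  have f4: "integrable R (\<lambda>t. \<integral>v. z v s * z v t \<partial>N)"
    "(\<integral>v. z v s * m v \<partial>N) = (\<integral>t. \<integral>v. z v s * z v t \<partial>N \<partial>R)" if s: "s \<in> space R" for s
  proof -
    have [measurable]: "(\<lambda>v. z v s) \<in> borel_measurable N" by (rule mt[OF s])
    have mm4: "(\<lambda>(v, t). z v s * z v t) \<in> borel_measurable (N \<Otimes>\<^sub>M R)" by measurable
    have sq4: "\<bar>z v s * z v t\<bar> \<le> (B v)\<^sup>2" if "v \<in> space N" "t \<in> space R" for v t
      using bound[OF that] bound[OF that(1) s] B0[OF that(1)] by (simp add: abs_mult power2_eq_square mult_mono)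
    note f4 = field_fubini[OF N R mm4 sq4 iB2]
    show "integrable R (\<lambda>t. \<integral>v. z v s * z v t \<partial>N)" by (rule f4(2))
    show "(\<integral>v. z v s * m v \<partial>N) = (\<integral>t. \<integral>v. z v s * z v t \<partial>N \<partial>R)"
      using f4(3) unfolding m_def by simp
  qed
  show "\<And>s. s \<in> space R \<Longrightarrow> integrable R (\<lambda>t. \<integral>v. z v s * z v t \<partial>N)" by (rule f4(1))
  have "integrable R (\<lambda>s. \<integral>v. z v s * m v \<partial>N) \<longleftrightarrow> ?i3"
    by (intro Bochner_Integration.integrable_cong refl) (use f4(2) in auto)
  then show ?i3 using f3(2) by simp
  have Em2: "(\<integral>v. (m v)\<^sup>2 \<partial>N) = (\<integral>s. \<integral>t. \<integral>v. z v s * z v t \<partial>N \<partial>R \<partial>R)"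
  proof -
    have "(\<integral>v. (m v)\<^sup>2 \<partial>N) = (\<integral>v. \<integral>t. z v t * m v \<partial>R \<partial>N)"
      by (simp add: m_def power2_eq_square)
    also have "\<dots> = (\<integral>s. \<integral>v. z v s * m v \<partial>N \<partial>R)" by (rule f3(3))
    also have "\<dots> = (\<integral>s. \<integral>t. \<integral>v. z v s * z v t \<partial>N \<partial>R \<partial>R)"
      by (intro Bochner_Integration.integral_cong refl f4(2))
    finally show ?thesis .
  qed
  have im2: "integrable N (\<lambda>v. (m v)\<^sup>2)"
    by (rule Bochner_Integration.integrable_bound[OF iB2])
       (use mB B0 in \<open>auto intro!: AE_I2 simp: power2_le_iff_abs_le\<close>)
  have "\<bar>\<integral>v. L v - m v - (q v - (m v)\<^sup>2) / 2 \<partial>N\<bar> \<le> (\<integral>v. \<bar>L v - m v - (q v - (m v)\<^sup>2) / 2\<bar> \<partial>N)"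
    by (rule integral_abs_bound)
  also have "\<dots> \<le> (\<integral>v. 40 * B v ^ 3 \<partial>N)"
  proof (intro integral_mono integrable_abs)
    fix v assume v: "v \<in> space N"
    show "\<bar>L v - m v - (q v - (m v)\<^sup>2) / 2\<bar> \<le> 40 * B v ^ 3"
      unfolding L_def m_def q_def by (rule R.log_partition_expansion[OF mv[OF v] bound[OF v]])
  qed (use iL im iq im2 B(2) in auto)
  also have "\<dots> = 40 * (\<integral>v. B v ^ 3 \<partial>N)" by simp
  also have "(\<integral>v. L v - m v - (q v - (m v)\<^sup>2) / 2 \<partial>N) =
     (\<integral>v. L v \<partial>N) - (\<integral>v. m v \<partial>N) - ((\<integral>v. q v \<partial>N) - (\<integral>v. (m v)\<^sup>2 \<partial>N)) / 2"
    using iL im iq im2 by simp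
  finally show ?e unfolding Em Eq Em2 L_def by simp
qed

lemma (in prob_space) abs_integral_diff_le:
  fixes f g :: "'a \<Rightarrow> real"
  assumes "integrable M f" "integrable M g" "\<And>x. x \<in> space M \<Longrightarrow> \<bar>f x - g x\<bar> \<le> e"
  shows "\<bar>(\<integral>x. f x \<partial>M) - (\<integral>x. g x \<partial>M)\<bar> \<le> e"
proof -
  have "(\<integral>x. f x \<partial>M) - (\<integral>x. g x \<partial>M) = (\<integral>x. f x - g x \<partial>M)" using assms by simp
  also have "\<bar>\<dots>\<bar> \<le> e" using assms by (intro abs_integral_le_const) auto
  finally show ?thesis .
qed

text \<open>The expansion turns a comparison of log-partition functions into a comparison of moments. Each
expansion contributes \<open>40 e\<close>, the means contribute \<open>e\<close> and the two halves of the variance \<open>e / 2\<close>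
each.\<close>

lemma log_partition_comparison:
  fixes z0 z1 :: "'v \<Rightarrow> 't \<Rightarrow> real"
  assumes N: "prob_space N0" "prob_space N1" and R: "prob_space R"
    and meas: "case_prod z0 \<in> borel_measurable (N0 \<Otimes>\<^sub>M R)" "case_prod z1 \<in> borel_measurable (N1 \<Otimes>\<^sub>M R)"
    and bound0: "\<And>v t. v \<in> space N0 \<Longrightarrow> t \<in> space R \<Longrightarrow> \<bar>z0 v t\<bar> \<le> B0 v"
    and bound1: "\<And>v t. v \<in> space N1 \<Longrightarrow> t \<in> space R \<Longrightarrow> \<bar>z1 v t\<bar> \<le> B1 v"
    and B0: "B0 \<in> borel_measurable N0" "integrable N0 (\<lambda>v. B0 v ^ 3)" "(\<integral>v. B0 v ^ 3 \<partial>N0) \<le> e"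
    and B1: "B1 \<in> borel_measurable N1" "integrable N1 (\<lambda>v. B1 v ^ 3)" "(\<integral>v. B1 v ^ 3 \<partial>N1) \<le> e"
    and first: "\<And>t. t \<in> space R \<Longrightarrow> \<bar>(\<integral>v. z0 v t \<partial>N0) - (\<integral>v. z1 v t \<partial>N1)\<bar> \<le> e"
    and second: "\<And>s t. s \<in> space R \<Longrightarrow> t \<in> space R \<Longrightarrow>
       \<bar>(\<integral>v. z0 v s * z0 v t \<partial>N0) - (\<integral>v. z1 v s * z1 v t \<partial>N1)\<bar> \<le> e"
  shows "\<bar>(\<integral>v. ln (\<integral>t. exp (z0 v t) \<partial>R) \<partial>N0) - (\<integral>v. ln (\<integral>t. exp (z1 v t) \<partial>R) \<partial>N1)\<bar> \<le> 82 * e"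
proof -
  interpret R: prob_space R by fact
  note x0 = expected_log_partition_expansion[OF N(1) R meas(1) bound0 B0(1,2)]
  note x1 = expected_log_partition_expansion[OF N(2) R meas(2) bound1 B1(1,2)]
  have 1: "\<bar>(\<integral>t. \<integral>v. z0 v t \<partial>N0 \<partial>R) - (\<integral>t. \<integral>v. z1 v t \<partial>N1 \<partial>R)\<bar> \<le> e"
    using first by (intro R.abs_integral_diff_le x0 x1)
  have 2: "\<bar>(\<integral>t. \<integral>v. (z0 v t)\<^sup>2 \<partial>N0 \<partial>R) - (\<integral>t. \<integral>v. (z1 v t)\<^sup>2 \<partial>N1 \<partial>R)\<bar> \<le> e"
    using second[of t t for t] unfolding power2_eq_square[symmetric]
    by (intro R.abs_integral_diff_le x0 x1)
  have 3: "\<bar>(\<integral>s. \<integral>t. \<integral>v. z0 v s * z0 v t \<partial>N0 \<partial>R \<partial>R) - (\<integral>s. \<integral>t. \<integral>v. z1 v s * z1 v t \<partial>N1 \<partial>R \<partial>R)\<bar> \<le> e"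
    using second by (intro R.abs_integral_diff_le x0 x1)
  have 4: "\<bar>(\<integral>v. ln (\<integral>t. exp (z0 v t) \<partial>R) \<partial>N0) - (\<integral>t. \<integral>v. z0 v t \<partial>N0 \<partial>R)
      - ((\<integral>t. \<integral>v. (z0 v t)\<^sup>2 \<partial>N0 \<partial>R) - (\<integral>s. \<integral>t. \<integral>v. z0 v s * z0 v t \<partial>N0 \<partial>R \<partial>R)) / 2\<bar>
      \<le> 40 * (\<integral>v. B0 v ^ 3 \<partial>N0)"
    by (rule x0(6))
  have 5: "\<bar>(\<integral>v. ln (\<integral>t. exp (z1 v t) \<partial>R) \<partial>N1) - (\<integral>t. \<integral>v. z1 v t \<partial>N1 \<partial>R)
      - ((\<integral>t. \<integral>v. (z1 v t)\<^sup>2 \<partial>N1 \<partial>R) - (\<integral>s. \<integral>t. \<integral>v. z1 v s * z1 v t \<partial>N1 \<partial>R \<partial>R)) / 2\<bar>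
      \<le> 40 * (\<integral>v. B1 v ^ 3 \<partial>N1)"
    by (rule x1(6))
  \<comment> \<open>The linear arithmetic is isolated from the integrals, which are opaque to it.\<close>
  have real_arith: "\<bar>l0 - l1\<bar> \<le> 82 * e" if "\<bar>a0 - a1\<bar> \<le> e" "\<bar>b0 - b1\<bar> \<le> e" "\<bar>c0 - c1\<bar> \<le> e"
    "\<bar>l0 - a0 - (b0 - c0) / 2\<bar> \<le> 40 * p0" "\<bar>l1 - a1 - (b1 - c1) / 2\<bar> \<le> 40 * p1" "p0 \<le> e" "p1 \<le> e"
    for l0 l1 a0 a1 b0 b1 c0 c1 p0 p1 :: real
    using that by argo
  show ?thesis by (rule real_arith[OF 1 2 3 4 5 B0(3) B1(3)])
qed

text \<open>Exponential tilting of the prior by the frozen sites. A bounded exponent keeps the normalising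
constant positive and finite.\<close>

lemma gibbs_measure:
  fixes a :: "'t \<Rightarrow> real"
  assumes R: "prob_space R" and a: "a \<in> borel_measurable R" "\<And>t. t \<in> space R \<Longrightarrow> \<bar>a t\<bar> \<le> K"
  obtains G Z where "prob_space G" "sets G = sets R" "Z > 0"
    "\<And>f. f \<in> borel_measurable R \<Longrightarrow> (\<integral>t. exp (a t + f t) \<partial>R) = Z * (\<integral>t. exp (f t) \<partial>G)"
proof -
  interpret R: prob_space R by fact
  note [measurable] = a(1)
  define Z where "Z = (\<integral>t. exp (a t) \<partial>R)"
  have Z: "Z > 0" and i: "integrable R (\<lambda>t. exp (a t))"
    using R.ln_integral_exp_bound(2,3)[OF a] unfolding Z_def by auto
  define G where "G = density R (\<lambda>t. ennreal (exp (a t) / Z))"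
  have "(\<integral>\<^sup>+t. ennreal (exp (a t) / Z) \<partial>R) = ennreal (\<integral>t. exp (a t) / Z \<partial>R)"
    using i Z by (intro nn_integral_eq_integral) auto
  also have "(\<integral>t. exp (a t) / Z \<partial>R) = 1" using Z by (simp add: Z_def)
  finally have "prob_space G"
    unfolding G_def by (intro prob_spaceI) (simp add: emeasure_density)
  moreover have "sets G = sets R" unfolding G_def by simp
  moreover have "(\<integral>t. exp (a t + f t) \<partial>R) = Z * (\<integral>t. exp (f t) \<partial>G)" if [measurable]: "f \<in> borel_measurable R" for f
  proof -
    have "(\<integral>t. exp (f t) \<partial>G) = (\<integral>t. (exp (a t) / Z) *\<^sub>R exp (f t) \<partial>R)"
      unfolding G_def using Z by (intro integral_density) auto
    also have "\<dots> = (\<integral>t. exp (a t + f t) / Z \<partial>R)" by (simp add: exp_add)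
    finally show ?thesis using Z by simp
  qed
  ultimately show ?thesis using Z that by blast
qed

text \<open>One replacement step: \<open>a\<close> is the exponent of the frozen sites. The bound does not depend on \<open>a\<close>,
since the moment hypotheses are uniform in \<open>s\<close> and \<open>t\<close> and therefore hold under every Gibbs measure.\<close>

lemma log_partition_swap:
  fixes z0 z1 :: "'v \<Rightarrow> 't \<Rightarrow> real"
  assumes N: "prob_space N0" "prob_space N1" and R: "prob_space R"
    and a: "a \<in> borel_measurable R" "\<And>t. t \<in> space R \<Longrightarrow> \<bar>a t\<bar> \<le> K"
    and meas: "case_prod z0 \<in> borel_measurable (N0 \<Otimes>\<^sub>M R)" "case_prod z1 \<in> borel_measurable (N1 \<Otimes>\<^sub>M R)"
    and bound0: "\<And>v t. v \<in> space N0 \<Longrightarrow> t \<in> space R \<Longrightarrow> \<bar>z0 v t\<bar> \<le> B0 v"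
    and bound1: "\<And>v t. v \<in> space N1 \<Longrightarrow> t \<in> space R \<Longrightarrow> \<bar>z1 v t\<bar> \<le> B1 v"
    and B0: "B0 \<in> borel_measurable N0" "integrable N0 (\<lambda>v. B0 v ^ 3)" "(\<integral>v. B0 v ^ 3 \<partial>N0) \<le> e"
    and B1: "B1 \<in> borel_measurable N1" "integrable N1 (\<lambda>v. B1 v ^ 3)" "(\<integral>v. B1 v ^ 3 \<partial>N1) \<le> e"
    and first: "\<And>t. t \<in> space R \<Longrightarrow> \<bar>(\<integral>v. z0 v t \<partial>N0) - (\<integral>v. z1 v t \<partial>N1)\<bar> \<le> e"
    and second: "\<And>s t. s \<in> space R \<Longrightarrow> t \<in> space R \<Longrightarrow>
       \<bar>(\<integral>v. z0 v s * z0 v t \<partial>N0) - (\<integral>v. z1 v s * z1 v t \<partial>N1)\<bar> \<le> e"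
  shows "\<bar>(\<integral>v. ln (\<integral>t. exp (a t + z0 v t) \<partial>R) \<partial>N0) - (\<integral>v. ln (\<integral>t. exp (a t + z1 v t) \<partial>R) \<partial>N1)\<bar> \<le> 82 * e"
proof -
  obtain G Z where G: "prob_space G" "sets G = sets R" "Z > 0"
    and GZ: "\<And>f. f \<in> borel_measurable R \<Longrightarrow> (\<integral>t. exp (a t + f t) \<partial>R) = Z * (\<integral>t. exp (f t) \<partial>G)"
    using gibbs_measure[OF R a] by blast
  interpret G: prob_space G by fact
  have sp: "space G = space R" using G(2) by (rule sets_eq_imp_space_eq)
  have meas': "case_prod z0 \<in> borel_measurable (N0 \<Otimes>\<^sub>M G)" "case_prod z1 \<in> borel_measurable (N1 \<Otimes>\<^sub>M G)"
    using meas by (auto simp: measurable_cong_sets[OF sets_pair_measure_cong[OF refl G(2)] refl])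
  have *: "(\<integral>v. ln (\<integral>t. exp (a t + z v t) \<partial>R) \<partial>N) = ln Z + (\<integral>v. ln (\<integral>t. exp (z v t) \<partial>G) \<partial>N)"
    if N: "prob_space N" and m: "case_prod z \<in> borel_measurable (N \<Otimes>\<^sub>M R)" "case_prod z \<in> borel_measurable (N \<Otimes>\<^sub>M G)"
      and b: "\<And>v t. v \<in> space N \<Longrightarrow> t \<in> space R \<Longrightarrow> \<bar>z v t\<bar> \<le> B v"
      and B: "B \<in> borel_measurable N" "integrable N (\<lambda>v. B v ^ 3)" for N z and B :: "'v \<Rightarrow> real"
  proof -
    interpret N: prob_space N by fact
    have mv: "z v \<in> borel_measurable R" "z v \<in> borel_measurable G" if "v \<in> space N" for v
      using measurable_Pair2[OF m(1) that] measurable_Pair2[OF m(2) that] by auto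
    have "(\<integral>v. ln (\<integral>t. exp (a t + z v t) \<partial>R) \<partial>N) = (\<integral>v. ln Z + ln (\<integral>t. exp (z v t) \<partial>G) \<partial>N)"
    proof (intro Bochner_Integration.integral_cong refl)
      fix v assume v: "v \<in> space N"
      have "(\<integral>t. exp (z v t) \<partial>G) > 0"
        using G.ln_integral_exp_bound(2)[OF mv(2)[OF v], of "B v"] b[OF v] sp by simp
      then show "ln (\<integral>t. exp (a t + z v t) \<partial>R) = ln Z + ln (\<integral>t. exp (z v t) \<partial>G)"
        using GZ[OF mv(1)[OF v]] G(3) by (simp add: ln_mult)
    qed
    also have "\<dots> = ln Z + (\<integral>v. ln (\<integral>t. exp (z v t) \<partial>G) \<partial>N)"
      using expected_log_partition_expansion(1)[OF N G(1) m(2) _ B] b sp by (simp add: N.prob_space)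
    finally show ?thesis .
  qed
  have "\<bar>(\<integral>v. ln (\<integral>t. exp (z0 v t) \<partial>G) \<partial>N0) - (\<integral>v. ln (\<integral>t. exp (z1 v t) \<partial>G) \<partial>N1)\<bar> \<le> 82 * e"
    by (rule log_partition_comparison[OF N G(1) meas' _ _ B0 B1])
       (use bound0 bound1 first second sp in auto)
  then show ?thesis
    using *[OF N(1) meas(1) meas'(1) bound0 B0(1,2)] *[OF N(2) meas(2) meas'(2) bound1 B1(1,2)] by simp
qed

lemma integrable_PiM_component:
  fixes f :: "'v \<Rightarrow> real"
  assumes "\<And>i. i \<in> I \<Longrightarrow> prob_space (N i)" "i \<in> I" "integrable (N i) f"
  shows "integrable (PiM I N) (\<lambda>v. f (v i))"
proof -
  have "integrable (distr (PiM I N) (N i) (\<lambda>\<omega>. \<omega> i)) f"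
    using assms by (subst distr_PiM_component) auto
  then show ?thesis
    using assms by (subst (asm) integrable_distr_eq) auto
qed

lemma log_partition_measurable:
  fixes z :: "'i \<Rightarrow> 'v \<Rightarrow> 't \<Rightarrow> real"
  assumes R: "prob_space R" and meas: "\<And>i. i \<in> I \<Longrightarrow> case_prod (z i) \<in> borel_measurable (S \<Otimes>\<^sub>M R)"
  shows "(\<lambda>v. ln (\<integral>t. exp (\<Sum>i\<in>I. z i (v i) t) \<partial>R)) \<in> borel_measurable (PiM I (\<lambda>_. S))"
proof -
  interpret R: prob_space R by fact
  have "(\<lambda>w. z i (fst w i) (snd w)) \<in> borel_measurable (PiM I (\<lambda>_. S) \<Otimes>\<^sub>M R)" if i: "i \<in> I" for i
  proof -
    have "(\<lambda>w. (fst w i, snd w)) \<in> measurable (PiM I (\<lambda>_. S) \<Otimes>\<^sub>M R) (S \<Otimes>\<^sub>M R)"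
      using i by measurable
    from measurable_compose[OF this meas[OF i]] show ?thesis by simp
  qed
  then have "(\<lambda>w. \<Sum>i\<in>I. z i (fst w i) (snd w)) \<in> borel_measurable (PiM I (\<lambda>_. S) \<Otimes>\<^sub>M R)"
    by (rule borel_measurable_sum)
  then have "(\<lambda>w. exp (\<Sum>i\<in>I. z i (fst w i) (snd w))) \<in> borel_measurable (PiM I (\<lambda>_. S) \<Otimes>\<^sub>M R)"
    by measurable
  then have "(\<lambda>v. \<integral>t. exp (\<Sum>i\<in>I. z i (v i) t) \<partial>R) \<in> borel_measurable (PiM I (\<lambda>_. S))"
    by (intro R.borel_measurable_lebesgue_integral) (simp add: case_prod_beta')
  then show ?thesis by measurable
qed

text \<open>The hybrid that has been switched exactly on the set \<open>J\<close> uses the laws \<open>N (i \<in> J) i\<close> and the fields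
\<open>z (i \<in> J) i\<close>. Indexing the two systems by a truth value makes every hybrid an instance of the same
expression, and the telescoping sum becomes an induction on \<open>J\<close>.\<close>

lemma lindeberg_log_partition:
  fixes z :: "bool \<Rightarrow> 'i \<Rightarrow> 'v \<Rightarrow> 't \<Rightarrow> real" and N :: "bool \<Rightarrow> 'i \<Rightarrow> 'v measure"
  assumes I: "finite I" and R: "prob_space R"
    and N: "\<And>b i. prob_space (N b i)" and S: "\<And>b i. sets (N b i) = sets S"
    and meas: "\<And>b i. i \<in> I \<Longrightarrow> case_prod (z b i) \<in> borel_measurable (S \<Otimes>\<^sub>M R)"
    and bound: "\<And>b i v t. i \<in> I \<Longrightarrow> v \<in> space S \<Longrightarrow> t \<in> space R \<Longrightarrow> \<bar>z b i v t\<bar> \<le> B b i v"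
    and B: "\<And>b i. i \<in> I \<Longrightarrow> B b i \<in> borel_measurable S"
      "\<And>b i. i \<in> I \<Longrightarrow> integrable (N b i) (\<lambda>v. B b i v ^ 3)"
      "\<And>b i. i \<in> I \<Longrightarrow> (\<integral>v. B b i v ^ 3 \<partial>N b i) \<le> e"
    and first: "\<And>i t. i \<in> I \<Longrightarrow> t \<in> space R \<Longrightarrow>
       \<bar>(\<integral>v. z True i v t \<partial>N True i) - (\<integral>v. z False i v t \<partial>N False i)\<bar> \<le> e"
    and second: "\<And>i s t. i \<in> I \<Longrightarrow> s \<in> space R \<Longrightarrow> t \<in> space R \<Longrightarrow>
       \<bar>(\<integral>v. z True i v s * z True i v t \<partial>N True i) - (\<integral>v. z False i v s * z False i v t \<partial>N False i)\<bar> \<le> e"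
  shows "\<bar>(\<integral>v. ln (\<integral>t. exp (\<Sum>i\<in>I. z True i (v i) t) \<partial>R) \<partial>PiM I (N True)) -
          (\<integral>v. ln (\<integral>t. exp (\<Sum>i\<in>I. z False i (v i) t) \<partial>R) \<partial>PiM I (N False))\<bar> \<le> real (card I) * (82 * e)"
proof -
  interpret R: prob_space R by fact
  interpret N: prob_space "N b i" for b i by (rule N)
  have sp: "space (N b i) = space S" for b i using S by (rule sets_eq_imp_space_eq)
  define H where "H J v = ln (\<integral>t. exp (\<Sum>i\<in>I. z (i \<in> J) i (v i) t) \<partial>R)" for J v
  define E where "E J = (\<integral>v. H J v \<partial>PiM I (\<lambda>i. N (i \<in> J) i))" for J
  obtain t0 where t0: "t0 \<in> space R" using R.not_empty by blast
  have B0: "B b i v \<ge> 0" if "i \<in> I" "v \<in> space S" for b i v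
    using bound[OF that t0] by (meson abs_ge_zero order_trans)
  have iB: "integrable (N b i) (B b i)" if "i \<in> I" for b i
  proof (rule integrable_dominated[of _ "\<lambda>v. 1 + B b i v ^ 3"])
    show "integrable (N b i) (\<lambda>v. 1 + B b i v ^ 3)" using B(2)[OF that] by simp
    show "B b i \<in> borel_measurable (N b i)" using B(1)[OF that] by (simp add: measurable_cong_sets[OF S refl])
    show "norm (B b i v) \<le> 1 + B b i v ^ 3" if "v \<in> space (N b i)" for v
      using B0[OF \<open>i \<in> I\<close>, of v b] power_le_one_plus_power[of "B b i v" 1 3] sp that by simp
  qed
  have mz: "(\<lambda>x. z b i (f x) (g x)) \<in> borel_measurable P"
    if "i \<in> I" "f \<in> measurable P S" "g \<in> measurable P R" for b i f g and P :: "'p measure"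
    using measurable_compose[OF measurable_Pair[OF that(2,3)] meas[OF that(1)]] by simp
  have step: "\<bar>E (insert j J) - E J\<bar> \<le> 82 * e" if j: "j \<in> I" "j \<notin> J" for j J
  proof -
    \<comment> \<open>The hybrids for \<open>J\<close> and \<open>insert j J\<close> share the law \<open>P\<close> and the exponent \<open>a\<close> of all sites but \<open>j\<close>.\<close>
    define I' where "I' = I - {j}"
    have I': "finite I'" "j \<notin> I'" "insert j I' = I" "I' \<subseteq> I" using I j unfolding I'_def by auto
    define P where "P = PiM I' (\<lambda>i. N (i \<in> J) i)"
    interpret P: prob_space P unfolding P_def by (intro prob_space_PiM N)
    define a where "a x t = (\<Sum>i\<in>I'. z (i \<in> J) i (x i) t)" for x t
    define G where "G c x y = ln (\<integral>t. exp (a x t + z c j y t) \<partial>R)" for c x y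
    define K where "K x = (\<Sum>i\<in>I'. B (i \<in> J) i (x i))" for x
    have xs: "x i \<in> space S" if "x \<in> space P" "i \<in> I'" for x i
      using that unfolding P_def by (auto simp: space_PiM PiE_def sp)
    have aK: "\<bar>a x t\<bar> \<le> K x" if "x \<in> space P" "t \<in> space R" for x t
      unfolding a_def K_def using that I' xs
      by (intro order_trans[OF sum_abs] sum_mono bound) auto
    have comp: "(\<lambda>x. x i) \<in> measurable P S" if "i \<in> I'" for i
      unfolding P_def using measurable_component_singleton[OF that, of "\<lambda>i. N (i \<in> J) i"]
      by (simp add: measurable_cong_sets[OF refl S])
    have idN: "(\<lambda>x. x) \<in> measurable (N c j) S" for c
      by (simp add: measurable_cong_sets[OF S refl])
    have Gm: "case_prod (G c) \<in> borel_measurable (P \<Otimes>\<^sub>M N c' j)" for c c'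
    proof -
      note [measurable] = comp idN
      have "(\<lambda>w. z (i \<in> J) i (fst (fst w) i) (snd w)) \<in> borel_measurable ((P \<Otimes>\<^sub>M N c' j) \<Otimes>\<^sub>M R)" if "i \<in> I'" for i
        by (rule mz) (use that I' in \<open>auto intro!: measurable_compose[OF _ comp]\<close>)
      moreover have "(\<lambda>w. z c j (snd (fst w)) (snd w)) \<in> borel_measurable ((P \<Otimes>\<^sub>M N c' j) \<Otimes>\<^sub>M R)"
        by (rule mz[OF j(1)]) (auto intro!: measurable_compose[OF _ idN])
      ultimately have "(\<lambda>w. a (fst (fst w)) (snd w) + z c j (snd (fst w)) (snd w)) \<in> borel_measurable ((P \<Otimes>\<^sub>M N c' j) \<Otimes>\<^sub>M R)"
        unfolding a_def by (intro borel_measurable_add borel_measurable_sum) auto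
      then have "(\<lambda>w. exp (a (fst (fst w)) (snd w) + z c j (snd (fst w)) (snd w))) \<in> borel_measurable ((P \<Otimes>\<^sub>M N c' j) \<Otimes>\<^sub>M R)"
        by simp
      then have "(\<lambda>p. \<integral>t. exp (a (fst p) t + z c j (snd p) t) \<partial>R) \<in> borel_measurable (P \<Otimes>\<^sub>M N c' j)"
        by (intro R.borel_measurable_lebesgue_integral) (simp add: case_prod_beta')
      then show ?thesis unfolding G_def by (simp add: case_prod_beta')
    qed
    have am: "a x \<in> borel_measurable R" if "x \<in> space P" for x
      unfolding a_def using I' xs[OF that] by (intro borel_measurable_sum mz) auto
    have zm: "z c j y \<in> borel_measurable R" if "y \<in> space S" for c y
      using mz[OF j(1), of "\<lambda>_. y" R "\<lambda>x. x"] that by simp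
    have GK: "\<bar>G c x y\<bar> \<le> K x + B c j y" if "x \<in> space P" "y \<in> space S" for c x y
      unfolding G_def using am[OF that(1)] zm[OF that(2), of c]
        aK[OF that(1)] bound[OF j(1) that(2), of _ c]
      by (intro R.ln_integral_exp_bound(1)) (auto intro!: order_trans[OF abs_triangle_ineq] add_mono)
    have iK: "integrable P K"
      unfolding K_def P_def using I' by (intro Bochner_Integration.integrable_sum integrable_PiM_component N iB) auto
    have Fub: "E J' = (\<integral>x. \<integral>y. G c x y \<partial>N c j \<partial>P)" "integrable P (\<lambda>x. \<integral>y. G c x y \<partial>N c j)"
      if J': "J' = J \<or> J' = insert j J" and c: "c = (j \<in> J')" for J' c
    proof -
      define M where "M i = N (i \<in> J') i" for i
      interpret M: product_sigma_finite M unfolding M_def by standard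
      have Mj: "M j = N c j" unfolding M_def c ..
      have mem: "(i \<in> J') = (i \<in> J)" if "i \<in> I'" for i using that J' I'(2) by auto
      have PM: "PiM I' M = P"
        unfolding P_def M_def by (intro PiM_cong refl) (simp add: mem)
      have HG: "H J' (x(j := y)) = G c x y" for x y
      proof -
        have "(\<Sum>i\<in>I. z (i \<in> J') i ((x(j := y)) i) t) = a x t + z c j y t" for t
        proof -
          have "(\<Sum>i\<in>I'. z (i \<in> J') i ((x(j := y)) i) t) = a x t"
            unfolding a_def using I'(2) by (intro sum.cong refl) (auto simp: mem)
          moreover have "(\<Sum>i\<in>insert j I'. z (i \<in> J') i ((x(j := y)) i) t) =
             z (j \<in> J') j y t + (\<Sum>i\<in>I'. z (i \<in> J') i ((x(j := y)) i) t)"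
            using I'(1,2) by simp
          ultimately show ?thesis using I'(3) c by simp
        qed
        then show ?thesis unfolding H_def G_def by simp
      qed
      have SM: "sets (PiM I M) = sets (PiM I (\<lambda>_. S))"
        by (intro sets_PiM_cong refl) (simp add: M_def S)
      have Hm: "H J' \<in> borel_measurable (PiM I M)"
        unfolding H_def using log_partition_measurable[OF R, of I "\<lambda>i. z (i \<in> J') i" S] meas
        by (simp add: measurable_cong_sets[OF SM refl])
      have iH: "integrable (PiM I M) (H J')"
      proof (rule integrable_dominated[OF _ Hm])
        show "integrable (PiM I M) (\<lambda>v. \<Sum>i\<in>I. B (i \<in> J') i (v i))"
          by (intro Bochner_Integration.integrable_sum integrable_PiM_component) (auto simp: M_def intro: iB N)
        fix v assume v: "v \<in> space (PiM I M)"
        have vi: "v i \<in> space S" if "i \<in> I" for i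
          using v that by (auto simp: space_PiM PiE_def M_def sp)
        have "\<bar>H J' v\<bar> \<le> (\<Sum>i\<in>I. B (i \<in> J') i (v i))"
          unfolding H_def
        proof (rule R.ln_integral_exp_bound(1))
          show "(\<lambda>t. \<Sum>i\<in>I. z (i \<in> J') i (v i) t) \<in> borel_measurable R"
            using vi by (intro borel_measurable_sum mz) auto
          show "\<bar>\<Sum>i\<in>I. z (i \<in> J') i (v i) t\<bar> \<le> (\<Sum>i\<in>I. B (i \<in> J') i (v i))" if "t \<in> space R" for t
            using vi that by (intro order_trans[OF sum_abs] sum_mono bound) auto
        qed
        then show "norm (H J' v) \<le> (\<Sum>i\<in>I. B (i \<in> J') i (v i))" by simp
      qed
      have iH': "integrable (PiM (insert j I') M) (H J')" using iH I' by simp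
      have "E J' = (\<integral>v. H J' v \<partial>PiM (insert j I') M)"
        unfolding E_def M_def using I' by simp
      also have "\<dots> = (\<integral>x. \<integral>y. H J' (x(j := y)) \<partial>M j \<partial>PiM I' M)"
        by (rule M.product_integral_insert[OF I'(1,2) iH'])
      finally show "E J' = (\<integral>x. \<integral>y. G c x y \<partial>N c j \<partial>P)"
        unfolding HG PM Mj .
      have mint: "(\<lambda>x. \<integral>y. G c x y \<partial>N c j) \<in> borel_measurable P"
        using Gm by (intro N.borel_measurable_lebesgue_integral)
      show "integrable P (\<lambda>x. \<integral>y. G c x y \<partial>N c j)"
      proof (rule integrable_dominated[OF _ mint])
        show "integrable P (\<lambda>x. K x + (\<integral>y. B c j y \<partial>N c j))" using iK by simp
        fix x assume x: "x \<in> space P"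
        have "\<bar>\<integral>y. G c x y \<partial>N c j\<bar> \<le> (\<integral>y. \<bar>G c x y\<bar> \<partial>N c j)" by (rule integral_abs_bound)
        also have "\<dots> \<le> (\<integral>y. K x + B c j y \<partial>N c j)"
          using GK[OF x] iB[OF j(1), of c] sp
          by (intro integral_mono' ) (auto intro: order_trans[OF abs_ge_zero])
        also have "\<dots> = K x + (\<integral>y. B c j y \<partial>N c j)"
          using iB[OF j(1)] by (simp add: N.prob_space)
        finally show "norm (\<integral>y. G c x y \<partial>N c j) \<le> K x + (\<integral>y. B c j y \<partial>N c j)" by simp
      qed
    qed
    have jJ: "True = (j \<in> insert j J)" "False = (j \<in> J)" using j by auto
    have "\<bar>(\<integral>x. \<integral>y. G True x y \<partial>N True j \<partial>P) - (\<integral>x. \<integral>y. G False x y \<partial>N False j \<partial>P)\<bar> \<le> 82 * e"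
    proof (rule P.abs_integral_diff_le)
      show "integrable P (\<lambda>x. \<integral>y. G True x y \<partial>N True j)" by (rule Fub(2)[OF _ jJ(1)]) simp
      show "integrable P (\<lambda>x. \<integral>y. G False x y \<partial>N False j)" by (rule Fub(2)[OF _ jJ(2)]) simp
      fix x assume x: "x \<in> space P"
      have "case_prod (z c j) \<in> borel_measurable (N c j \<Otimes>\<^sub>M R)" for c
        using meas[OF j(1), of c] by (simp add: measurable_cong_sets[OF sets_pair_measure_cong[OF S refl] refl])
      then show "\<bar>(\<integral>y. G True x y \<partial>N True j) - (\<integral>y. G False x y \<partial>N False j)\<bar> \<le> 82 * e"
        unfolding G_def
        by (intro log_partition_swap[where ?B0.0="B True j" and ?B1.0="B False j" and K="K x"] N R am[OF x] aK[OF x])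
           (use j bound B first second S sp in \<open>auto simp: measurable_cong_sets[OF S refl]\<close>)
    qed
    then show ?thesis
      using Fub(1)[OF _ jJ(1)] Fub(1)[OF _ jJ(2)] by simp
  qed
  have "\<bar>E J - E {}\<bar> \<le> real (card J) * (82 * e)" if "J \<subseteq> I" for J
  proof -
    have "finite J" using that I finite_subset by blast
    then show ?thesis using that
    proof (induction J)
      case (insert j J)
      then have "\<bar>E (insert j J) - E J\<bar> \<le> 82 * e" by (intro step) auto
      moreover have "\<bar>E J - E {}\<bar> \<le> real (card J) * (82 * e)" using insert by simp
      moreover have "real (card (insert j J)) * (82 * e) = 82 * e + real (card J) * (82 * e)"
        using insert by (simp add: distrib_right)
      ultimately show ?case by linarith
    qed simp
  qed
  from this[OF subset_refl] have "\<bar>E I - E {}\<bar> \<le> real (card I) * (82 * e)" .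
  moreover have "E I = (\<integral>v. ln (\<integral>t. exp (\<Sum>i\<in>I. z True i (v i) t) \<partial>R) \<partial>PiM I (N True))"
  proof -
    have "PiM I (\<lambda>i. N (i \<in> I) i) = PiM I (N True)" by (intro PiM_cong refl) auto
    moreover have "H I = (\<lambda>v. ln (\<integral>t. exp (\<Sum>i\<in>I. z True i (v i) t) \<partial>R))"
    proof
      fix v
      have "(\<Sum>i\<in>I. z (i \<in> I) i (v i) t) = (\<Sum>i\<in>I. z True i (v i) t)" for t
        by (intro sum.cong refl) auto
      then show "H I v = ln (\<integral>t. exp (\<Sum>i\<in>I. z True i (v i) t) \<partial>R)" unfolding H_def by simp
    qed
    ultimately show ?thesis unfolding E_def by simp
  qed
  moreover have "E {} = (\<integral>v. ln (\<integral>t. exp (\<Sum>i\<in>I. z False i (v i) t) \<partial>R) \<partial>PiM I (N False))"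
    unfolding E_def H_def by simp
  ultimately show ?thesis by simp
qed

section \<open>Exponential moments and tilting\<close>

lemma DERIV_quadratic_remainder:
  fixes f :: "real \<Rightarrow> real"
  assumes "d > 0" "\<And>t. \<bar>t\<bar> < d \<Longrightarrow> \<bar>f t - f 0 - L * t\<bar> \<le> C * t\<^sup>2"
  shows "(f has_real_derivative L) (at 0)"
proof -
  have "((\<lambda>h. (f (0 + h) - f 0) / h - L) \<longlongrightarrow> 0) (at 0)"
  proof (rule Lim_null_comparison)
    show "\<forall>\<^sub>F h in at 0. norm ((f (0 + h) - f 0) / h - L) \<le> C * \<bar>h\<bar>"
      unfolding eventually_at
    proof -
      show "\<exists>d>0. \<forall>x\<in>UNIV. x \<noteq> 0 \<and> dist x 0 < d \<longrightarrow> norm ((f (0 + x) - f 0) / x - L) \<le> C * \<bar>x\<bar>"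
      proof (intro exI[of _ d] conjI ballI impI assms(1))
        fix h :: real assume h: "h \<noteq> 0 \<and> dist h 0 < d"
        then have "\<bar>(f h - f 0) / h - L\<bar> = \<bar>f h - f 0 - L * h\<bar> / \<bar>h\<bar>"
          by (simp add: field_simps flip: abs_divide)
        also have "\<dots> \<le> C * h\<^sup>2 / \<bar>h\<bar>"
          using assms(2)[of h] h by (intro divide_right_mono) auto
        also have "C * h\<^sup>2 / \<bar>h\<bar> = C * \<bar>h\<bar>"
          using h by (simp add: field_simps power2_eq_square)
        finally show "norm ((f (0 + h) - f 0) / h - L) \<le> C * \<bar>h\<bar>" by simp
      qed
    qed
    show "((\<lambda>h. C * \<bar>h\<bar>) \<longlongrightarrow> 0) (at 0)"
      by (auto intro!: tendsto_eq_intros)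
  qed
  then show ?thesis unfolding DERIV_def by (simp add: LIM_zero_iff)
qed

lemma power_le_exp_scaled:
  fixes x d :: real
  assumes "0 \<le> x" "0 < d" "0 < k"
  shows "x ^ k \<le> (k / d) ^ k * exp (d * x)"
proof -
  have "d * x / k \<le> exp (d * x / k)" using exp_ge_add_one_self[of "d * x / k"] by linarith
  then have "(d * x / k) ^ k \<le> exp (d * x / k) ^ k" using assms by (intro power_mono) auto
  also have "\<dots> = exp (d * x)" using assms by (simp flip: exp_of_nat_mult)
  finally have "(k / d) ^ k * (d * x / k) ^ k \<le> (k / d) ^ k * exp (d * x)"
    using assms by (intro mult_left_mono) auto
  then show ?thesis using assms by (simp flip: power_mult_distrib)
qed

text \<open>Differentiation under the integral sign at \<open>0\<close>; the weight \<open>g\<close> carries the other exponential or a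
first derivative when the lemma is applied twice.\<close>

lemma DERIV_integral_exp:
  fixes g b :: "'w \<Rightarrow> real"
  assumes [measurable]: "g \<in> borel_measurable M" "b \<in> borel_measurable M"
    and d: "d > 0" and int: "integrable M (\<lambda>x. \<bar>g x\<bar> * exp (d * \<bar>b x\<bar>))"
  shows "((\<lambda>t. \<integral>x. g x * exp (t * b x) \<partial>M) has_real_derivative (\<integral>x. g x * b x \<partial>M)) (at 0)"
proof (rule DERIV_quadratic_remainder)
  define C where "C = (4 / d)\<^sup>2 * (\<integral>x. \<bar>g x\<bar> * exp (d * \<bar>b x\<bar>) \<partial>M)"
  show "0 < d / 2" using d by simp
  have exp1: "1 \<le> exp (d * \<bar>b x\<bar>)" for x using d by simp
  have ig: "integrable M g"
    by (rule Bochner_Integration.integrable_bound[OF int])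
       (use mult_left_mono[OF exp1] in \<open>auto intro!: AE_I2\<close>)
  have b1: "\<bar>b x\<bar> \<le> 1 / d * exp (d * \<bar>b x\<bar>)" for x
    using power_le_exp_scaled[of "\<bar>b x\<bar>" d 1] d by simp
  have igb: "integrable M (\<lambda>x. g x * b x)"
    by (rule Bochner_Integration.integrable_bound[OF integrable_mult_right[OF int, of "1/d"]])
       (use mult_left_mono[OF b1, of "\<bar>g _\<bar>"] d in \<open>auto intro!: AE_I2 simp: abs_mult mult.commute\<close>)
  fix t :: real assume t: "\<bar>t\<bar> < d / 2"
  have e1: "exp (t * b x) \<le> exp (d * \<bar>b x\<bar>)" for x
  proof -
    have "t * b x \<le> \<bar>t\<bar> * \<bar>b x\<bar>" by (metis abs_ge_self abs_mult)
    also have "\<dots> \<le> d * \<bar>b x\<bar>" using t d by (intro mult_right_mono) auto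
    finally show ?thesis by simp
  qed
  have ige: "integrable M (\<lambda>x. g x * exp (t * b x))"
    by (rule Bochner_Integration.integrable_bound[OF int])
       (use mult_left_mono[OF e1] in \<open>auto intro!: AE_I2 simp: abs_mult\<close>)
  have r: "\<bar>g x * exp (t * b x) - g x - t * (g x * b x)\<bar> \<le> (4 / d)\<^sup>2 * t\<^sup>2 * (\<bar>g x\<bar> * exp (d * \<bar>b x\<bar>))" for x
  proof -
    have tx: "\<bar>t\<bar> * \<bar>b x\<bar> * 2 \<le> d * \<bar>b x\<bar>"
      using mult_right_mono[of "\<bar>t\<bar> * 2" d "\<bar>b x\<bar>"] t by simp
    have "\<bar>exp (t * b x) - 1 - t * b x\<bar> \<le> \<bar>t * b x\<bar>\<^sup>2 * exp \<bar>t * b x\<bar>" by (rule exp_taylor1)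
    also have "\<bar>t * b x\<bar>\<^sup>2 = t\<^sup>2 * \<bar>b x\<bar>\<^sup>2" by (simp add: power_mult_distrib)
    also have "t\<^sup>2 * \<bar>b x\<bar>\<^sup>2 * exp \<bar>t * b x\<bar> \<le> t\<^sup>2 * ((2 / (d / 2))\<^sup>2 * exp (d / 2 * \<bar>b x\<bar>)) * exp (d / 2 * \<bar>b x\<bar>)"
      using power_le_exp_scaled[of "\<bar>b x\<bar>" "d / 2" 2] d t
      by (intro mult_mono mult_left_mono) (auto simp: abs_mult tx)
    also have "\<dots> = (4 / d)\<^sup>2 * t\<^sup>2 * exp (d * \<bar>b x\<bar>)"
      by (simp flip: exp_add)
    finally have "\<bar>g x\<bar> * \<bar>exp (t * b x) - 1 - t * b x\<bar> \<le> \<bar>g x\<bar> * ((4 / d)\<^sup>2 * t\<^sup>2 * exp (d * \<bar>b x\<bar>))"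
      by (intro mult_left_mono) auto
    moreover have "g x * exp (t * b x) - g x - t * (g x * b x) = g x * (exp (t * b x) - 1 - t * b x)"
      by (simp add: algebra_simps)
    ultimately show ?thesis by (simp add: abs_mult mult_ac)
  qed
  have "(\<integral>x. g x * exp (t * b x) \<partial>M) - (\<integral>x. g x \<partial>M) - (\<integral>x. g x * b x \<partial>M) * t
     = (\<integral>x. g x * exp (t * b x) - g x - t * (g x * b x) \<partial>M)"
    using ig igb ige by (simp add: mult.commute)
  also have "\<bar>\<dots>\<bar> \<le> (\<integral>x. \<bar>g x * exp (t * b x) - g x - t * (g x * b x)\<bar> \<partial>M)"
    by (rule integral_abs_bound)
  also have "\<dots> \<le> (\<integral>x. (4 / d)\<^sup>2 * t\<^sup>2 * (\<bar>g x\<bar> * exp (d * \<bar>b x\<bar>)) \<partial>M)"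
    using ig igb ige by (intro integral_mono r integrable_mult_right int integrable_abs) auto
  also have "\<dots> = C * t\<^sup>2" unfolding C_def by simp
  finally show "\<bar>(\<integral>x. g x * exp (t * b x) \<partial>M) - (\<integral>x. g x * exp (0 * b x) \<partial>M) - (\<integral>x. g x * b x \<partial>M) * t\<bar> \<le> C * t\<^sup>2"
    by simp
qed

text \<open>All second derivatives in the problem, mixed or not, on the diagonal or not, are of this form for
suitable components \<open>a\<close> and \<open>b\<close>.\<close>

lemma deriv_deriv_log_mgf:
  fixes a b :: "'w \<Rightarrow> real"
  assumes M: "prob_space M" and [measurable]: "a \<in> borel_measurable M" "b \<in> borel_measurable M"
    and d: "d > 0" and int: "integrable M (\<lambda>x. exp (d * (\<bar>a x\<bar> + \<bar>b x\<bar>)))"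
  shows "deriv (\<lambda>s. deriv (\<lambda>t. ln (\<integral>x. exp (s * a x + t * b x) \<partial>M)) 0) 0
    = (\<integral>x. a x * b x \<partial>M) - (\<integral>x. a x \<partial>M) * (\<integral>x. b x \<partial>M)"
proof -
  interpret prob_space M by fact
  define n where "n s = (\<integral>x. b x * exp (s * a x) \<partial>M)" for s
  define z where "z s = (\<integral>x. exp (s * a x) \<partial>M)" for s
  have es: "exp (s * a x) \<le> exp (d / 2 * \<bar>a x\<bar>)" if "\<bar>s\<bar> < d / 2" for s x
  proof -
    have "s * a x \<le> \<bar>s\<bar> * \<bar>a x\<bar>" by (metis abs_ge_self abs_mult)
    also have "\<dots> \<le> d / 2 * \<bar>a x\<bar>" using that by (intro mult_right_mono) auto
    finally show ?thesis by simp
  qed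
  have bs: "exp (d / 2 * \<bar>a x\<bar>) * exp (d / 2 * \<bar>b x\<bar>) \<le> exp (d * (\<bar>a x\<bar> + \<bar>b x\<bar>))" for x
  proof -
    have "d / 2 * \<bar>a x\<bar> \<le> d * \<bar>a x\<bar>" "d / 2 * \<bar>b x\<bar> \<le> d * \<bar>b x\<bar>"
      using d by (auto intro!: mult_right_mono)
    then show ?thesis by (simp flip: exp_add add: distrib_left)
  qed
  have inner: "deriv (\<lambda>t. ln (\<integral>x. exp (s * a x + t * b x) \<partial>M)) 0 = n s / z s" and zpos: "z s > 0"
    if s: "\<bar>s\<bar> < d / 2" for s
  proof -
    have i: "integrable M (\<lambda>x. \<bar>exp (s * a x)\<bar> * exp (d / 2 * \<bar>b x\<bar>))"
    proof (rule integrable_dominated[OF int])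
      fix x
      have "exp (s * a x) * exp (d / 2 * \<bar>b x\<bar>) \<le> exp (d * (\<bar>a x\<bar> + \<bar>b x\<bar>))"
        by (rule order_trans[OF mult_right_mono[OF es[OF s, of x]] bs]) simp
      then show "norm (\<bar>exp (s * a x)\<bar> * exp (d / 2 * \<bar>b x\<bar>)) \<le> exp (d * (\<bar>a x\<bar> + \<bar>b x\<bar>))"
        by simp
    qed simp
    have i0: "integrable M (\<lambda>x. exp (s * a x))"
      by (rule integrable_dominated[OF i]) (use d in auto)
    show z: "z s > 0"
    proof -
      have "z s \<noteq> 0"
        unfolding z_def using integral_nonneg_eq_0_iff_AE[OF i0] by (simp add: AE_False)
      moreover have "z s \<ge> 0" unfolding z_def by simp
      ultimately show ?thesis by simp
    qed
    have "((\<lambda>t. \<integral>x. exp (s * a x) * exp (t * b x) \<partial>M) has_real_derivative (\<integral>x. exp (s * a x) * b x \<partial>M)) (at 0)"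
      by (rule DERIV_integral_exp[OF _ _ _ i]) (use d in auto)
    then have "((\<lambda>t. \<integral>x. exp (s * a x + t * b x) \<partial>M) has_real_derivative n s) (at 0)"
      by (simp add: exp_add n_def mult.commute)
    then have "((\<lambda>t. ln (\<integral>x. exp (s * a x + t * b x) \<partial>M)) has_real_derivative (1 / z s * n s)) (at 0)"
      using z by (auto simp: z_def intro!: derivative_eq_intros)
    then show "deriv (\<lambda>t. ln (\<integral>x. exp (s * a x + t * b x) \<partial>M)) 0 = n s / z s"
      by (simp add: DERIV_imp_deriv)
  qed
  have "integrable M (\<lambda>x. \<bar>b x\<bar> * exp (d / 2 * \<bar>a x\<bar>))"
  proof (rule integrable_dominated[OF integrable_mult_right[OF int, of "1 / (d / 2)"]])
    fix x
    have "\<bar>b x\<bar> \<le> 1 / (d / 2) * exp (d / 2 * \<bar>b x\<bar>)"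
      using power_le_exp_scaled[of "\<bar>b x\<bar>" "d / 2" 1] d by simp
    then have "\<bar>b x\<bar> * exp (d / 2 * \<bar>a x\<bar>) \<le> 1 / (d / 2) * exp (d / 2 * \<bar>b x\<bar>) * exp (d / 2 * \<bar>a x\<bar>)"
      by (intro mult_right_mono) auto
    also have "\<dots> = 1 / (d / 2) * (exp (d / 2 * \<bar>a x\<bar>) * exp (d / 2 * \<bar>b x\<bar>))"
      by simp
    also have "\<dots> \<le> 1 / (d / 2) * exp (d * (\<bar>a x\<bar> + \<bar>b x\<bar>))"
      using d by (intro mult_left_mono bs) auto
    finally show "norm (\<bar>b x\<bar> * exp (d / 2 * \<bar>a x\<bar>)) \<le> 1 / (d / 2) * exp (d * (\<bar>a x\<bar> + \<bar>b x\<bar>))"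
      by simp
  qed simp
  then have dn: "(n has_real_derivative (\<integral>x. b x * a x \<partial>M)) (at 0)"
    unfolding n_def using d by (intro DERIV_integral_exp[where d="d / 2"]) auto
  have "integrable M (\<lambda>x. \<bar>1\<bar> * exp (d / 2 * \<bar>a x\<bar>))"
    by (rule integrable_dominated[OF int]) (use d in \<open>auto simp: algebra_simps\<close>)
  then have "((\<lambda>s. \<integral>x. 1 * exp (s * a x) \<partial>M) has_real_derivative (\<integral>x. 1 * a x \<partial>M)) (at 0)"
    using d by (intro DERIV_integral_exp[where d="d / 2"]) auto
  then have dz: "(z has_real_derivative (\<integral>x. a x \<partial>M)) (at 0)"
    unfolding z_def by simp
  have z0: "z 0 = 1" unfolding z_def by (simp add: prob_space)
  have n0: "n 0 = (\<integral>x. b x \<partial>M)" unfolding n_def by simp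
  have "((\<lambda>s. n s / z s) has_real_derivative ((\<integral>x. b x * a x \<partial>M) * z 0 - n 0 * (\<integral>x. a x \<partial>M)) / (z 0 * z 0)) (at 0)"
    by (rule DERIV_divide[OF dn dz]) (simp add: z0)
  then have "((\<lambda>s. n s / z s) has_real_derivative (\<integral>x. a x * b x \<partial>M) - (\<integral>x. a x \<partial>M) * (\<integral>x. b x \<partial>M)) (at 0)"
    by (simp add: z0 n0 mult.commute)
  then have "((\<lambda>s. deriv (\<lambda>t. ln (\<integral>x. exp (s * a x + t * b x) \<partial>M)) 0) has_real_derivative
      (\<integral>x. a x * b x \<partial>M) - (\<integral>x. a x \<partial>M) * (\<integral>x. b x \<partial>M)) (at 0)"
    by (rule DERIV_cong_ev[THEN iffD1, rotated -1])
       (use d inner in \<open>auto simp: eventually_nhds_metric intro!: exI[of _ "d / 2"]\<close>)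
  then show ?thesis by (rule DERIV_imp_deriv)
qed

text \<open>The norm is dominated by a multiple of the largest component in absolute value, and the exponential
of that component is one of the finitely many \<open>exp (\<plusminus> r / 2 * W x $ i)\<close>.\<close>

lemma exp_norm_integrable:
  fixes W :: "'w \<Rightarrow> real ^ 'd"
  assumes [measurable]: "W \<in> borel_measurable M"
    and r: "r > 0" and int: "\<And>u. norm u < r \<Longrightarrow> integrable M (\<lambda>x. exp (W x \<bullet> u))"
  shows "\<exists>c>0. integrable M (\<lambda>x. exp (c * norm (W x)))"
proof -
  define c where "c = r / 2 / CARD('d)"
  have c: "c > 0" unfolding c_def using r by simp
  have comp: "integrable M (\<lambda>x. exp (s * W x $ i))" if "\<bar>s\<bar> < r" for s i
    using int[of "axis i s"] that by (simp add: inner_axis norm_eq_sqrt_inner[of "axis _ _"] inner_axis_axis mult.commute)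
  have "integrable M (\<lambda>x. \<Sum>i\<in>UNIV. exp (r / 2 * W x $ i) + exp (- (r / 2) * W x $ i))"
    using r by (intro Bochner_Integration.integrable_sum Bochner_Integration.integrable_add comp) auto
  moreover have "exp (c * norm (W x)) \<le> (\<Sum>i\<in>UNIV. exp (r / 2 * W x $ i) + exp (- (r / 2) * W x $ i))" for x
  proof -
    have "Max (range (\<lambda>i. \<bar>W x $ i\<bar>)) \<in> range (\<lambda>i. \<bar>W x $ i\<bar>)" by (rule Max_in) auto
    then obtain i where i: "Max (range (\<lambda>i. \<bar>W x $ i\<bar>)) = \<bar>W x $ i\<bar>" by blast
    have "norm (W x) \<le> (\<Sum>j\<in>UNIV. \<bar>W x $ j\<bar>)" by (rule norm_le_l1_cart)
    also have "\<dots> \<le> CARD('d) * \<bar>W x $ i\<bar>"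
      by (rule sum_bounded_above[of UNIV "\<lambda>j. \<bar>W x $ j\<bar>" "\<bar>W x $ i\<bar>", simplified])
         (auto simp flip: i)
    finally have "c * norm (W x) \<le> c * (CARD('d) * \<bar>W x $ i\<bar>)" using c by (intro mult_left_mono) auto
    also have "\<dots> = r / 2 * \<bar>W x $ i\<bar>" unfolding c_def by simp
    finally have "exp (c * norm (W x)) \<le> exp (r / 2 * \<bar>W x $ i\<bar>)" by simp
    also have "\<dots> \<le> exp (r / 2 * W x $ i) + exp (- (r / 2) * W x $ i)"
      by (cases "W x $ i \<ge> 0") auto
    also have "\<dots> \<le> (\<Sum>i\<in>UNIV. exp (r / 2 * W x $ i) + exp (- (r / 2) * W x $ i))"
      by (rule member_le_sum) (auto intro!: add_nonneg_nonneg)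
    finally show ?thesis .
  qed
  ultimately have "integrable M (\<lambda>x. exp (c * norm (W x)))"
    by - (rule integrable_dominated[of M _ "\<lambda>x. exp (c * norm (W x))"], assumption, auto)
  then show ?thesis using c by blast
qed

text \<open>The law of one site of the data: the member with natural parameter \<open>u\<close> of the exponential family
generated by \<open>M\<close> and \<open>U\<close>.\<close>

definition exp_tilt :: "'w measure \<Rightarrow> ('w \<Rightarrow> real ^ 'd) \<Rightarrow> real ^ 'd \<Rightarrow> 'w measure" where
  "exp_tilt M U u = density M (\<lambda>x. ennreal (exp (U x \<bullet> u - cumulant M U u)))"

text \<open>Expectations of a test function under the tilted law, to zeroth and first order in \<open>u\<close>, with errors
that depend on \<open>f\<close> only through a constant \<open>c\<close> with \<open>\<bar>f\<bar> \<le> c * exp (d * H)\<close>. Polynomials in \<open>W\<close> and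
\<open>U\<close> have such a \<open>c\<close>, so a single lemma serves the first, second and third moments. Four multiples of
\<open>d\<close> are consumed: one for \<open>f\<close>, one for \<open>exp \<bar>U x \<bullet> u\<bar>\<close> and two for the factor \<open>(U x \<bullet> u)\<^sup>2\<close> of
the remainder.\<close>

lemma tilt_expansion:
  fixes U :: "'w \<Rightarrow> real ^ 'd"
  assumes M: "prob_space M" and [measurable]: "U \<in> borel_measurable M" "H \<in> borel_measurable M"
    and d: "d > 0" and H: "\<And>x. norm (U x) \<le> H x" and int: "integrable M (\<lambda>x. exp (4 * d * H x))"
  obtains u0 C where "u0 > 0" "C > 0" "\<And>u. norm u \<le> u0 \<Longrightarrow> prob_space (exp_tilt M U u)"
    "\<And>u f c. norm u \<le> u0 \<Longrightarrow> f \<in> borel_measurable M \<Longrightarrow> 0 \<le> c \<Longrightarrow> (\<And>x. \<bar>f x\<bar> \<le> c * exp (d * H x)) \<Longrightarrow>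
      integrable (exp_tilt M U u) f \<and>
      (\<integral>x. \<bar>f x\<bar> \<partial>exp_tilt M U u) \<le> C * c \<and>
      \<bar>(\<integral>x. f x \<partial>exp_tilt M U u) - (\<integral>x. f x \<partial>M)\<bar> \<le> C * c * norm u \<and>
      ((\<integral>x. f x \<partial>M) = 0 \<longrightarrow>
        \<bar>(\<integral>x. f x \<partial>exp_tilt M U u) - (\<integral>x. f x * (U x \<bullet> u) \<partial>M)\<bar> \<le> C * c * (norm u)\<^sup>2)"
proof -
  interpret prob_space M by fact
  define K where "K = (\<integral>x. exp (4 * d * H x) \<partial>M)"
  have H0: "H x \<ge> 0" for x using H[of x] norm_ge_zero order_trans by blast
  have K1: "K \<ge> 1"
  proof -
    have "(\<integral>x. 1 \<partial>M) \<le> K" unfolding K_def using d H0 by (intro integral_mono int) auto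
    then show ?thesis by (simp add: prob_space)
  qed
  define D where "D = K * (1 + 1 / d + (1 / d)\<^sup>2)"
  have D: "D \<ge> K" "D \<ge> K / d" "D \<ge> K * (1 / d)\<^sup>2" "D > 0"
  proof -
    have "K \<ge> 0" "K / d \<ge> 0" "K * (1 / d)\<^sup>2 \<ge> 0" using K1 d by auto
    moreover have "D = K + K / d + K * (1 / d)\<^sup>2" unfolding D_def by (simp add: distrib_left)
    ultimately show "D \<ge> K" "D \<ge> K / d" "D \<ge> K * (1 / d)\<^sup>2" "D > 0" using K1 by linarith+
  qed
  have Hd: "H x \<le> 1 / d * exp (d * H x)" for x
    using power_le_exp_scaled[of "H x" d 1] d H0 by simp
  have Hd2: "(H x)\<^sup>2 \<le> (1 / d)\<^sup>2 * exp (2 * d * H x)" for x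
    using power_mono[OF Hd[of x] H0, of 2] by (simp add: power_mult_distrib power2_eq_square mult.assoc flip: exp_add)
  have xu: "\<bar>U x \<bullet> u\<bar> \<le> H x * norm u" for x u
    using Cauchy_Schwarz_ineq2[of "U x" u] mult_right_mono[OF H[of x], of "norm u"] by simp
  have exu: "exp \<bar>U x \<bullet> u\<bar> \<le> exp (d * H x)" if "norm u \<le> d" for x u
    using order_trans[OF xu[of x u] mult_left_mono[OF that H0[of x]]] by (simp add: mult.commute)
  have intK: "integrable M g" "\<bar>\<integral>x. g x \<partial>M\<bar> \<le> c * K" "(\<integral>x. \<bar>g x\<bar> \<partial>M) \<le> c * K"
    if [measurable]: "g \<in> borel_measurable M" and g: "\<And>x. \<bar>g x\<bar> \<le> c * exp (4 * d * H x)" for g c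
  proof -
    have c: "integrable M (\<lambda>x. c * exp (4 * d * H x))" using int by simp
    show "integrable M g"
      by (rule Bochner_Integration.integrable_bound[OF c])
         (auto intro!: AE_I2 order_trans[OF g] order_trans[OF _ abs_ge_self])
    note i = this
    show 1: "(\<integral>x. \<bar>g x\<bar> \<partial>M) \<le> c * K"
      using integral_mono[OF integrable_abs[OF i] c g] by (simp add: K_def)
    show "\<bar>\<integral>x. g x \<partial>M\<bar> \<le> c * K"
      by (rule order_trans[OF integral_abs_bound 1])
  qed
  have emono: "exp (k * d * H x) \<le> exp (4 * d * H x)" if "k \<le> 4" for k x
    using that d H0 by (simp add: mult_right_mono)
  have E0: "integrable M (\<lambda>x. f x * exp (U x \<bullet> u))" "(\<integral>x. \<bar>f x\<bar> * exp (U x \<bullet> u) \<partial>M) \<le> c * D"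
    "\<bar>\<integral>x. f x \<partial>M\<bar> \<le> c * D"
    "\<bar>(\<integral>x. f x * exp (U x \<bullet> u) \<partial>M) - (\<integral>x. f x \<partial>M)\<bar> \<le> c * D * norm u"
    "\<bar>(\<integral>x. f x * exp (U x \<bullet> u) \<partial>M) - (\<integral>x. f x \<partial>M) - (\<integral>x. f x * (U x \<bullet> u) \<partial>M)\<bar> \<le> c * D * (norm u)\<^sup>2"
    "\<bar>\<integral>x. f x * (U x \<bullet> u) \<partial>M\<bar> \<le> c * D * norm u"
    if u: "norm u \<le> d" and fm[measurable]: "f \<in> borel_measurable M" and c: "c \<ge> 0"
      and f: "\<And>x. \<bar>f x\<bar> \<le> c * exp (d * H x)" for u f c
  proof -
    have e: "exp (U x \<bullet> u) \<le> exp (d * H x)" for x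
      using order_trans[OF _ exu[OF u, of x], of "exp (U x \<bullet> u)"] by simp
    have b0: "\<bar>f x * exp (U x \<bullet> u)\<bar> \<le> c * exp (4 * d * H x)" for x
    proof -
      have "\<bar>f x * exp (U x \<bullet> u)\<bar> \<le> (c * exp (d * H x)) * exp (d * H x)"
        unfolding abs_mult using e c by (intro mult_mono f) auto
      also have "\<dots> = c * exp (2 * d * H x)" by (simp flip: exp_add)
      also have "\<dots> \<le> c * exp (4 * d * H x)" using emono[of 2 x] c by (intro mult_left_mono) auto
      finally show ?thesis .
    qed
    have bf: "\<bar>f x\<bar> \<le> c * exp (4 * d * H x)" for x
      using f[of x] mult_left_mono[OF emono[of 1 x] c] by simp
    have b1: "\<bar>f x * (U x \<bullet> u)\<bar> \<le> (c / d * norm u) * exp (4 * d * H x)" for x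
    proof -
      have "\<bar>f x * (U x \<bullet> u)\<bar> \<le> (c * exp (d * H x)) * ((1 / d * exp (d * H x)) * norm u)"
        unfolding abs_mult using c d xu[of x u] Hd[of x]
        by (intro mult_mono f order_trans[OF xu]) (auto intro: mult_right_mono)
      also have "\<dots> = (c / d * norm u) * exp (2 * d * H x)" by (simp flip: exp_add)
      also have "\<dots> \<le> (c / d * norm u) * exp (4 * d * H x)"
        using emono[of 2 x] c d by (intro mult_left_mono) auto
      finally show ?thesis .
    qed
    have b2: "\<bar>f x * exp (U x \<bullet> u) - f x\<bar> \<le> (c / d * norm u) * exp (4 * d * H x)" for x
    proof -
      have "\<bar>exp (U x \<bullet> u) - 1\<bar> \<le> \<bar>U x \<bullet> u\<bar> * exp \<bar>U x \<bullet> u\<bar>" by (rule exp_taylor0)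
      also have "\<dots> \<le> ((1 / d * exp (d * H x)) * norm u) * exp (d * H x)"
        using d xu[of x u] Hd[of x] exu[OF u]
        by (intro mult_mono order_trans[OF xu]) (auto intro: mult_right_mono)
      finally have "\<bar>f x\<bar> * \<bar>exp (U x \<bullet> u) - 1\<bar> \<le> (c * exp (d * H x)) * (((1 / d * exp (d * H x)) * norm u) * exp (d * H x))"
        using c by (intro mult_mono f) auto
      also have "\<dots> = (c / d * norm u) * exp (3 * d * H x)" by (simp flip: exp_add)
      also have "\<dots> \<le> (c / d * norm u) * exp (4 * d * H x)"
        using emono[of 3 x] c d by (intro mult_left_mono) auto
      finally show ?thesis by (simp add: algebra_simps flip: abs_mult)
    qed
    have b3: "\<bar>f x * exp (U x \<bullet> u) - f x - f x * (U x \<bullet> u)\<bar> \<le> (c * (1 / d)\<^sup>2 * (norm u)\<^sup>2) * exp (4 * d * H x)" for x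
    proof -
      have "\<bar>exp (U x \<bullet> u) - 1 - U x \<bullet> u\<bar> \<le> \<bar>U x \<bullet> u\<bar>\<^sup>2 * exp \<bar>U x \<bullet> u\<bar>" by (rule exp_taylor1)
      also have "\<dots> \<le> (((1 / d)\<^sup>2 * exp (2 * d * H x)) * (norm u)\<^sup>2) * exp (d * H x)"
      proof (intro mult_mono exu u)
        have "\<bar>U x \<bullet> u\<bar>\<^sup>2 \<le> (H x * norm u)\<^sup>2" by (intro power_mono xu) auto
        also have "\<dots> = (H x)\<^sup>2 * (norm u)\<^sup>2" by (simp add: power_mult_distrib)
        also have "\<dots> \<le> ((1 / d)\<^sup>2 * exp (2 * d * H x)) * (norm u)\<^sup>2" by (intro mult_right_mono Hd2) auto
        finally show "\<bar>U x \<bullet> u\<bar>\<^sup>2 \<le> ((1 / d)\<^sup>2 * exp (2 * d * H x)) * (norm u)\<^sup>2" .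
      qed auto
      finally have "\<bar>f x\<bar> * \<bar>exp (U x \<bullet> u) - 1 - U x \<bullet> u\<bar> \<le> (c * exp (d * H x)) * ((((1 / d)\<^sup>2 * exp (2 * d * H x)) * (norm u)\<^sup>2) * exp (d * H x))"
        using c by (intro mult_mono f) auto
      also have "\<dots> = (c * (1 / d)\<^sup>2 * (norm u)\<^sup>2) * exp (4 * d * H x)" by (simp flip: exp_add)
      also have "\<bar>f x\<bar> * \<bar>exp (U x \<bullet> u) - 1 - U x \<bullet> u\<bar> = \<bar>f x * exp (U x \<bullet> u) - f x - f x * (U x \<bullet> u)\<bar>"
        unfolding abs_mult[symmetric] by (simp add: right_diff_distrib)
      finally show ?thesis .
    qed
    have cK: "c * K \<le> c * D" "(c / d * norm u) * K \<le> c * D * norm u" "(c * (1 / d)\<^sup>2 * (norm u)\<^sup>2) * K \<le> c * D * (norm u)\<^sup>2"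
      using mult_left_mono[OF D(1) c] mult_right_mono[OF mult_left_mono[OF D(2) c], of "norm u"]
        mult_right_mono[OF mult_left_mono[OF D(3) c], of "(norm u)\<^sup>2"] by (auto simp: mult_ac)
    show i: "integrable M (\<lambda>x. f x * exp (U x \<bullet> u))" by (rule intK[OF _ b0]) simp
    have i1: "integrable M f" by (rule intK[OF _ bf]) simp
    have i2: "integrable M (\<lambda>x. f x * (U x \<bullet> u))" by (rule intK[OF _ b1]) simp
    show "(\<integral>x. \<bar>f x\<bar> * exp (U x \<bullet> u) \<partial>M) \<le> c * D"
      using order_trans[OF intK(3)[OF _ b0] cK(1)] by (simp add: abs_mult)
    show "\<bar>\<integral>x. f x \<partial>M\<bar> \<le> c * D"
      using order_trans[OF intK(2)[OF _ bf] cK(1)] by simp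
    show "\<bar>(\<integral>x. f x * exp (U x \<bullet> u) \<partial>M) - (\<integral>x. f x \<partial>M)\<bar> \<le> c * D * norm u"
      using order_trans[OF intK(2)[OF _ b2] cK(2)] i i1 by simp
    show "\<bar>(\<integral>x. f x * exp (U x \<bullet> u) \<partial>M) - (\<integral>x. f x \<partial>M) - (\<integral>x. f x * (U x \<bullet> u) \<partial>M)\<bar> \<le> c * D * (norm u)\<^sup>2"
      using order_trans[OF intK(2)[OF _ b3] cK(3)] i i1 i2 by simp
    show "\<bar>\<integral>x. f x * (U x \<bullet> u) \<partial>M\<bar> \<le> c * D * norm u"
      using order_trans[OF intK(2)[OF _ b1] cK(2)] by simp
  qed
  \<comment> \<open>This radius keeps the normalising constant of the tilted law at least \<open>1 / 2\<close>.\<close>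
  define u0 where "u0 = min d (1 / (2 * D))"
  define C where "C = 2 * D + 2 * D * D"
  have uC: "u0 > 0" "C > 0" unfolding u0_def C_def using d D(4) by (auto intro!: add_pos_pos)
  have key: "prob_space (exp_tilt M U u)"
    "\<And>f c. f \<in> borel_measurable M \<Longrightarrow> 0 \<le> c \<Longrightarrow> (\<And>x. \<bar>f x\<bar> \<le> c * exp (d * H x)) \<Longrightarrow>
      integrable (exp_tilt M U u) f \<and>
      (\<integral>x. \<bar>f x\<bar> \<partial>exp_tilt M U u) \<le> C * c \<and>
      \<bar>(\<integral>x. f x \<partial>exp_tilt M U u) - (\<integral>x. f x \<partial>M)\<bar> \<le> C * c * norm u \<and>
      ((\<integral>x. f x \<partial>M) = 0 \<longrightarrow>
        \<bar>(\<integral>x. f x \<partial>exp_tilt M U u) - (\<integral>x. f x * (U x \<bullet> u) \<partial>M)\<bar> \<le> C * c * (norm u)\<^sup>2)"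
    if u: "norm u \<le> u0" for u
  proof -
    from u have ud: "norm u \<le> d" and uD: "D * norm u \<le> 1 / 2"
      using D(4) unfolding u0_def by (auto simp: field_simps)
    define Z where "Z = (\<integral>x. exp (U x \<bullet> u) \<partial>M)"
    have one: "\<bar>1 :: real\<bar> \<le> 1 * exp (d * H x)" for x using d H0[of x] by simp
    have iZ: "integrable M (\<lambda>x. exp (U x \<bullet> u))" using E0(1)[OF ud _ _ one] by simp
    have Z1: "\<bar>Z - 1\<bar> \<le> D * norm u" using E0(4)[OF ud _ _ one] by (simp add: Z_def prob_space)
    then have Z: "Z \<ge> 1 / 2" using uD by linarith
    then have cu: "exp (U x \<bullet> u - cumulant M U u) = exp (U x \<bullet> u) / Z" for x
      unfolding cumulant_def Z_def[symmetric] by (simp add: exp_diff)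
    have T: "exp_tilt M U u = density M (\<lambda>x. ennreal (exp (U x \<bullet> u) / Z))"
      unfolding exp_tilt_def cu ..
    have "(\<integral>\<^sup>+x. ennreal (exp (U x \<bullet> u) / Z) \<partial>M) = ennreal (\<integral>x. exp (U x \<bullet> u) / Z \<partial>M)"
      using iZ Z by (intro nn_integral_eq_integral) auto
    also have "(\<integral>x. exp (U x \<bullet> u) / Z \<partial>M) = 1" using Z by (simp flip: Z_def)
    finally show "prob_space (exp_tilt M U u)"
      unfolding T by (intro prob_spaceI) (simp add: emeasure_density)
    fix f c assume fm[measurable]: "f \<in> borel_measurable M" and c: "0 \<le> c" and f': "\<And>x. \<bar>f x\<bar> \<le> c * exp (d * H x)"
    show "integrable (exp_tilt M U u) f \<and>
      (\<integral>x. \<bar>f x\<bar> \<partial>exp_tilt M U u) \<le> C * c \<and>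
      \<bar>(\<integral>x. f x \<partial>exp_tilt M U u) - (\<integral>x. f x \<partial>M)\<bar> \<le> C * c * norm u \<and>
      ((\<integral>x. f x \<partial>M) = 0 \<longrightarrow>
        \<bar>(\<integral>x. f x \<partial>exp_tilt M U u) - (\<integral>x. f x * (U x \<bullet> u) \<partial>M)\<bar> \<le> C * c * (norm u)\<^sup>2)"
    proof -
      note E = E0[OF ud _ c f', simplified]
      have If: "(\<integral>x. f x \<partial>exp_tilt M U u) = (\<integral>x. f x * exp (U x \<bullet> u) \<partial>M) / Z"
        unfolding T using Z by (subst integral_density) (auto simp: mult.commute)
      have Ia: "(\<integral>x. \<bar>f x\<bar> \<partial>exp_tilt M U u) = (\<integral>x. \<bar>f x\<bar> * exp (U x \<bullet> u) \<partial>M) / Z"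
        unfolding T using Z by (subst integral_density) (auto simp: mult.commute)
      have "integrable (exp_tilt M U u) f"
        unfolding T using Z E(1) by (subst integrable_density) (auto simp: mult.commute)
      moreover have div: "\<bar>x / Z\<bar> \<le> 2 * b" if "\<bar>x\<bar> \<le> b" for x b
      proof -
        have "\<bar>x / Z\<bar> = \<bar>x\<bar> * (1 / Z)" using Z by (simp add: abs_divide)
        also have "\<dots> \<le> b * 2" using Z that by (intro mult_mono) (auto simp: field_simps)
        finally show ?thesis by simp
      qed
      have tri: "\<bar>x - y * z\<bar> \<le> a + b * e" if "\<bar>x\<bar> \<le> a" "\<bar>y\<bar> \<le> b" "\<bar>z\<bar> \<le> e" for x y z a b e :: real
      proof -
        have "\<bar>y * z\<bar> \<le> b * e" unfolding abs_mult using that by (intro mult_mono) auto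
        then show ?thesis using that(1) by linarith
      qed
      have DD: "0 \<le> c * (D * D)" "0 \<le> c * D" using c D(4) by auto
      have "(\<integral>x. \<bar>f x\<bar> \<partial>exp_tilt M U u) \<le> 2 * (c * D)"
        unfolding Ia using E(2) by (intro order_trans[OF abs_ge_self div]) simp
      then have "(\<integral>x. \<bar>f x\<bar> \<partial>exp_tilt M U u) \<le> C * c"
        unfolding C_def using DD by (simp add: algebra_simps)
      moreover have "\<bar>(\<integral>x. f x \<partial>exp_tilt M U u) - (\<integral>x. f x \<partial>M)\<bar> \<le> C * c * norm u"
      proof -
        have e1: "(\<integral>x. f x \<partial>exp_tilt M U u) - (\<integral>x. f x \<partial>M) =
          (((\<integral>x. f x * exp (U x \<bullet> u) \<partial>M) - (\<integral>x. f x \<partial>M)) - (\<integral>x. f x \<partial>M) * (Z - 1)) / Z"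
          unfolding If using Z by (simp add: field_simps)
        have e2: "\<bar>((\<integral>x. f x * exp (U x \<bullet> u) \<partial>M) - (\<integral>x. f x \<partial>M)) - (\<integral>x. f x \<partial>M) * (Z - 1)\<bar>
            \<le> c * D * norm u + (c * D) * (D * norm u)"
          by (rule tri[OF E(4) E(3) Z1])
        have e3: "2 * (c * D * norm u + (c * D) * (D * norm u)) = C * c * norm u"
          unfolding C_def by (simp add: algebra_simps)
        show ?thesis unfolding e1 using div[OF e2] unfolding e3 .
      qed
      moreover have "\<bar>(\<integral>x. f x \<partial>exp_tilt M U u) - (\<integral>x. f x * (U x \<bullet> u) \<partial>M)\<bar> \<le> C * c * (norm u)\<^sup>2"
        if f0: "(\<integral>x. f x \<partial>M) = 0"
      proof -
        have e1: "(\<integral>x. f x \<partial>exp_tilt M U u) - (\<integral>x. f x * (U x \<bullet> u) \<partial>M) =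
          (((\<integral>x. f x * exp (U x \<bullet> u) \<partial>M) - (\<integral>x. f x \<partial>M) - (\<integral>x. f x * (U x \<bullet> u) \<partial>M))
            - (\<integral>x. f x * (U x \<bullet> u) \<partial>M) * (Z - 1)) / Z"
          unfolding If f0 using Z by (simp add: field_simps)
        have e2: "\<bar>((\<integral>x. f x * exp (U x \<bullet> u) \<partial>M) - (\<integral>x. f x \<partial>M) - (\<integral>x. f x * (U x \<bullet> u) \<partial>M))
            - (\<integral>x. f x * (U x \<bullet> u) \<partial>M) * (Z - 1)\<bar>
            \<le> c * D * (norm u)\<^sup>2 + (c * D * norm u) * (D * norm u)"
          by (rule tri[OF E(5) E(6) Z1])
        have e3: "2 * (c * D * (norm u)\<^sup>2 + (c * D * norm u) * (D * norm u)) = C * c * (norm u)\<^sup>2"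
          unfolding C_def by (simp add: algebra_simps power2_eq_square)
        show ?thesis unfolding e1 using div[OF e2] unfolding e3 .
      qed
      ultimately show ?thesis by blast
    qed
  qed
  show thesis by (rule that[OF uC key])
qed

definition cov_matrix :: "'w measure \<Rightarrow> ('w \<Rightarrow> real ^ 'd) \<Rightarrow> ('w \<Rightarrow> real ^ 'd) \<Rightarrow> real ^ 'd ^ 'd" where
  "cov_matrix M V U = (\<chi> i j. (\<integral>x. V x $ i * U x $ j \<partial>M) - (\<integral>x. V x $ i \<partial>M) * (\<integral>x. U x $ j \<partial>M))"

lemma borel_measurable_vec_nth_compose [measurable (raw)]:
  fixes f :: "'w \<Rightarrow> real ^ 'd"
  assumes "f \<in> borel_measurable M"
  shows "(\<lambda>x. f x $ i) \<in> borel_measurable M"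
  using measurable_compose[OF assms borel_measurable_continuous_onI[OF continuous_on_component[OF continuous_on_id]]]
  by simp

lemma cov_matrix_inner:
  fixes V U :: "'w \<Rightarrow> real ^ 'd"
  assumes "integrable M V" "integrable M U"
    and "\<And>i j. integrable M (\<lambda>x. V x $ i * U x $ j)"
  shows "(\<integral>w. ((V w - (\<integral>w. V w \<partial>M)) \<bullet> x) * (U w \<bullet> y) \<partial>M) = (cov_matrix M V U *v y) \<bullet> x"
proof -
  let ?m = "\<integral>w. V w \<partial>M"
  have iU: "integrable M (\<lambda>w. U w $ j)" for j
    using assms(2) by (simp add: integrable_bounded_linear[OF bounded_linear_vec_nth])
  have m: "?m $ i = (\<integral>w. V w $ i \<partial>M)" for i
    using integral_bounded_linear[OF bounded_linear_vec_nth[of i] assms(1)] by simp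
  have "(\<integral>w. ((V w - ?m) \<bullet> x) * (U w \<bullet> y) \<partial>M)
     = (\<integral>w. (\<Sum>i\<in>UNIV. \<Sum>j\<in>UNIV. (x $ i * y $ j) * (V w $ i * U w $ j - ?m $ i * U w $ j)) \<partial>M)"
    unfolding inner_vec_def sum_product
    by (intro Bochner_Integration.integral_cong sum.cong refl) (simp add: algebra_simps)
  also have "\<dots> = (\<Sum>i\<in>UNIV. \<Sum>j\<in>UNIV. (x $ i * y $ j) * ((\<integral>w. V w $ i * U w $ j \<partial>M) - ?m $ i * (\<integral>w. U w $ j \<partial>M)))"
    using assms(3) iU by simp
  also have "\<dots> = (cov_matrix M V U *v y) \<bullet> x"
    by (simp add: inner_vec_def matrix_vector_mult_def cov_matrix_def m sum_distrib_left sum_distrib_right mult_ac)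
  finally show ?thesis .
qed

lemma inner_add_axis: "W \<bullet> (axis i s + axis j t) = s * W $ i + t * W $ j" for W :: "real ^ 'd"
  by (simp add: inner_add_right inner_axis mult.commute)

lemma exp_components_integrable:
  fixes V U :: "'w \<Rightarrow> real ^ 'd"
  assumes [measurable]: "V \<in> borel_measurable M" "U \<in> borel_measurable M"
    and d: "d > 0" and int: "integrable M (\<lambda>x. exp (d * (norm (V x) + norm (U x))))"
  shows "integrable M (\<lambda>x. exp (d * (\<bar>V x $ i\<bar> + \<bar>U x $ j\<bar>)))"
  by (rule Bochner_Integration.integrable_bound[OF int])
     (use d component_le_norm_cart in \<open>auto intro!: AE_I2 add_mono\<close>)

text \<open>The matrix \<open>K\<^sub>0\<close>, and with \<open>\<gamma>\<close> in place of \<open>\<lambda>\<close> the matrix \<open>\<Sigma>\<^sub>0\<close>, in a form that can be paired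
with features.\<close>

lemma hessian_cumulant:
  fixes W :: "'w \<Rightarrow> real ^ 'd"
  assumes M: "prob_space M" and W[measurable]: "W \<in> borel_measurable M"
    and d: "d > 0" and int: "integrable M (\<lambda>x. exp (d * norm (W x)))"
  shows "hessian (cumulant M W) 0 = cov_matrix M W W"
proof -
  have "integrable M (\<lambda>x. exp (d / 2 * (norm (W x) + norm (W x))))" using int by simp
  note e = exp_components_integrable[OF W W _ this]
  have "hessian (cumulant M W) 0 $ i $ j = cov_matrix M W W $ i $ j" for i j
    using deriv_deriv_log_mgf[OF M _ _ _ e, of i j] d W
    by (simp add: hessian_def partial_deriv_def cumulant_def inner_add_axis cov_matrix_def)
  then show ?thesis by (simp add: vec_eq_iff)
qed

lemma mixed_hessian_joint_cumulant:
  fixes W U :: "'w \<Rightarrow> real ^ 'd"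
  assumes M: "prob_space M" and W[measurable]: "W \<in> borel_measurable M" and U[measurable]: "U \<in> borel_measurable M"
    and d: "d > 0" and int: "integrable M (\<lambda>x. exp (d * (norm (W x) + norm (U x))))"
  shows "mixed_hessian (joint_cumulant M W U) 0 0 = cov_matrix M W U"
proof -
  note e = exp_components_integrable[OF W U d int]
  have "mixed_hessian (joint_cumulant M W U) 0 0 $ i $ j = cov_matrix M W U $ i $ j" for i j
    using deriv_deriv_log_mgf[OF M _ _ d e, of i j] W U
    by (simp add: mixed_hessian_def partial_deriv_def joint_cumulant_def inner_axis cov_matrix_def mult.commute)
  then show ?thesis by (simp add: vec_eq_iff)
qed

text \<open>Moments of \<open>W - m\<close> are traded for the exponential weight \<open>exp (d * H)\<close> that \<open>tilt_expansion\<close> accepts.\<close>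

lemma centered_norm_bounds:
  fixes W :: "'w \<Rightarrow> real ^ 'd"
  assumes "norm (W w) + norm m \<le> H" "d > 0"
  shows "norm (W w - m) \<le> H" "\<bar>(W w - m) \<bullet> x\<bar> \<le> H * norm x"
    "H \<le> 1 / d * exp (d * H)" "H\<^sup>2 \<le> (2 / d)\<^sup>2 * exp (d * H)" "H ^ 3 \<le> (3 / d) ^ 3 * exp (d * H)" "H \<ge> 0"
proof -
  show 1: "norm (W w - m) \<le> H" using norm_triangle_ineq4[of "W w" m] assms by linarith
  show "\<bar>(W w - m) \<bullet> x\<bar> \<le> H * norm x"
    by (rule order_trans[OF Cauchy_Schwarz_ineq2]) (intro mult_right_mono 1 norm_ge_zero)
  show H0: "H \<ge> 0" using 1 norm_ge_zero order_trans by blast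
  show "H \<le> 1 / d * exp (d * H)" using power_le_exp_scaled[OF H0 assms(2), of 1] by simp
  show "H\<^sup>2 \<le> (2 / d)\<^sup>2 * exp (d * H)" using power_le_exp_scaled[OF H0 assms(2), of 2] by simp
  show "H ^ 3 \<le> (3 / d) ^ 3 * exp (d * H)" using power_le_exp_scaled[OF H0 assms(2), of 3] by simp
qed

text \<open>Applied to \<open>(W - E W) \<bullet> x\<close>, the expansion of \<open>ln E exp\<close> for centred variables is the second-order
Taylor formula of the cumulant function at \<open>0\<close>, with a cubic remainder.\<close>

lemma cumulant_taylor:
  fixes W :: "'w \<Rightarrow> real ^ 'd"
  assumes M: "prob_space M" and W[measurable]: "W \<in> borel_measurable M"
    and d: "d > 0" and int: "integrable M (\<lambda>x. exp (d * norm (W x)))"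
  shows "\<exists>u0>0. \<exists>C>0. \<forall>x. norm x \<le> u0 \<longrightarrow>
    \<bar>cumulant M W x - (\<integral>w. W w \<partial>M) \<bullet> x - (1 / 2) * ((cov_matrix M W W *v x) \<bullet> x)\<bar> \<le> C * norm x ^ 3"
proof -
  interpret prob_space M by fact
  define m where "m = (\<integral>w. W w \<partial>M)"
  define H where "H w = norm (W w) + norm m" for w
  have [measurable]: "H \<in> borel_measurable M" unfolding H_def by measurable
  define c where "c = d / 2"
  have c: "c > 0" unfolding c_def using d by simp
  have iH: "integrable M (\<lambda>w. exp (2 * c * H w))"
    using integrable_mult_right[OF int, of "exp (d * norm m)"]
    by (simp add: H_def c_def distrib_left exp_add mult.commute)
  have Hb: "norm (W w) + norm m \<le> H w" for w unfolding H_def by simp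
  note b = centered_norm_bounds[of W, OF Hb c]
  have dom: "integrable M f" if [measurable]: "f \<in> borel_measurable M" and f: "\<And>w. norm (f w) \<le> k * exp (2 * c * H w)"
    for f :: "'w \<Rightarrow> 'z :: {banach, second_countable_topology}" and k
    by (rule Bochner_Integration.integrable_bound[OF integrable_mult_right[OF iH, of k]])
       (use f in \<open>auto intro!: AE_I2 order_trans[OF f] intro: order_trans[OF _ abs_ge_self]\<close>)
  have ee: "exp (c * H w) \<le> exp (2 * c * H w)" for w using c b(6)[of w] by (simp add: mult_right_mono)
  have iW: "integrable M W"
  proof (rule dom[of _ "1 / c"])
    fix w
    have "norm (W w) \<le> H w" unfolding H_def by simp
    also have "\<dots> \<le> 1 / c * exp (c * H w)" by (rule b(3))
    also have "\<dots> \<le> 1 / c * exp (2 * c * H w)" using c by (intro mult_left_mono ee) auto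
    finally show "norm (W w) \<le> 1 / c * exp (2 * c * H w)" .
  qed simp
  have iWW: "integrable M (\<lambda>w. W w $ i * W w $ j)" for i j
  proof (rule dom[of _ "(2 / c)\<^sup>2"])
    fix w
    have "\<bar>W w $ i\<bar> \<le> H w" "\<bar>W w $ j\<bar> \<le> H w"
      using component_le_norm_cart[of "W w"] by (auto simp: H_def intro: add_increasing2)
    then have "\<bar>W w $ i\<bar> * \<bar>W w $ j\<bar> \<le> H w * H w" by (intro mult_mono b) auto
    also have "\<dots> \<le> (2 / c)\<^sup>2 * exp (c * H w)" using b(4)[of w] by (simp add: power2_eq_square)
    also have "\<dots> \<le> (2 / c)\<^sup>2 * exp (2 * c * H w)" by (intro mult_left_mono ee) auto
    finally show "norm (W w $ i * W w $ j) \<le> (2 / c)\<^sup>2 * exp (2 * c * H w)" by (simp add: abs_mult)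
  qed simp
  define C1 where "C1 = (3 / c) ^ 3 * (\<integral>w. exp (2 * c * H w) \<partial>M)"
  define C2 where "C2 = (2 / c)\<^sup>2 * (\<integral>w. exp (2 * c * H w) \<partial>M)"
  have C0: "C1 \<ge> 0" "C2 \<ge> 0" unfolding C1_def C2_def using c by auto
  \<comment> \<open>The first bound keeps \<open>exp \<bar>y\<bar>\<close> below \<open>exp (c * H)\<close>; the others give the smallness condition of
      \<open>ln_mgf_expansion\<close>.\<close>
  define u0 where "u0 = min c (min 1 (1 / (2 * (C1 + C2 + 1))))"
  define C where "C = C1 + 2 * (C1 + C2)\<^sup>2 + 1"
  have "u0 > 0" unfolding u0_def using c C0 by (auto simp: add_nonneg_pos)
  moreover have "C > 0" unfolding C_def using C0 by (simp add: add_nonneg_pos)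
  moreover have "\<bar>cumulant M W x - m \<bullet> x - (1 / 2) * ((cov_matrix M W W *v x) \<bullet> x)\<bar> \<le> C * norm x ^ 3"
    if x: "norm x \<le> u0" for x
  proof -
    have xc: "norm x \<le> c" "norm x \<le> 1" "(C1 + C2) * norm x \<le> 1 / 2"
    proof -
      show "norm x \<le> c" "norm x \<le> 1" using x unfolding u0_def by auto
      have "norm x \<le> 1 / (2 * (C1 + C2 + 1))" using x unfolding u0_def by auto
      then have "(C1 + C2 + 1) * norm x \<le> 1 / 2" using C0 by (simp add: field_simps)
      then show "(C1 + C2) * norm x \<le> 1 / 2" using norm_ge_zero[of x] distrib_right[of "C1 + C2" 1 "norm x"] by linarith
    qed
    define y where "y w = (W w - m) \<bullet> x" for w
    have [measurable]: "y \<in> borel_measurable M" unfolding y_def by measurable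
    have y: "\<bar>y w\<bar> \<le> H w * norm x" for w unfolding y_def by (rule b(2))
    have y3: "\<bar>y w\<bar> ^ 3 * exp \<bar>y w\<bar> \<le> (norm x ^ 3 * (3 / c) ^ 3) * exp (2 * c * H w)" for w
    proof -
      have "\<bar>y w\<bar> \<le> c * H w"
        using order_trans[OF y mult_left_mono[OF xc(1) b(6)]] by (simp add: mult.commute)
      then have "\<bar>y w\<bar> ^ 3 * exp \<bar>y w\<bar> \<le> (H w * norm x) ^ 3 * exp (c * H w)"
        by (intro mult_mono power_mono y) (auto intro: mult_nonneg_nonneg b(6))
      also have "\<dots> = norm x ^ 3 * (H w ^ 3) * exp (c * H w)" by (simp add: power_mult_distrib)
      also have "\<dots> \<le> norm x ^ 3 * ((3 / c) ^ 3 * exp (c * H w)) * exp (c * H w)"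
        by (intro mult_right_mono mult_left_mono b(5)) auto
      also have "\<dots> = (norm x ^ 3 * (3 / c) ^ 3) * exp (2 * c * H w)"
        by (simp flip: exp_add)
      finally show ?thesis .
    qed
    have i3: "integrable M (\<lambda>w. \<bar>y w\<bar> ^ 3 * exp \<bar>y w\<bar>)"
      by (rule dom[OF _ order_trans[OF eq_refl y3]]) auto
    define k where "k = (\<integral>w. \<bar>y w\<bar> ^ 3 * exp \<bar>y w\<bar> \<partial>M)"
    have k0: "k \<ge> 0" unfolding k_def by simp
    have k: "k \<le> C1 * norm x ^ 3"
    proof -
      have "k \<le> (\<integral>w. (norm x ^ 3 * (3 / c) ^ 3) * exp (2 * c * H w) \<partial>M)"
        unfolding k_def using iH by (intro integral_mono i3 y3) auto
      then show ?thesis by (simp add: C1_def mult_ac)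
    qed
    have y2: "(y w)\<^sup>2 \<le> ((norm x)\<^sup>2 * (2 / c)\<^sup>2) * exp (2 * c * H w)" for w
    proof -
      have "(y w)\<^sup>2 \<le> (H w * norm x)\<^sup>2"
        using power_mono[OF y[of w], of 2] by simp
      also have "\<dots> = (norm x)\<^sup>2 * (H w)\<^sup>2" by (simp add: power_mult_distrib)
      also have "\<dots> \<le> (norm x)\<^sup>2 * ((2 / c)\<^sup>2 * exp (2 * c * H w))"
        by (intro mult_left_mono order_trans[OF b(4)] ee) auto
      finally show ?thesis by (simp add: mult.assoc)
    qed
    have i2: "integrable M (\<lambda>w. (y w)\<^sup>2)"
      by (rule dom[OF _ order_trans[OF eq_refl y2]]) auto
    define s where "s = (\<integral>w. (y w)\<^sup>2 \<partial>M)"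
    have s0: "s \<ge> 0" unfolding s_def by simp
    have s: "s \<le> C2 * (norm x)\<^sup>2"
    proof -
      have "s \<le> (\<integral>w. ((norm x)\<^sup>2 * (2 / c)\<^sup>2) * exp (2 * c * H w) \<partial>M)"
        unfolding s_def using iH by (intro integral_mono i2 y2) auto
      then show ?thesis by (simp add: C2_def mult_ac)
    qed
    have xp: "norm x ^ 3 \<le> (norm x)\<^sup>2" "(norm x)\<^sup>2 \<le> norm x" "norm x ^ 4 \<le> norm x ^ 3"
      using xc(2) power_decreasing[of 2 3 "norm x"] power_decreasing[of 1 2 "norm x"]
        power_decreasing[of 3 4 "norm x"] by auto
    have sk: "s / 2 + k \<le> (C1 + C2) * (norm x)\<^sup>2"
    proof -
      have "C1 * norm x ^ 3 \<le> C1 * (norm x)\<^sup>2" using C0 xp by (intro mult_left_mono) auto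
      then show ?thesis using s s0 k by (simp add: distrib_right)
    qed
    also have "\<dots> \<le> (C1 + C2) * norm x" using C0 xp by (intro mult_left_mono) auto
    finally have sk1: "s / 2 + k \<le> 1 / 2" using xc(3) by linarith
    have mean: "(\<integral>w. y w \<partial>M) = 0"
      unfolding y_def using iW by (simp add: inner_diff_left m_def prob_space)
    have "\<bar>ln (\<integral>w. exp (y w) \<partial>M) - s / 2\<bar> \<le> k + 2 * (s / 2 + k)\<^sup>2"
      using ln_mgf_expansion[OF _ i3 mean] sk1 unfolding s_def k_def by simp
    also have "\<dots> \<le> C1 * norm x ^ 3 + 2 * ((C1 + C2) * (norm x)\<^sup>2)\<^sup>2"
      using s0 k0 by (intro add_mono k mult_left_mono power_mono sk) auto
    also have "((C1 + C2) * (norm x)\<^sup>2)\<^sup>2 = (C1 + C2)\<^sup>2 * norm x ^ 4"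
      by (simp add: power_mult_distrib flip: power_mult)
    also have "C1 * norm x ^ 3 + 2 * ((C1 + C2)\<^sup>2 * norm x ^ 4) \<le> C1 * norm x ^ 3 + 2 * ((C1 + C2)\<^sup>2 * norm x ^ 3)"
      using xp(3) by (intro add_left_mono mult_left_mono) auto
    also have "\<dots> \<le> C * norm x ^ 3" unfolding C_def by (simp add: algebra_simps)
    finally have e1: "\<bar>ln (\<integral>w. exp (y w) \<partial>M) - s / 2\<bar> \<le> C * norm x ^ 3" .
    have s_eq: "s = (cov_matrix M W W *v x) \<bullet> x"
    proof -
      have "s = (\<integral>w. y w * (W w \<bullet> x) - (m \<bullet> x) * y w \<partial>M)"
        unfolding s_def y_def by (simp add: power2_eq_square inner_diff_left algebra_simps)
      also have "\<dots> = (\<integral>w. y w * (W w \<bullet> x) \<partial>M) - (m \<bullet> x) * (\<integral>w. y w \<partial>M)"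
      proof -
        have iy: "integrable M y" unfolding y_def using iW by simp
        have "integrable M (\<lambda>w. (y w)\<^sup>2 + (m \<bullet> x) * y w)" using i2 iy by simp
        then have "integrable M (\<lambda>w. y w * (W w \<bullet> x))"
          by (simp add: y_def power2_eq_square inner_diff_left algebra_simps)
        then show ?thesis using iy by simp
      qed
      also have "\<dots> = (cov_matrix M W W *v x) \<bullet> x"
        using cov_matrix_inner[OF iW iW iWW, of x x] mean unfolding y_def m_def by simp
      finally show ?thesis .
    qed
    have "(\<integral>w. exp (y w) \<partial>M) > 0"
    proof -
      have "integrable M (\<lambda>w. exp (y w))"
      proof (rule dom[of _ 1])
        fix w
        have "y w \<le> c * H w"
          using order_trans[OF y mult_left_mono[OF xc(1) b(6)]] by (simp add: mult.commute) (meson abs_ge_self order_trans)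
        then have "exp (y w) \<le> exp (c * H w)" by simp
        then show "norm (exp (y w)) \<le> 1 * exp (2 * c * H w)" using ee[of w] by simp
      qed simp
      then have "(\<integral>w. exp (y w) \<partial>M) \<noteq> 0"
        using integral_nonneg_eq_0_iff_AE[of M "\<lambda>w. exp (y w)"] by (simp add: AE_False)
      moreover have "(\<integral>w. exp (y w) \<partial>M) \<ge> 0" by simp
      ultimately show ?thesis by linarith
    qed
    moreover have "(\<integral>w. exp (W w \<bullet> x) \<partial>M) = exp (m \<bullet> x) * (\<integral>w. exp (y w) \<partial>M)"
      unfolding y_def by (simp add: inner_diff_left exp_diff)
    ultimately have "cumulant M W x = m \<bullet> x + ln (\<integral>w. exp (y w) \<partial>M)"
      unfolding cumulant_def by (simp add: ln_mult)
    then show ?thesis using e1 unfolding s_eq by simp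
  qed
  ultimately show ?thesis unfolding m_def by blast
qed

text \<open>How the tilted law of \<open>W\<close> looks from its untilted mean \<open>m\<close>: the displacement of the mean is linear in
\<open>u\<close> up to second order, the second moments are the untilted covariances up to first order. The moments
are taken about \<open>m\<close> and not about the tilted mean, because the linear term of the model cumulant is the
inner product with \<open>m\<close>, which leaves \<open>W - m\<close> in the log-likelihood.\<close>

definition tilted_moment_bounds ::
    "'w measure \<Rightarrow> ('w \<Rightarrow> real ^ 'd) \<Rightarrow> ('w \<Rightarrow> real ^ 'd) \<Rightarrow> real \<Rightarrow> real ^ 'd \<Rightarrow> bool" where
  "tilted_moment_bounds M W U C u \<longleftrightarrow> (let P = exp_tilt M U u; m = (\<integral>w. W w \<partial>M) in
     prob_space P \<and> integrable P (\<lambda>w. norm (W w - m) ^ 3) \<and> (\<integral>w. norm (W w - m) ^ 3 \<partial>P) \<le> C \<and>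
     (\<forall>x. integrable P (\<lambda>w. (W w - m) \<bullet> x) \<and>
       \<bar>(\<integral>w. (W w - m) \<bullet> x \<partial>P) - (cov_matrix M W U *v u) \<bullet> x\<bar> \<le> C * ((norm u)\<^sup>2 * norm x)) \<and>
     (\<forall>x y. integrable P (\<lambda>w. ((W w - m) \<bullet> x) * ((W w - m) \<bullet> y)) \<and>
       \<bar>(\<integral>w. ((W w - m) \<bullet> x) * ((W w - m) \<bullet> y) \<partial>P) - (cov_matrix M W W *v x) \<bullet> y\<bar>
         \<le> C * (norm u * norm x * norm y)))"

lemma tilted_moment_bounds_mono:
  assumes "tilted_moment_bounds M W U C u" "C \<le> C'"
  shows "tilted_moment_bounds M W U C' u"
proof -
  have "x \<le> C' * p" if "x \<le> C * p" "0 \<le> p" for x p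
    using that mult_right_mono[OF assms(2) that(2)] by linarith
  then show ?thesis
    using assms unfolding tilted_moment_bounds_def Let_def by (auto intro: order_trans[OF _ assms(2)])
qed

text \<open>Three applications of \<open>tilt_expansion\<close>. The linear functionals of \<open>W - m\<close> have mean \<open>0\<close> before
tilting, so for them the expansion has a first-order term, the covariance with \<open>U\<close>, and a quadratic
error; for the products and the third moment zeroth order is enough.\<close>

lemma tilted_moments:
  fixes W U :: "'w \<Rightarrow> real ^ 'd"
  assumes M: "prob_space M" and W[measurable]: "W \<in> borel_measurable M" and U[measurable]: "U \<in> borel_measurable M"
    and d: "d > 0" and int: "integrable M (\<lambda>x. exp (d * (norm (W x) + norm (U x))))"
  shows "\<exists>u0>0. \<exists>C>0. \<forall>u. norm u \<le> u0 \<longrightarrow> tilted_moment_bounds M W U C u"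
proof -
  interpret prob_space M by fact
  define m where "m = (\<integral>w. W w \<partial>M)"
  define H where "H w = norm (W w) + norm (U w) + norm m" for w
  have [measurable]: "H \<in> borel_measurable M" unfolding H_def by measurable
  define c where "c = d / 4"
  have c: "c > 0" unfolding c_def using d by simp
  have iH: "integrable M (\<lambda>w. exp (4 * c * H w))"
    using integrable_mult_right[OF int, of "exp (d * norm m)"]
    by (simp add: H_def c_def distrib_left exp_add mult_ac)
  have Hb: "norm (W w) + norm m \<le> H w" for w unfolding H_def by simp
  have HU: "norm (U w) \<le> H w" for w unfolding H_def by simp
  note b = centered_norm_bounds[of W, OF Hb c]
  obtain u0 C0 where u0: "u0 > 0" and C0: "C0 > 0" and T: "\<And>u. norm u \<le> u0 \<Longrightarrow> prob_space (exp_tilt M U u)"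
    and E: "\<And>u f k. norm u \<le> u0 \<Longrightarrow> f \<in> borel_measurable M \<Longrightarrow> 0 \<le> k \<Longrightarrow> (\<And>x. \<bar>f x\<bar> \<le> k * exp (c * H x)) \<Longrightarrow>
      integrable (exp_tilt M U u) f \<and>
      (\<integral>x. \<bar>f x\<bar> \<partial>exp_tilt M U u) \<le> C0 * k \<and>
      \<bar>(\<integral>x. f x \<partial>exp_tilt M U u) - (\<integral>x. f x \<partial>M)\<bar> \<le> C0 * k * norm u \<and>
      ((\<integral>x. f x \<partial>M) = 0 \<longrightarrow>
        \<bar>(\<integral>x. f x \<partial>exp_tilt M U u) - (\<integral>x. f x * (U x \<bullet> u) \<partial>M)\<bar> \<le> C0 * k * (norm u)\<^sup>2)"
    by (fact tilt_expansion[OF M U \<open>H \<in> borel_measurable M\<close> c HU iH])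
  have dom: "integrable M f" if [measurable]: "f \<in> borel_measurable M" and f: "\<And>w. norm (f w) \<le> k * exp (4 * c * H w)"
    for f :: "'w \<Rightarrow> 'z :: {banach, second_countable_topology}" and k
    by (rule Bochner_Integration.integrable_bound[OF integrable_mult_right[OF iH, of k]])
       (use f in \<open>auto intro!: AE_I2 order_trans[OF f] intro: order_trans[OF _ abs_ge_self]\<close>)
  have ee: "exp (c * H w) \<le> exp (4 * c * H w)" for w using c b(6)[of w] by (simp add: mult_right_mono)
  have H1: "H w \<le> (1 / c) * exp (4 * c * H w)" for w
    using order_trans[OF b(3) mult_left_mono[OF ee]] c by simp
  have iW: "integrable M W"
    by (rule dom[OF _ order_trans[OF _ H1]]) (auto simp: H_def)
  have iU: "integrable M U"
    by (rule dom[OF _ order_trans[OF _ H1]]) (auto simp: H_def)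
  have H2: "\<bar>p * q\<bar> \<le> (2 / c)\<^sup>2 * exp (c * H w)" if "\<bar>p\<bar> \<le> H w" "\<bar>q\<bar> \<le> H w" for p q w
  proof -
    have "\<bar>p\<bar> * \<bar>q\<bar> \<le> H w * H w" using that b by (intro mult_mono) auto
    also have "\<dots> \<le> (2 / c)\<^sup>2 * exp (c * H w)" using b(4)[of w] by (simp add: power2_eq_square)
    finally show ?thesis by (simp add: abs_mult)
  qed
  have H2': "\<bar>p * q\<bar> \<le> (2 / c)\<^sup>2 * exp (4 * c * H w)" if "\<bar>p\<bar> \<le> H w" "\<bar>q\<bar> \<le> H w" for p q w
    by (rule order_trans[OF H2[OF that] mult_left_mono[OF ee]]) simp
  have comp: "\<bar>W w $ i\<bar> \<le> H w" "\<bar>U w $ i\<bar> \<le> H w" for w i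
    using component_le_norm_cart[of "W w" i] component_le_norm_cart[of "U w" i] unfolding H_def
    by (meson add_increasing2 add_increasing norm_ge_zero order_trans)+
  have iWW: "integrable M (\<lambda>w. W w $ i * W w $ j)" for i j
    by (rule dom[OF _ H2'[THEN order_trans[OF eq_refl[OF real_norm_def]]]]) (use comp in auto)
  have iWU: "integrable M (\<lambda>w. W w $ i * U w $ j)" for i j
    by (rule dom[OF _ H2'[THEN order_trans[OF eq_refl[OF real_norm_def]]]]) (use comp in auto)
  have mean: "(\<integral>w. (W w - m) \<bullet> x \<partial>M) = 0" for x
    using iW by (simp add: inner_diff_left m_def prob_space)
  have covWU: "(\<integral>w. ((W w - m) \<bullet> x) * (U w \<bullet> u) \<partial>M) = (cov_matrix M W U *v u) \<bullet> x" for x u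
    unfolding m_def by (rule cov_matrix_inner[OF iW iU iWU])
  have b2: "\<bar>((W w - m) \<bullet> x) * ((W w - m) \<bullet> y)\<bar> \<le> ((2 / c)\<^sup>2 * norm x * norm y) * exp (c * H w)" for w x y
  proof -
    have "\<bar>((W w - m) \<bullet> x) * ((W w - m) \<bullet> y)\<bar> \<le> (H w * norm x) * (H w * norm y)"
      unfolding abs_mult by (intro mult_mono b(2)) (auto intro: mult_nonneg_nonneg b(6))
    also have "\<dots> = (H w)\<^sup>2 * (norm x * norm y)" by (simp add: power2_eq_square)
    also have "\<dots> \<le> ((2 / c)\<^sup>2 * exp (c * H w)) * (norm x * norm y)" by (intro mult_right_mono b(4)) auto
    finally show ?thesis by (simp add: mult_ac)
  qed
  have covWW: "(\<integral>w. ((W w - m) \<bullet> x) * ((W w - m) \<bullet> y) \<partial>M) = (cov_matrix M W W *v x) \<bullet> y" for x y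
  proof -
    have i1: "integrable M (\<lambda>w. (W w - m) \<bullet> y)" using iW by simp
    have i2: "integrable M (\<lambda>w. ((W w - m) \<bullet> x) * ((W w - m) \<bullet> y))"
      by (rule dom[of _ "(2 / c)\<^sup>2 * norm x * norm y"])
         (use order_trans[OF b2 mult_left_mono[OF ee]] in auto)
    have "integrable M (\<lambda>w. ((W w - m) \<bullet> x) * ((W w - m) \<bullet> y) + (m \<bullet> x) * ((W w - m) \<bullet> y))"
      using i1 i2 by simp
    then have "integrable M (\<lambda>w. ((W w - m) \<bullet> y) * (W w \<bullet> x))"
      by (simp add: inner_diff_left algebra_simps)
    moreover have "((W w - m) \<bullet> x) * ((W w - m) \<bullet> y) = ((W w - m) \<bullet> y) * (W w \<bullet> x) - (m \<bullet> x) * ((W w - m) \<bullet> y)" for w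
      by (simp add: inner_diff_left algebra_simps)
    ultimately have "(\<integral>w. ((W w - m) \<bullet> x) * ((W w - m) \<bullet> y) \<partial>M) = (\<integral>w. ((W w - m) \<bullet> y) * (W w \<bullet> x) \<partial>M)"
      using i1 mean[of y] by simp
    also have "\<dots> = (cov_matrix M W W *v x) \<bullet> y"
      unfolding m_def by (rule cov_matrix_inner[OF iW iW iWW])
    finally show ?thesis .
  qed
  define C where "C = C0 * ((1 / c) + (2 / c)\<^sup>2 + (3 / c) ^ 3)"
  have C: "C > 0" "C0 * (1 / c) \<le> C" "C0 * (2 / c)\<^sup>2 \<le> C" "C0 * (3 / c) ^ 3 \<le> C"
  proof -
    have p: "1 / c > 0" "(2 / c)\<^sup>2 > 0" "(3 / c) ^ 3 > 0" using c by auto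
    show "C > 0" unfolding C_def using C0 p by (intro mult_pos_pos add_pos_pos)
    show "C0 * (1 / c) \<le> C" "C0 * (2 / c)\<^sup>2 \<le> C" "C0 * (3 / c) ^ 3 \<le> C"
      unfolding C_def using C0 p by (intro mult_left_mono; linarith)+
  qed
  {
    fix u :: "real ^ 'd" assume u: "norm u \<le> u0"
    have 3: "integrable (exp_tilt M U u) (\<lambda>w. norm (W w - m) ^ 3)" "(\<integral>w. norm (W w - m) ^ 3 \<partial>exp_tilt M U u) \<le> C"
    proof -
      have "\<bar>norm (W w - m) ^ 3\<bar> \<le> (3 / c) ^ 3 * exp (c * H w)" for w
        using order_trans[OF power_mono[OF b(1) norm_ge_zero] b(5)] by simp
      from E[OF u _ _ this] c C(4) show "integrable (exp_tilt M U u) (\<lambda>w. norm (W w - m) ^ 3)" "(\<integral>w. norm (W w - m) ^ 3 \<partial>exp_tilt M U u) \<le> C"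
        by auto
    qed
    have 1: "integrable (exp_tilt M U u) (\<lambda>w. (W w - m) \<bullet> x)"
      "\<bar>(\<integral>w. (W w - m) \<bullet> x \<partial>exp_tilt M U u) - (cov_matrix M W U *v u) \<bullet> x\<bar> \<le> C * ((norm u)\<^sup>2 * norm x)" for x
    proof -
      have "\<bar>(W w - m) \<bullet> x\<bar> \<le> (1 / c * norm x) * exp (c * H w)" for w
        using order_trans[OF b(2) mult_right_mono[OF b(3)]] by (simp add: mult_ac)
      note e = E[OF u _ _ this]
      show "integrable (exp_tilt M U u) (\<lambda>w. (W w - m) \<bullet> x)" using e c by simp
      have "\<bar>(\<integral>w. (W w - m) \<bullet> x \<partial>exp_tilt M U u) - (\<integral>w. ((W w - m) \<bullet> x) * (U w \<bullet> u) \<partial>M)\<bar> \<le> C0 * (1 / c * norm x) * (norm u)\<^sup>2"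
        using e c mean by simp
      also have "\<dots> = (C0 * (1 / c)) * ((norm u)\<^sup>2 * norm x)" by simp
      also have "\<dots> \<le> C * ((norm u)\<^sup>2 * norm x)" by (intro mult_right_mono C) auto
      finally show "\<bar>(\<integral>w. (W w - m) \<bullet> x \<partial>exp_tilt M U u) - (cov_matrix M W U *v u) \<bullet> x\<bar> \<le> C * ((norm u)\<^sup>2 * norm x)"
        unfolding covWU .
    qed
    have 2: "integrable (exp_tilt M U u) (\<lambda>w. ((W w - m) \<bullet> x) * ((W w - m) \<bullet> y))"
      "\<bar>(\<integral>w. ((W w - m) \<bullet> x) * ((W w - m) \<bullet> y) \<partial>exp_tilt M U u) - (cov_matrix M W W *v x) \<bullet> y\<bar>
        \<le> C * (norm u * norm x * norm y)" for x y
    proof -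
      note e = E[OF u _ _ b2]
      show "integrable (exp_tilt M U u) (\<lambda>w. ((W w - m) \<bullet> x) * ((W w - m) \<bullet> y))" using e by simp
      have "\<bar>(\<integral>w. ((W w - m) \<bullet> x) * ((W w - m) \<bullet> y) \<partial>exp_tilt M U u) - (cov_matrix M W W *v x) \<bullet> y\<bar> \<le> C0 * ((2 / c)\<^sup>2 * norm x * norm y) * norm u"
        using e[of x y] unfolding covWW by simp
      also have "\<dots> = (C0 * (2 / c)\<^sup>2) * (norm u * norm x * norm y)" by simp
      also have "\<dots> \<le> C * (norm u * norm x * norm y)" by (intro mult_right_mono C) auto
      finally show "\<bar>(\<integral>w. ((W w - m) \<bullet> x) * ((W w - m) \<bullet> y) \<partial>exp_tilt M U u) - (cov_matrix M W W *v x) \<bullet> y\<bar>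
        \<le> C * (norm u * norm x * norm y)" .
    qed
    have "tilted_moment_bounds M W U C u"
      unfolding tilted_moment_bounds_def Let_def m_def[symmetric] using T[OF u] 3 1 2 by blast
  }
  then show ?thesis using u0 C(1) by blast
qed

lemma matrix_bound:
  fixes A :: "real ^ 'd ^ 'd"
  obtains a where "a \<ge> 0" "\<And>v. norm (A *v v) \<le> a * norm v"
  using that[of "onorm ((*v) A)"] onorm[OF matrix_vector_mul_bounded_linear, of A]
    onorm_pos_le[OF matrix_vector_mul_bounded_linear, of A] by auto

lemma cumulant_measurable:
  fixes W :: "'w \<Rightarrow> real ^ 'd"
  assumes M: "prob_space M" and [measurable]: "W \<in> borel_measurable M"
  shows "cumulant M W \<in> borel_measurable borel"
proof -
  interpret prob_space M by fact
  have "(\<lambda>(u, x). exp (W x \<bullet> u)) \<in> borel_measurable (borel \<Otimes>\<^sub>M M)" by measurable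
  then have "(\<lambda>u. \<integral>x. exp (W x \<bullet> u) \<partial>M) \<in> borel_measurable borel"
    by (rule borel_measurable_lebesgue_integral)
  then show ?thesis unfolding cumulant_def[abs_def] by measurable
qed

text \<open>Everything that the comparison needs to know about the two exponential families, with one radius
\<open>u0\<close> and one constant \<open>C\<close>, so that the estimate at a single \<open>n\<close> and \<open>\<theta>\<close> is visibly uniform.\<close>

definition moment_estimates ::
    "'w measure \<Rightarrow> 'w measure \<Rightarrow> ('w \<Rightarrow> real ^ 'd) \<Rightarrow> ('w \<Rightarrow> real ^ 'd) \<Rightarrow> real \<Rightarrow> real \<Rightarrow> bool" where
  "moment_estimates lam gam W U u0 C \<longleftrightarrow>
     (\<forall>v. norm (cov_matrix gam W U *v v) \<le> C * norm v \<and> norm (cov_matrix gam W W *v v) \<le> C * norm v \<and>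
          norm (cov_matrix lam W W *v v) \<le> C * norm v) \<and>
     (\<forall>x. norm x \<le> u0 \<longrightarrow>
        \<bar>cumulant lam W x - (\<integral>w. W w \<partial>gam) \<bullet> x - (1 / 2) * ((cov_matrix lam W W *v x) \<bullet> x)\<bar> \<le> C * norm x ^ 3) \<and>
     (\<forall>u. norm u \<le> u0 \<longrightarrow> tilted_moment_bounds gam W U C u)"

text \<open>The product \<open>exp (d * norm (W x)) * exp (d * norm (U x))\<close> is at most the sum of the two squares, so
joint exponential moments follow from those of \<open>W\<close> and of \<open>U\<close>.\<close>

lemma regularity_exp_norm:
  fixes W U :: "'w \<Rightarrow> real ^ 'd"
  assumes base: "prob_space lam" "prob_space gam" "sets lam = sets gam"
    and W[measurable]: "W \<in> borel_measurable gam" and U[measurable]: "U \<in> borel_measurable gam"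
    and reg: "local_exp_family_regularity lam gam W U"
  obtains d where "d > 0" "integrable lam (\<lambda>x. exp (d * norm (W x)))"
    "integrable gam (\<lambda>x. exp (d * (norm (W x) + norm (U x))))" "integrable gam (\<lambda>x. exp (d * norm (W x)))"
proof -
  have Wl: "W \<in> borel_measurable lam" using W by (simp add: measurable_cong_sets[OF base(3) refl])
  obtain \<rho> where \<rho>: "\<rho> > 0" "\<And>u. norm u < \<rho> \<Longrightarrow> integrable lam (\<lambda>x. exp (W x \<bullet> u))"
      "\<And>u. norm u < \<rho> \<Longrightarrow> integrable gam (\<lambda>x. exp (U x \<bullet> u))"
      "\<And>v u. norm v < \<rho> \<Longrightarrow> norm u < \<rho> \<Longrightarrow> integrable gam (\<lambda>x. exp (W x \<bullet> v + U x \<bullet> u))"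
    using reg unfolding local_exp_family_regularity_def by blast
  have \<rho>W: "integrable gam (\<lambda>x. exp (W x \<bullet> u))" if "norm u < \<rho>" for u
    using \<rho>(4)[OF that, of 0] \<rho>(1) by simp
  obtain c1 where c1: "c1 > 0" "integrable lam (\<lambda>x. exp (c1 * norm (W x)))"
    using exp_norm_integrable[OF Wl \<rho>(1,2)] by blast
  obtain c2 where c2: "c2 > 0" "integrable gam (\<lambda>x. exp (c2 * norm (W x)))"
    using exp_norm_integrable[OF W \<rho>(1) \<rho>W] by blast
  obtain c3 where c3: "c3 > 0" "integrable gam (\<lambda>x. exp (c3 * norm (U x)))"
    using exp_norm_integrable[OF U \<rho>(1,3)] by blast
  \<comment> \<open>The factor \<open>1 / 2\<close> pays for splitting the product into a sum of squares.\<close>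
  define d where "d = min c1 (min (c2 / 2) (c3 / 2))"
  have d: "d > 0" "d \<le> c1" "2 * d \<le> c2" "2 * d \<le> c3" using c1 c2 c3 unfolding d_def by auto
  have mono: "integrable M (\<lambda>x. exp (d' * norm (V x)))"
    if "integrable M (\<lambda>x. exp (c * norm (V x)))" "d' \<le> c" "V \<in> borel_measurable M"
    for M :: "'w measure" and V :: "'w \<Rightarrow> real ^ 'd" and c d'
  proof (rule integrable_dominated[OF that(1)])
    show "(\<lambda>x. exp (d' * norm (V x))) \<in> borel_measurable M" using that(3) by measurable
    show "norm (exp (d' * norm (V x))) \<le> exp (c * norm (V x))" for x
      using that(2) by (auto intro!: mult_right_mono)
  qed
  have "integrable gam (\<lambda>x. exp (2 * d * norm (W x)) + exp (2 * d * norm (U x)))"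
    using mono[OF c2(2) d(3) W] mono[OF c3(2) d(4) U] by simp
  then have joint: "integrable gam (\<lambda>x. exp (d * (norm (W x) + norm (U x))))"
  proof (rule integrable_dominated)
    show "(\<lambda>x. exp (d * (norm (W x) + norm (U x)))) \<in> borel_measurable gam" by measurable
    fix x
    have "exp (d * (p + q)) \<le> exp (2 * d * p) + exp (2 * d * q)" for p q :: real
    proof (cases "p \<le> q")
      case True
      then have "d * (p + q) \<le> 2 * d * q" using d(1) mult_left_mono[of p q d] by (simp add: distrib_left)
      then show ?thesis by (simp add: add_increasing)
    next
      case False
      then have "d * (p + q) \<le> 2 * d * p" using d(1) mult_left_mono[of q p d] by (simp add: distrib_left)
      then show ?thesis by (simp add: add_increasing2)
    qed
    then show "norm (exp (d * (norm (W x) + norm (U x)))) \<le> exp (2 * d * norm (W x)) + exp (2 * d * norm (U x))"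
      by simp
  qed
  have "d \<le> c2" using d(1,3) by linarith
  then show ?thesis
    using that[OF d(1) mono[OF c1(2) d(2) Wl] joint] mono[OF c2(2) _ W] by blast
qed

lemma moment_estimates_exist:
  fixes W U :: "'w \<Rightarrow> real ^ 'd"
  assumes base: "prob_space lam" "prob_space gam" "sets lam = sets gam"
    and W: "W \<in> borel_measurable gam" and U: "U \<in> borel_measurable gam"
    and reg: "local_exp_family_regularity lam gam W U"
  obtains u0 C where "0 < u0" "u0 \<le> 1" "1 \<le> C" "moment_estimates lam gam W U u0 C"
proof -
  have Wl: "W \<in> borel_measurable lam" using W by (simp add: measurable_cong_sets[OF base(3) refl])
  have mean: "(\<integral>w. W w \<partial>lam) = (\<integral>w. W w \<partial>gam)" using reg unfolding local_exp_family_regularity_def by blast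
  obtain d where d: "d > 0" "integrable lam (\<lambda>x. exp (d * norm (W x)))"
    "integrable gam (\<lambda>x. exp (d * (norm (W x) + norm (U x))))" "integrable gam (\<lambda>x. exp (d * norm (W x)))"
    by (rule regularity_exp_norm[OF base W U reg])
  obtain u1 C1 where L: "u1 > 0" "C1 > 0" "\<forall>x. norm x \<le> u1 \<longrightarrow>
      \<bar>cumulant lam W x - (\<integral>w. W w \<partial>gam) \<bullet> x - (1 / 2) * ((cov_matrix lam W W *v x) \<bullet> x)\<bar> \<le> C1 * norm x ^ 3"
    using cumulant_taylor[OF base(1) Wl d(1,2)] unfolding mean by blast
  let ?m = "\<integral>w. W w \<partial>gam"
  obtain u2 C2 where "u2 > 0" "C2 > 0" and G: "\<forall>u. norm u \<le> u2 \<longrightarrow> tilted_moment_bounds gam W U C2 u"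
    using tilted_moments[OF base(2) W U d(1,3)] by blast
  obtain a1 where a1: "a1 \<ge> 0" "\<And>v. norm (cov_matrix gam W U *v v) \<le> a1 * norm v" using matrix_bound by blast
  obtain a2 where a2: "a2 \<ge> 0" "\<And>v. norm (cov_matrix gam W W *v v) \<le> a2 * norm v" using matrix_bound by blast
  obtain a3 where a3: "a3 \<ge> 0" "\<And>v. norm (cov_matrix lam W W *v v) \<le> a3 * norm v" using matrix_bound by blast
  define C where "C = 1 + C1 + C2 + a1 + a2 + a3"
  have C: "C1 \<le> C" "C2 \<le> C" "a1 \<le> C" "a2 \<le> C" "a3 \<le> C" "1 \<le> C"
    unfolding C_def using L(2) \<open>C2 > 0\<close> a1(1) a2(1) a3(1) by auto
  define u0 where "u0 = min 1 (min u1 u2)"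
  have u0: "0 < u0" "u0 \<le> 1" "u0 \<le> u1" "u0 \<le> u2" unfolding u0_def using L(1) \<open>u2 > 0\<close> by auto
  have "moment_estimates lam gam W U u0 C"
    unfolding moment_estimates_def
  proof (intro conjI allI impI)
    fix v
    show "norm (cov_matrix gam W U *v v) \<le> C * norm v"
      by (rule order_trans[OF a1(2) mult_right_mono[OF C(3)]]) simp
    show "norm (cov_matrix gam W W *v v) \<le> C * norm v"
      by (rule order_trans[OF a2(2) mult_right_mono[OF C(4)]]) simp
    show "norm (cov_matrix lam W W *v v) \<le> C * norm v"
      by (rule order_trans[OF a3(2) mult_right_mono[OF C(5)]]) simp
  next
    fix x :: "real ^ 'd" assume "norm x \<le> u0"
    then have "norm x \<le> u1" using u0 by linarith
    then have "\<bar>cumulant lam W x - ?m \<bullet> x - (1 / 2) * ((cov_matrix lam W W *v x) \<bullet> x)\<bar> \<le> C1 * norm x ^ 3"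
      using L(3) by blast
    also have "\<dots> \<le> C * norm x ^ 3" by (intro mult_right_mono C) auto
    finally show "\<bar>cumulant lam W x - ?m \<bullet> x - (1 / 2) * ((cov_matrix lam W W *v x) \<bullet> x)\<bar> \<le> C * norm x ^ 3" .
  next
    fix u :: "real ^ 'd" assume "norm u \<le> u0"
    then have "norm u \<le> u2" using u0 by linarith
    then show "tilted_moment_bounds gam W U C u"
      using G tilted_moment_bounds_mono[OF _ C(2)] by blast
  qed
  then show ?thesis using that u0 C(6) by blast
qed

lemma hessians_eq_cov_matrix:
  fixes W U :: "'w \<Rightarrow> real ^ 'd"
  assumes base: "prob_space lam" "prob_space gam" "sets lam = sets gam"
    and W: "W \<in> borel_measurable gam" and U: "U \<in> borel_measurable gam"
    and reg: "local_exp_family_regularity lam gam W U"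
  shows "mixed_hessian (joint_cumulant gam W U) 0 0 = cov_matrix gam W U"
    and "hessian (\<lambda>v. joint_cumulant gam W U v 0) 0 = cov_matrix gam W W"
    and "hessian (cumulant lam W) 0 = cov_matrix lam W W"
proof -
  have Wl: "W \<in> borel_measurable lam" using W by (simp add: measurable_cong_sets[OF base(3) refl])
  obtain d where d: "d > 0" "integrable lam (\<lambda>x. exp (d * norm (W x)))"
    "integrable gam (\<lambda>x. exp (d * (norm (W x) + norm (U x))))" "integrable gam (\<lambda>x. exp (d * norm (W x)))"
    by (rule regularity_exp_norm[OF base W U reg])
  show "mixed_hessian (joint_cumulant gam W U) 0 0 = cov_matrix gam W U"
    by (rule mixed_hessian_joint_cumulant[OF base(2) W U d(1,3)])
  have "(\<lambda>v. joint_cumulant gam W U v 0) = cumulant gam W"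
    by (simp add: joint_cumulant_def cumulant_def fun_eq_iff)
  then show "hessian (\<lambda>v. joint_cumulant gam W U v 0) 0 = cov_matrix gam W W"
    using hessian_cumulant[OF base(2) W d(1,4)] by simp
  show "hessian (cumulant lam W) 0 = cov_matrix lam W W"
    by (rule hessian_cumulant[OF base(1) Wl d(1,2)])
qed

section \<open>Gaussian processes with bilinear covariance\<close>

text \<open>For standard deviation \<open>\<sigma>\<close> the third absolute central moment is \<open>2 * sqrt (2 / \<pi>) * \<sigma>\<^sup>3\<close>. The last
conclusion allows any upper bound \<open>s\<close> of the standard deviation, so that one constant serves all
components.\<close>

lemma gaussian_rv_moments:
  fixes Z :: "'q \<Rightarrow> real"
  assumes Q: "prob_space Q" and Z: "gaussian_rv Q Z"
  defines "c \<equiv> \<integral>x. Z x \<partial>Q"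
  shows "integrable Q Z" "integrable Q (\<lambda>x. (Z x)\<^sup>2)" "integrable Q (\<lambda>x. \<bar>Z x - c\<bar> ^ 3)"
    and "\<And>s. 0 \<le> s \<Longrightarrow> (\<integral>x. (Z x - c)\<^sup>2 \<partial>Q) \<le> s\<^sup>2 \<Longrightarrow> (\<integral>x. \<bar>Z x - c\<bar> ^ 3 \<partial>Q) \<le> 2 * s ^ 3"
proof -
  interpret prob_space Q by fact
  have [measurable]: "Z \<in> borel_measurable Q" using Z unfolding gaussian_rv_def by blast
  have *: "integrable Q Z \<and> integrable Q (\<lambda>x. (Z x)\<^sup>2) \<and> integrable Q (\<lambda>x. \<bar>Z x - c\<bar> ^ 3) \<and>
     (\<forall>s. 0 \<le> s \<longrightarrow> (\<integral>x. (Z x - c)\<^sup>2 \<partial>Q) \<le> s\<^sup>2 \<longrightarrow> (\<integral>x. \<bar>Z x - c\<bar> ^ 3 \<partial>Q) \<le> 2 * s ^ 3)"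
  proof -
    consider (normal) \<mu> \<sigma> where "\<sigma> > 0" "distributed Q lborel Z (\<lambda>z. ennreal (normal_density \<mu> \<sigma> z))"
      | (const) \<mu> where "AE x in Q. Z x = \<mu>"
      using Z unfolding gaussian_rv_def by blast
    then show ?thesis
    proof cases
      case normal
      note \<sigma> = normal(1) and D = normal(2)
      have c: "c = \<mu>" unfolding c_def by (rule normal_distributed_expectation[OF \<sigma> D])
      have var: "(\<integral>x. (Z x - c)\<^sup>2 \<partial>Q) = \<sigma>\<^sup>2"
        using normal_distributed_variance[OF \<sigma> D] unfolding c_def .
      have i1: "integrable Q Z"
        using distributed_integrable[OF D, of "\<lambda>x. x"] integrable_normal_moment_nz_1[OF \<sigma>] by simp
      have i2: "integrable Q (\<lambda>x. (Z x - \<mu>)\<^sup>2)"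
        using distributed_integrable[OF D, of "\<lambda>x. (x - \<mu>)\<^sup>2"] integrable_normal_moment[OF \<sigma>, of \<mu> 2] by simp
      have "integrable Q (\<lambda>x. (Z x - \<mu>)\<^sup>2 + 2 * \<mu> * Z x - \<mu>\<^sup>2)" using i1 i2 by simp
      then have i2': "integrable Q (\<lambda>x. (Z x)\<^sup>2)" by (simp add: power2_eq_square algebra_simps)
      have i3: "integrable Q (\<lambda>x. \<bar>Z x - \<mu>\<bar> ^ 3)"
        using distributed_integrable[OF D, of "\<lambda>x. \<bar>x - \<mu>\<bar> ^ 3"] integrable_normal_moment_abs[OF \<sigma>, of \<mu> 3] by simp
      have "(\<integral>x. \<bar>Z x - \<mu>\<bar> ^ 3 \<partial>Q) = (\<integral>x. normal_density \<mu> \<sigma> x * \<bar>x - \<mu>\<bar> ^ 3 \<partial>lborel)"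
        using distributed_integral[OF D, of "\<lambda>x. \<bar>x - \<mu>\<bar> ^ 3"] by simp
      also have "\<dots> = 2 * \<sigma> ^ 3 * sqrt (2 / pi)"
        using integral_normal_moment_abs_odd[OF \<sigma>, of \<mu> 1] by (simp add: numeral_3_eq_3)
      also have "\<dots> \<le> 2 * \<sigma> ^ 3 * 1"
        using \<sigma> pi_gt3 by (intro mult_left_mono) auto
      finally have 3: "(\<integral>x. \<bar>Z x - \<mu>\<bar> ^ 3 \<partial>Q) \<le> 2 * \<sigma> ^ 3" by simp
      have "(\<integral>x. \<bar>Z x - \<mu>\<bar> ^ 3 \<partial>Q) \<le> 2 * s ^ 3" if "0 \<le> s" "\<sigma>\<^sup>2 \<le> s\<^sup>2" for s
      proof -
        have "\<sigma> \<le> s" using that by (rule power2_le_imp_le[rotated])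
        then have "\<sigma> ^ 3 \<le> s ^ 3" using \<sigma> by (intro power_mono) auto
        then show ?thesis using 3 by simp
      qed
      then show ?thesis using i1 i2' i3 var unfolding c by auto
    next
      case const
      have c: "c = \<mu>" unfolding c_def using integral_cong_AE[of Z Q "\<lambda>_. \<mu>"] const by (simp add: prob_space)
      have 3: "AE x in Q. \<bar>Z x - c\<bar> ^ 3 = 0" using const by eventually_elim (simp add: c)
      have "integrable Q Z" using const by (subst integrable_cong_AE[where g="\<lambda>_. \<mu>"]) auto
      moreover have "integrable Q (\<lambda>x. (Z x)\<^sup>2)"
        using const by (subst integrable_cong_AE[where g="\<lambda>_. \<mu>\<^sup>2"]) auto
      moreover have "integrable Q (\<lambda>x. \<bar>Z x - c\<bar> ^ 3)"
        using 3 by (subst integrable_cong_AE[where g="\<lambda>_. 0"]) auto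
      moreover have "(\<integral>x. \<bar>Z x - c\<bar> ^ 3 \<partial>Q) = 0"
        using integral_cong_AE[OF _ _ 3] by simp
      ultimately show ?thesis by simp
    qed
  qed
  show "integrable Q Z" "integrable Q (\<lambda>x. (Z x)\<^sup>2)" "integrable Q (\<lambda>x. \<bar>Z x - c\<bar> ^ 3)"
    "\<And>s. 0 \<le> s \<Longrightarrow> (\<integral>x. (Z x - c)\<^sup>2 \<partial>Q) \<le> s\<^sup>2 \<Longrightarrow> (\<integral>x. \<bar>Z x - c\<bar> ^ 3 \<partial>Q) \<le> 2 * s ^ 3"
    using * by blast+
qed

lemma sum_cube_le:
  fixes a :: "'i \<Rightarrow> real"
  assumes "finite B" "\<And>i. i \<in> B \<Longrightarrow> 0 \<le> a i"
  shows "(\<Sum>i\<in>B. a i) ^ 3 \<le> real (card B) ^ 3 * (\<Sum>i\<in>B. a i ^ 3)"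
proof (cases "B = {}")
  case False
  have "Max (a ` B) \<in> a ` B" using assms(1) False by (intro Max_in) auto
  then obtain j where j: "j \<in> B" "Max (a ` B) = a j" by auto
  have "(\<Sum>i\<in>B. a i) \<le> card B * a j"
    using assms(1) by (intro sum_bounded_above) (simp flip: j(2))
  then have "(\<Sum>i\<in>B. a i) ^ 3 \<le> (card B * a j) ^ 3"
    using assms(2) by (intro power_mono sum_nonneg) auto
  also have "\<dots> = real (card B) ^ 3 * a j ^ 3" by (rule power_mult_distrib)
  also have "\<dots> \<le> real (card B) ^ 3 * (\<Sum>i\<in>B. a i ^ 3)"
    using assms j by (intro mult_left_mono member_le_sum) auto
  finally show ?thesis .
qed simp

text \<open>A process whose covariance is bilinear in \<open>h\<close> is, after centring, linear in \<open>h\<close>: a linear combination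
of its values whose feature combination vanishes has variance \<open>0\<close>. The vector is built from an
orthonormal basis \<open>B\<close> of the span of the features. Each \<open>e\<close> in \<open>B\<close> is a combination of features, and
the same combination of process values is a Gaussian variable with variance \<open>(S *v e) \<bullet> e \<le> s\<^sup>2\<close>.
Orthonormality matters: for an arbitrary basis the third moment would not be bounded independently of
the features. The vector is given as a function of the path on \<open>T\<close>, since independence of the
components is assumed for the paths.\<close>

lemma gaussian_process_linear_representation:
  fixes Y :: "'a \<Rightarrow> 'q \<Rightarrow> real" and h :: "'a \<Rightarrow> real ^ 'd"
  assumes Q: "prob_space Q" and gp: "gaussian_process Q T Y"
    and mean: "\<And>t. t \<in> T \<Longrightarrow> (\<integral>x. Y t x \<partial>Q) = b t"
    and cov: "\<And>s t. s \<in> T \<Longrightarrow> t \<in> T \<Longrightarrow> covariance Q (Y s) (Y t) = (S *v h s) \<bullet> h t"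
    and s: "0 \<le> s" "\<And>v. (S *v v) \<bullet> v \<le> s\<^sup>2 * (norm v)\<^sup>2"
  obtains F :: "('a \<Rightarrow> real) \<Rightarrow> real ^ 'd"
    where "F \<in> borel_measurable (PiM T (\<lambda>_. borel))"
      and "\<And>t. t \<in> T \<Longrightarrow> AE x in Q. Y t x = F (\<lambda>t\<in>T. Y t x) \<bullet> h t + b t"
      and "integrable Q (\<lambda>x. norm (F (\<lambda>t\<in>T. Y t x)) ^ 3)"
      and "(\<integral>x. norm (F (\<lambda>t\<in>T. Y t x)) ^ 3 \<partial>Q) \<le> 2 * real CARD('d) ^ 4 * s ^ 3"
proof -
  interpret prob_space Q by fact
  have grv: "gaussian_rv Q (\<lambda>x. \<Sum>t\<in>U. c t * Y t x)" if "finite U" "U \<subseteq> T" for U c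
    using gp that unfolding gaussian_process_def by blast
  have gY: "gaussian_rv Q (Y t)" if "t \<in> T" for t
    using grv[of "{t}" "\<lambda>_. 1"] that by simp
  have [measurable]: "Y t \<in> borel_measurable Q" if "t \<in> T" for t
    using gY[OF that] unfolding gaussian_rv_def by blast
  note iY = gaussian_rv_moments(1,2)[OF Q gY]
  define Z where "Z t x = Y t x - b t" for t x
  have mZ[measurable]: "Z t \<in> borel_measurable Q" if "t \<in> T" for t
    unfolding Z_def using that by measurable
  have iZ2: "integrable Q (\<lambda>x. (Z t x)\<^sup>2)" if "t \<in> T" for t
    unfolding Z_def using iY[OF that] by (rule integrable_shifted_square)
  have iZZ: "integrable Q (\<lambda>x. Z u x * Z t x)" if "u \<in> T" "t \<in> T" for u t
    by (intro integrable_mult_of_squares mZ iZ2 that)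
  have covZ: "(\<integral>x. Z u x * Z t x \<partial>Q) = (S *v h u) \<bullet> h t" if "u \<in> T" "t \<in> T" for u t
    using cov[OF that] mean that unfolding covariance_def Z_def by simp
  have var: "(\<integral>x. (\<Sum>t\<in>U. c t * Z t x)\<^sup>2 \<partial>Q) = (S *v (\<Sum>t\<in>U. c t *\<^sub>R h t)) \<bullet> (\<Sum>t\<in>U. c t *\<^sub>R h t)"
    and var_int: "integrable Q (\<lambda>x. (\<Sum>t\<in>U. c t * Z t x)\<^sup>2)"
    if U: "finite U" "U \<subseteq> T" for U c
  proof -
    have eq: "(\<lambda>x. (\<Sum>t\<in>U. c t * Z t x)\<^sup>2) = (\<lambda>x. \<Sum>u\<in>U. \<Sum>t\<in>U. (c u * c t) * (Z u x * Z t x))"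
      unfolding power2_eq_square sum_product by (intro ext sum.cong refl) simp
    have i: "integrable Q (\<lambda>x. (c u * c t) * (Z u x * Z t x))" if "u \<in> U" "t \<in> U" for u t
      by (intro integrable_mult_right iZZ) (use that U(2) in auto)
    show "integrable Q (\<lambda>x. (\<Sum>t\<in>U. c t * Z t x)\<^sup>2)"
      unfolding eq by (intro Bochner_Integration.integrable_sum i)
    have "(\<integral>x. (\<Sum>t\<in>U. c t * Z t x)\<^sup>2 \<partial>Q) = (\<Sum>u\<in>U. \<Sum>t\<in>U. \<integral>x. (c u * c t) * (Z u x * Z t x) \<partial>Q)"
      unfolding eq using i by (simp add: Bochner_Integration.integral_sum)
    also have "\<dots> = (\<Sum>u\<in>U. \<Sum>t\<in>U. (c u * c t) * ((S *v h u) \<bullet> h t))"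
      using covZ U by (intro sum.cong refl) (auto simp: subset_iff)
    also have "\<dots> = (S *v (\<Sum>t\<in>U. c t *\<^sub>R h t)) \<bullet> (\<Sum>t\<in>U. c t *\<^sub>R h t)"
    proof -
      have "S *v (\<Sum>t\<in>U. c t *\<^sub>R h t) = (\<Sum>t\<in>U. c t *\<^sub>R (S *v h t))"
        by (simp add: linear_sum[OF matrix_vector_mul_linear] matrix_vector_mult_scaleR)
      then show ?thesis
        by (simp add: inner_sum_left inner_sum_right sum_distrib_left mult.assoc)
           (subst sum.swap, simp add: mult.left_commute)
    qed
    finally show "(\<integral>x. (\<Sum>t\<in>U. c t * Z t x)\<^sup>2 \<partial>Q) = (S *v (\<Sum>t\<in>U. c t *\<^sub>R h t)) \<bullet> (\<Sum>t\<in>U. c t *\<^sub>R h t)" .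
  qed
  \<comment> \<open>Finitely many process values suffice: choose index points whose features form a basis of the span.\<close>
  obtain B0 where B0: "B0 \<subseteq> h ` T" "independent B0" "h ` T \<subseteq> span B0"
    using basis_exists[of "h ` T"] by metis
  obtain U0 where U0: "U0 \<subseteq> T" "inj_on h U0" "B0 = h ` U0"
    using B0(1) unfolding subset_image_inj by blast
  have fB0: "finite B0" using B0(2) by (rule independent_imp_finite)
  have fU0: "finite U0" using fB0 U0 finite_imageD by blast
  obtain B where B: "B \<subseteq> span B0" "pairwise orthogonal B" "\<And>x. x \<in> B \<Longrightarrow> norm x = 1" "independent B"
      "card B = dim (span B0)" "span B = span B0"
    using orthonormal_basis_subspace[OF subspace_span[of B0]] by metis
  have fB: "finite B" using B(4) by (rule independent_imp_finite)
  have cB: "card B \<le> CARD('d)" using dim_subset_UNIV_cart[of "span B0"] B(5) by simp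
  have "\<exists>c. e = (\<Sum>t\<in>U0. c t *\<^sub>R h t)" if "e \<in> B" for e
  proof -
    have "e \<in> span B0" using B(1) that by blast
    then obtain u where "e = (\<Sum>v\<in>B0. u v *\<^sub>R v)" unfolding span_finite[OF fB0] by blast
    then have "e = (\<Sum>t\<in>U0. u (h t) *\<^sub>R h t)"
      unfolding U0(3) by (simp add: sum.reindex[OF U0(2)])
    then show ?thesis by (rule exI[of _ "\<lambda>t. u (h t)"])
  qed
  then obtain c where c: "\<And>e. e \<in> B \<Longrightarrow> e = (\<Sum>t\<in>U0. c e t *\<^sub>R h t)" by metis
  define g where "g e x = (\<Sum>t\<in>U0. c e t * Z t x)" for e x
  define F where "F f = (\<Sum>e\<in>B. (\<Sum>t\<in>U0. c e t * (f t - b t)) *\<^sub>R e)" for f :: "'a \<Rightarrow> real"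
  have Fg: "F (\<lambda>t\<in>T. Y t x) = (\<Sum>e\<in>B. g e x *\<^sub>R e)" for x
    unfolding F_def g_def Z_def
    by (intro sum.cong refl arg_cong2[where f=scaleR]) (use U0 in auto)
  have Fm: "F \<in> borel_measurable (PiM T (\<lambda>_. borel))"
  proof -
    have [measurable]: "(\<lambda>f. f t) \<in> borel_measurable (PiM T (\<lambda>_. borel :: real measure))" if "t \<in> U0" for t
      using that U0 by (intro measurable_component_singleton) auto
    show ?thesis
      unfolding F_def
      by (intro borel_measurable_sum borel_measurable_scaleR borel_measurable_times borel_measurable_diff
          borel_measurable_const) simp_all
  qed
  have mg[measurable]: "g e \<in> borel_measurable Q" for e
    unfolding g_def using U0 by (intro borel_measurable_sum borel_measurable_times mZ) auto
  have rep: "AE x in Q. Y t x = F (\<lambda>t\<in>T. Y t x) \<bullet> h t + b t" if t: "t \<in> T" for t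
  proof -
    \<comment> \<open>Coefficients of \<open>Z t\<close> minus its orthogonal expansion, as a single combination over \<open>insert t U0\<close>.\<close>
    define a where "a u = (if u = t then 1 else 0) - (if u \<in> U0 then (\<Sum>e\<in>B. (h t \<bullet> e) * c e u) else 0)" for u
    have fin: "finite (insert t U0)" "insert t U0 \<subseteq> T" using fU0 U0 t by auto
    have expand: "(\<Sum>u\<in>insert t U0. a u *\<^sub>R f u) = f t - (\<Sum>e\<in>B. (h t \<bullet> e) *\<^sub>R (\<Sum>u\<in>U0. c e u *\<^sub>R f u))"
      for f :: "'a \<Rightarrow> 'z :: real_vector"
    proof -
      have "(\<Sum>u\<in>insert t U0. a u *\<^sub>R f u) = (\<Sum>u\<in>insert t U0. (if u = t then f u else 0)) -
          (\<Sum>u\<in>insert t U0. (if u \<in> U0 then (\<Sum>e\<in>B. (h t \<bullet> e) * c e u) *\<^sub>R f u else 0))"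
        unfolding sum_subtractf[symmetric] a_def by (intro sum.cong refl) (auto simp: scaleR_diff_left)
      also have "(\<Sum>u\<in>insert t U0. (if u = t then f u else 0)) = f t"
        using fin(1) by (simp add: sum.delta)
      also have "(\<Sum>u\<in>insert t U0. (if u \<in> U0 then (\<Sum>e\<in>B. (h t \<bullet> e) * c e u) *\<^sub>R f u else 0))
          = (\<Sum>u\<in>U0. (\<Sum>e\<in>B. (h t \<bullet> e) * c e u) *\<^sub>R f u)"
        using fin(1) by (intro sum.mono_neutral_cong_right) auto
      also have "\<dots> = (\<Sum>e\<in>B. (h t \<bullet> e) *\<^sub>R (\<Sum>u\<in>U0. c e u *\<^sub>R f u))"
        unfolding scaleR_sum_left scaleR_sum_right by (subst sum.swap) simp
      finally show ?thesis .
    qed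
    have "(\<Sum>u\<in>insert t U0. a u *\<^sub>R h u) = h t - (\<Sum>e\<in>B. (h t \<bullet> e) *\<^sub>R e)"
      unfolding expand using c by (intro arg_cong2[where f=minus] refl sum.cong) auto
    also have "(\<Sum>e\<in>B. (h t \<bullet> e) *\<^sub>R e) = h t"
      by (rule orthonormal_basis_expand[OF B(2,3) _ fB]) (use B0(3) B(6) t in auto)
    finally have "(\<Sum>u\<in>insert t U0. a u *\<^sub>R h u) = 0" by simp
    then have "(\<integral>x. (\<Sum>u\<in>insert t U0. a u * Z u x)\<^sup>2 \<partial>Q) = 0"
      unfolding var[OF fin] by simp
    then have "AE x in Q. (\<Sum>u\<in>insert t U0. a u * Z u x)\<^sup>2 = 0"
      using integral_nonneg_eq_0_iff_AE[OF var_int[OF fin, of a]] by simp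
    then show ?thesis
    proof eventually_elim
      case (elim x)
      have "Z t x = (\<Sum>e\<in>B. (h t \<bullet> e) * g e x)"
        using elim expand[of "\<lambda>u. Z u x"] unfolding g_def by simp
      also have "\<dots> = (\<Sum>e\<in>B. g e x *\<^sub>R e) \<bullet> h t"
        by (simp add: inner_sum_left inner_commute[of "h t"] mult.commute)
      finally show ?case unfolding Fg Z_def by simp
    qed
  qed
  have g3: "integrable Q (\<lambda>x. \<bar>g e x\<bar> ^ 3)" "(\<integral>x. \<bar>g e x\<bar> ^ 3 \<partial>Q) \<le> 2 * s ^ 3" if e: "e \<in> B" for e
  proof -
    note gr = gaussian_rv_moments[OF Q grv[OF fU0 U0(1), of "c e"]]
    have m: "(\<integral>x. (\<Sum>t\<in>U0. c e t * Y t x) \<partial>Q) = (\<Sum>t\<in>U0. c e t * b t)"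
      using iY mean U0 by (subst Bochner_Integration.integral_sum) (auto simp: subset_iff)
    have gg: "(\<Sum>t\<in>U0. c e t * Y t x) - (\<Sum>t\<in>U0. c e t * b t) = g e x" for x
      unfolding g_def Z_def by (simp add: sum_subtractf right_diff_distrib)
    have "(\<integral>x. (g e x)\<^sup>2 \<partial>Q) = (S *v e) \<bullet> e"
      unfolding g_def var[OF fU0 U0(1)] c[OF e, symmetric] ..
    also have "\<dots> \<le> s\<^sup>2" using s(2)[of e] B(3)[OF e] by simp
    finally have v: "(\<integral>x. (g e x)\<^sup>2 \<partial>Q) \<le> s\<^sup>2" .
    show "integrable Q (\<lambda>x. \<bar>g e x\<bar> ^ 3)" using gr(3) unfolding m gg .
    show "(\<integral>x. \<bar>g e x\<bar> ^ 3 \<partial>Q) \<le> 2 * s ^ 3" using gr(4)[OF s(1)] v unfolding m gg by simp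
  qed
  have bnd: "norm (F (\<lambda>t\<in>T. Y t x)) ^ 3 \<le> real CARD('d) ^ 3 * (\<Sum>e\<in>B. \<bar>g e x\<bar> ^ 3)" for x
  proof -
    have "norm (F (\<lambda>t\<in>T. Y t x)) \<le> (\<Sum>e\<in>B. \<bar>g e x\<bar>)"
      unfolding Fg by (rule order_trans[OF norm_sum]) (intro sum_mono, use B(3) in simp)
    then have "norm (F (\<lambda>t\<in>T. Y t x)) ^ 3 \<le> (\<Sum>e\<in>B. \<bar>g e x\<bar>) ^ 3" by (intro power_mono) auto
    also have "\<dots> \<le> real (card B) ^ 3 * (\<Sum>e\<in>B. \<bar>g e x\<bar> ^ 3)" by (intro sum_cube_le fB) auto
    also have "\<dots> \<le> real CARD('d) ^ 3 * (\<Sum>e\<in>B. \<bar>g e x\<bar> ^ 3)"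
      using cB by (intro mult_right_mono power_mono sum_nonneg) auto
    finally show ?thesis .
  qed
  have ib: "integrable Q (\<lambda>x. real CARD('d) ^ 3 * (\<Sum>e\<in>B. \<bar>g e x\<bar> ^ 3))"
    using g3(1) by (intro integrable_mult_right Bochner_Integration.integrable_sum) auto
  have mF: "(\<lambda>x. norm (F (\<lambda>t\<in>T. Y t x)) ^ 3) \<in> borel_measurable Q"
    unfolding Fg by measurable
  have iF: "integrable Q (\<lambda>x. norm (F (\<lambda>t\<in>T. Y t x)) ^ 3)"
    by (rule integrable_dominated[OF ib mF]) (use bnd in simp)
  have "(\<integral>x. norm (F (\<lambda>t\<in>T. Y t x)) ^ 3 \<partial>Q) \<le> (\<integral>x. real CARD('d) ^ 3 * (\<Sum>e\<in>B. \<bar>g e x\<bar> ^ 3) \<partial>Q)"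
    by (intro integral_mono iF ib bnd)
  also have "\<dots> = real CARD('d) ^ 3 * (\<Sum>e\<in>B. \<integral>x. \<bar>g e x\<bar> ^ 3 \<partial>Q)"
    using g3(1) by (simp add: Bochner_Integration.integral_sum)
  also have "\<dots> \<le> real CARD('d) ^ 3 * (\<Sum>e\<in>B. 2 * s ^ 3)"
    by (intro mult_left_mono sum_mono g3(2)) auto
  also have "\<dots> \<le> real CARD('d) ^ 3 * (real CARD('d) * (2 * s ^ 3))"
    using cB s(1) by (auto intro!: mult_left_mono mult_right_mono)
  also have "\<dots> = 2 * real CARD('d) ^ 4 * s ^ 3" by (simp add: power_numeral_reduce)
  finally show ?thesis using that[OF Fm rep iF] by blast
qed

lemma (in Metric_space) compact_space_finite_nets:
  assumes "compact_space mtopology"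
  obtains K where "\<And>n. finite (K n)" "\<And>n. K n \<subseteq> M" "\<And>n. M \<subseteq> (\<Union>x\<in>K n. mball x (1 / real (Suc n)))"
proof -
  have "mtotally_bounded M"
    using assms compactin_imp_mtotally_bounded unfolding compact_space_def by simp
  then have "\<forall>n. \<exists>K. finite K \<and> K \<subseteq> M \<and> M \<subseteq> (\<Union>x\<in>K. mball x (1 / real (Suc n)))"
    unfolding mtotally_bounded_def by simp
  then show thesis using that by metis
qed

lemma compact_metrizable_imp_separable:
  assumes "compact_space X" "metrizable_space X"
  shows "separable_space X"
proof -
  obtain M d where M: "Metric_space M d" "X = Metric_space.mtopology M d"
    using assms(2) unfolding metrizable_space_def by blast
  interpret Metric_space M d by fact
  obtain K where K: "\<And>n. finite (K n)" "\<And>n. K n \<subseteq> M" "\<And>n. M \<subseteq> (\<Union>x\<in>K n. mball x (1 / real (Suc n)))"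
    using compact_space_finite_nets assms(1) unfolding M(2) by metis
  have "x \<in> mtopology closure_of (\<Union>n. K n)" if x: "x \<in> M" for x
  proof -
    have "\<exists>y\<in>(\<Union>n. K n). y \<in> mball x r" if r: "r > 0" for r
    proof -
      obtain n where n: "1 / real (Suc n) < r" using nat_approx_posE[OF r] by metis
      obtain y where "y \<in> K n" "x \<in> mball y (1 / real (Suc n))" using K(3)[of n] x by blast
      then show ?thesis using n by (intro bexI[of _ y]) (auto simp: commute)
    qed
    then show ?thesis using x by (auto simp: metric_closure_of)
  qed
  then have "mtopology closure_of (\<Union>n. K n) = topspace mtopology"
    using closure_of_subset_topspace[of mtopology] by auto
  then show ?thesis
    unfolding M(2) separable_space_def using K(1,2)
    by (intro exI[of _ "\<Union>n. K n"]) (auto intro: countable_finite)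
qed

text \<open>Moves the exceptional null set from one for each \<open>t\<close> to a single one: exclude the null sets of a
countable dense set and use continuity.\<close>

lemma AE_eq_on_separable:
  fixes f g :: "'a :: topological_space \<Rightarrow> 'q \<Rightarrow> real"
  assumes T: "compact T" "metrizable_space (top_of_set T)"
    and f: "\<And>x. x \<in> space Q \<Longrightarrow> continuous_on T (\<lambda>t. f t x)"
    and g: "\<And>x. x \<in> space Q \<Longrightarrow> continuous_on T (\<lambda>t. g t x)"
    and eq: "\<And>t. t \<in> T \<Longrightarrow> AE x in Q. f t x = g t x"
  shows "AE x in Q. \<forall>t\<in>T. f t x = g t x"
proof -
  have "compact_space (top_of_set T)" using T(1) by (simp add: compact_space_subtopology)
  then obtain D where D: "countable D" "D \<subseteq> T" "top_of_set T closure_of D = T"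
    using compact_metrizable_imp_separable[OF _ T(2)] unfolding separable_space_def by auto
  have "AE x in Q. \<forall>t\<in>D. f t x = g t x"
    using D(1,2) eq by (subst AE_ball_countable) auto
  then show ?thesis
  proof (rule AE_mp, intro AE_I2 impI ballI)
    fix x t assume x: "x \<in> space Q" and e: "\<forall>t\<in>D. f t x = g t x" and t: "t \<in> T"
    show "f t x = g t x"
      by (rule forall_in_closure_of_eq[of t "top_of_set T" D euclidean "\<lambda>t. f t x" "\<lambda>t. g t x"])
         (use D(3) t f[OF x] g[OF x] e in auto)
  qed
qed

text \<open>Paths that are continuous in \<open>t\<close> and measurable for each \<open>t\<close> are jointly measurable. On a finite net
of mesh \<open>1 / (n + 1)\<close>, replace \<open>t\<close> by the first net point within the mesh; the resulting functions are
measurable because they only involve finitely many net points, and they converge by continuity.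
Without joint measurability the Gaussian log-partition function would not be known to be a random
variable, and almost sure equality would not determine its integral.\<close>

lemma caratheodory_measurable:
  fixes f :: "'a :: topological_space \<Rightarrow> 'q \<Rightarrow> real"
  assumes T: "compact T" "metrizable_space (top_of_set T)"
    and R: "sets R = sets (restrict_space borel T)"
    and meas: "\<And>t. t \<in> T \<Longrightarrow> f t \<in> borel_measurable Q"
    and cont: "\<And>x. x \<in> space Q \<Longrightarrow> continuous_on T (\<lambda>t. f t x)"
  shows "(\<lambda>(x, t). f t x) \<in> borel_measurable (Q \<Otimes>\<^sub>M R)"
proof -
  have spR: "space R = T" using sets_eq_imp_space_eq[OF R] by (simp add: space_restrict_space)
  obtain M d where M: "Metric_space M d" "top_of_set T = Metric_space.mtopology M d"
    using T(2) unfolding metrizable_space_def by blast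
  interpret Metric_space M d by fact
  have MT: "M = T" using arg_cong[OF M(2), of topspace] by simp
  have "compact_space mtopology" using T(1) unfolding M(2)[symmetric] by (simp add: compact_space_subtopology)
  then obtain K where K: "\<And>n. finite (K n)" "\<And>n. K n \<subseteq> M" "\<And>n. M \<subseteq> (\<Union>x\<in>K n. mball x (1 / real (Suc n)))"
    using compact_space_finite_nets by metis
  have "\<exists>ks. set ks = K n" for n using K(1) finite_list by blast
  then obtain ks where ks: "\<And>n. set (ks n) = K n" by metis
  define p where "p n x t = foldr (\<lambda>k v. if t \<in> mball k (1 / real (Suc n)) then f k x else v) (ks n) 0" for n x t
  have ball: "mball k e \<in> sets R" for k e
  proof -
    have "openin (top_of_set T) (mball k e)" unfolding M(2) by (rule openin_mball)
    then obtain V where V: "open V" "mball k e = T \<inter> V" unfolding openin_open by blast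
    then show ?thesis unfolding R V(2) by (auto simp: sets_restrict_space)
  qed
  have pm: "(\<lambda>(x, t). foldr (\<lambda>k v. if t \<in> mball k e then f k x else v) ls 0) \<in> borel_measurable (Q \<Otimes>\<^sub>M R)"
    if "set ls \<subseteq> T" for ls e
    using that
  proof (induction ls)
    case (Cons k ls)
    have [measurable]: "f k \<in> borel_measurable Q" using Cons by (intro meas) auto
    have [measurable]: "mball k e \<in> sets R" by (rule ball)
    have [measurable]: "(\<lambda>w. foldr (\<lambda>k v. if snd w \<in> mball k e then f k (fst w) else v) ls 0) \<in> borel_measurable (Q \<Otimes>\<^sub>M R)"
      using Cons by (simp add: case_prod_beta' del: in_mball)
    have "(\<lambda>w. if snd w \<in> mball k e then f k (fst w) else foldr (\<lambda>k v. if snd w \<in> mball k e then f k (fst w) else v) ls 0)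
       \<in> borel_measurable (Q \<Otimes>\<^sub>M R)" by measurable
    then show ?case by (simp add: case_prod_beta' del: in_mball)
  qed simp
  have pick: "\<exists>k\<in>set ls. t \<in> mball k e \<and> foldr (\<lambda>k v. if t \<in> mball k e then f k x else v) ls 0 = f k x"
    if "\<exists>k\<in>set ls. t \<in> mball k e" for ls t e x
    using that by (induction ls) auto
  have lim: "(\<lambda>n. p n x t) \<longlonglongrightarrow> f t x" if x: "x \<in> space Q" and t: "t \<in> T" for x t
  proof -
    have "\<exists>k\<in>K n. t \<in> mball k (1 / real (Suc n)) \<and> p n x t = f k x" for n
      using pick[of "ks n" t "1 / real (Suc n)" x] K(3)[of n] t unfolding p_def ks MT by blast
    then obtain k where k: "\<And>n. k n \<in> K n" "\<And>n. t \<in> mball (k n) (1 / real (Suc n))" "\<And>n. p n x t = f (k n) x"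
      by metis
    have "limitin mtopology k t sequentially"
      unfolding limit_metric_sequentially
    proof (intro conjI allI impI)
      show "t \<in> M" using t MT by simp
      fix e :: real assume "e > 0"
      then obtain N where N: "1 / real (Suc N) < e" using nat_approx_posE by metis
      show "\<exists>N. \<forall>n\<ge>N. k n \<in> M \<and> d (k n) t < e"
      proof (intro exI[of _ N] allI impI conjI)
        fix n assume "n \<ge> N"
        then have "1 / real (Suc n) \<le> 1 / real (Suc N)" by (intro divide_left_mono) auto
        then show "d (k n) t < e" using k(2)[of n] N by (auto simp: in_mball)
        show "k n \<in> M" using k(1) K(2) by blast
      qed
    qed
    then have "limitin euclidean ((\<lambda>t. f t x) \<circ> k) (f t x) sequentially"
    proof -
      have "continuous_map (top_of_set T) euclidean (\<lambda>t. f t x)" using cont[OF x] by simp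
      then show ?thesis
        using \<open>limitin mtopology k t sequentially\<close> unfolding M(2) by (rule continuous_map_limit)
    qed
    then show ?thesis unfolding k(3) by (simp add: comp_def)
  qed
  show ?thesis
  proof (rule borel_measurable_LIMSEQ_real)
    show "(\<lambda>(x, t). p n x t) \<in> borel_measurable (Q \<Otimes>\<^sub>M R)" for n
      unfolding p_def using K(2)[of n] MT ks by (intro pm) auto
    show "(\<lambda>n. case w of (x, t) \<Rightarrow> p n x t) \<longlonglongrightarrow> (case w of (x, t) \<Rightarrow> f t x)" if "w \<in> space (Q \<Otimes>\<^sub>M R)" for w
      using that lim by (auto simp: space_pair_measure spR)
  qed
qed

text \<open>The representation for all components at once. Each \<open>G m\<close> is a measurable function of the path of the
component \<open>m\<close>, so the vectors inherit independence, and their joint law is a product measure. The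
moments of \<open>G m\<close> are only stated against features in \<open>T\<close>: outside the span of the features the
covariance of \<open>G m\<close> need not be \<open>S\<close>.\<close>

lemma gaussian_comparison_linear:
  fixes eta :: "nat \<Rightarrow> 'a :: topological_space \<Rightarrow> real ^ 'd" and Y :: "nat \<Rightarrow> 'a \<Rightarrow> 'q \<Rightarrow> real"
  assumes gc: "gaussian_comparison Q Y T M eta A S K \<theta>"
    and T: "compact T" "metrizable_space (top_of_set T)"
    and eta: "\<And>m. m \<in> {1..M} \<Longrightarrow> continuous_on T (eta m)"
    and s: "0 \<le> s" "\<And>v. (S *v v) \<bullet> v \<le> s\<^sup>2 * (norm v)\<^sup>2"
    and M: "M \<ge> 1"
  defines "b \<equiv> \<lambda>m t. (A *v eta m \<theta>) \<bullet> eta m t - (1 / 2) * ((K *v eta m t) \<bullet> eta m t)"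
  obtains G :: "nat \<Rightarrow> 'q \<Rightarrow> real ^ 'd"
  where "\<And>m. G m \<in> borel_measurable Q"
    and "distr Q (PiM {1..M} (\<lambda>_. borel)) (\<lambda>x. \<lambda>m\<in>{1..M}. G m x) = PiM {1..M} (\<lambda>m. distr Q borel (G m))"
    and "AE x in Q. \<forall>m\<in>{1..M}. \<forall>t\<in>T. Y m t x = G m x \<bullet> eta m t + b m t"
    and "\<And>m. m \<in> {1..M} \<Longrightarrow> integrable Q (\<lambda>x. norm (G m x) ^ 3)"
    and "\<And>m. m \<in> {1..M} \<Longrightarrow> (\<integral>x. norm (G m x) ^ 3 \<partial>Q) \<le> 2 * real CARD('d) ^ 4 * s ^ 3"
    and "\<And>m t. m \<in> {1..M} \<Longrightarrow> t \<in> T \<Longrightarrow> integrable Q (\<lambda>x. G m x \<bullet> eta m t)"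
    and "\<And>m t. m \<in> {1..M} \<Longrightarrow> t \<in> T \<Longrightarrow> (\<integral>x. G m x \<bullet> eta m t \<partial>Q) = 0"
    and "\<And>m u t. m \<in> {1..M} \<Longrightarrow> u \<in> T \<Longrightarrow> t \<in> T \<Longrightarrow> integrable Q (\<lambda>x. (G m x \<bullet> eta m u) * (G m x \<bullet> eta m t))"
    and "\<And>m u t. m \<in> {1..M} \<Longrightarrow> u \<in> T \<Longrightarrow> t \<in> T \<Longrightarrow>
          (\<integral>x. (G m x \<bullet> eta m u) * (G m x \<bullet> eta m t) \<partial>Q) = (S *v eta m u) \<bullet> eta m t"
proof -
  let ?I = "{1..M}"
  have Q: "prob_space Q" and gp: "\<And>m. m \<in> ?I \<Longrightarrow> gaussian_process Q T (Y m)"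
    and cont: "\<And>m x. m \<in> ?I \<Longrightarrow> x \<in> space Q \<Longrightarrow> continuous_on T (\<lambda>t. Y m t x)"
    and ind: "prob_space.indep_vars Q (\<lambda>m. \<Pi>\<^sub>M t\<in>T. borel) (\<lambda>m x. \<lambda>t\<in>T. Y m t x) ?I"
    and mean: "\<And>m t. m \<in> ?I \<Longrightarrow> t \<in> T \<Longrightarrow> (\<integral>x. Y m t x \<partial>Q) = b m t"
    and cov: "\<And>m s t. m \<in> ?I \<Longrightarrow> s \<in> T \<Longrightarrow> t \<in> T \<Longrightarrow> covariance Q (Y m s) (Y m t) = (S *v eta m s) \<bullet> eta m t"
    using gc unfolding gaussian_comparison_def b_def by blast+
  interpret prob_space Q by fact
  define rep where "rep m F \<longleftrightarrow> F \<in> borel_measurable (PiM T (\<lambda>_. borel)) \<and>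
      (\<forall>t\<in>T. AE x in Q. Y m t x = F (\<lambda>t\<in>T. Y m t x) \<bullet> eta m t + b m t) \<and>
      integrable Q (\<lambda>x. norm (F (\<lambda>t\<in>T. Y m t x)) ^ 3) \<and>
      (\<integral>x. norm (F (\<lambda>t\<in>T. Y m t x)) ^ 3 \<partial>Q) \<le> 2 * real CARD('d) ^ 4 * s ^ 3"
    for m and F :: "('a \<Rightarrow> real) \<Rightarrow> real ^ 'd"
  have "\<exists>F. rep m F" if m: "m \<in> ?I" for m
  proof (rule gaussian_process_linear_representation[OF Q gp[OF m] _ _ s])
    show "(\<integral>x. Y m t x \<partial>Q) = b m t" if "t \<in> T" for t by (rule mean[OF m that])
    show "covariance Q (Y m u) (Y m t) = (S *v eta m u) \<bullet> eta m t" if "u \<in> T" "t \<in> T" for u t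
      by (rule cov[OF m that])
  qed (unfold rep_def, intro exI conjI ballI, assumption)
  then obtain F where F': "\<And>m. m \<in> ?I \<Longrightarrow> rep m (F m)" by metis
  have F: "\<And>m. m \<in> ?I \<Longrightarrow> F m \<in> borel_measurable (PiM T (\<lambda>_. borel))"
      "\<And>m t. m \<in> ?I \<Longrightarrow> t \<in> T \<Longrightarrow> AE x in Q. Y m t x = F m (\<lambda>t\<in>T. Y m t x) \<bullet> eta m t + b m t"
      "\<And>m. m \<in> ?I \<Longrightarrow> integrable Q (\<lambda>x. norm (F m (\<lambda>t\<in>T. Y m t x)) ^ 3)"
      "\<And>m. m \<in> ?I \<Longrightarrow> (\<integral>x. norm (F m (\<lambda>t\<in>T. Y m t x)) ^ 3 \<partial>Q) \<le> 2 * real CARD('d) ^ 4 * s ^ 3"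
    using F' unfolding rep_def by auto
  define G where "G m x = (if m \<in> ?I then F m (\<lambda>t\<in>T. Y m t x) else 0)" for m x
  have GF: "G m = (\<lambda>x. F m (\<lambda>t\<in>T. Y m t x))" if "m \<in> ?I" for m
    unfolding G_def using that by auto
  have indF: "indep_vars (\<lambda>_. borel) (\<lambda>m x. F m (\<lambda>t\<in>T. Y m t x)) ?I"
    by (rule indep_vars_compose2[OF ind F(1)])
  have rvF: "(\<lambda>x. F m (\<lambda>t\<in>T. Y m t x)) \<in> borel_measurable Q" if "m \<in> ?I" for m
    using indF that unfolding indep_vars_def by auto
  have Gm: "G m \<in> borel_measurable Q" for m
  proof (cases "m \<in> ?I")
    case True then show ?thesis using rvF GF by simp
  next
    case False then have "G m = (\<lambda>_. 0)" unfolding G_def by auto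
    then show ?thesis by simp
  qed
  have indG: "indep_vars (\<lambda>_. borel) G ?I"
    using indF by (subst indep_vars_cong[OF refl _ refl, where Y="\<lambda>m x. F m (\<lambda>t\<in>T. Y m t x)"]) (use GF in auto)
  have dist: "distr Q (PiM ?I (\<lambda>_. borel)) (\<lambda>x. \<lambda>m\<in>?I. G m x) = PiM ?I (\<lambda>m. distr Q borel (G m))"
    using indG M by (subst (asm) indep_vars_iff_distr_eq_PiM') (auto intro: Gm)
  have rep1: "AE x in Q. Y m t x = G m x \<bullet> eta m t + b m t" if "m \<in> ?I" "t \<in> T" for m t
    using F(2)[OF that] GF[OF that(1)] by simp
  have bcont: "continuous_on T (b m)" if "m \<in> ?I" for m
    unfolding b_def
    by (intro continuous_intros eta that bounded_linear.continuous_on[OF matrix_vector_mul_bounded_linear])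
  have "AE x in Q. \<forall>t\<in>T. Y m t x = G m x \<bullet> eta m t + b m t" if m: "m \<in> ?I" for m
    by (rule AE_eq_on_separable[OF T cont[OF m] _ rep1[OF m]])
       (auto intro!: continuous_intros eta[OF m] bcont[OF m])
  note repT = this
  have rep: "AE x in Q. \<forall>m\<in>?I. \<forall>t\<in>T. Y m t x = G m x \<bullet> eta m t + b m t"
  proof (rule AE_finite_allI)
    show "AE x in Q. \<forall>t\<in>T. Y m t x = G m x \<bullet> eta m t + b m t" if "m \<in> ?I" for m by (rule repT[OF that])
  qed simp
  have gY: "gaussian_rv Q (Y m t)" if "m \<in> ?I" "t \<in> T" for m t
    using gp[OF that(1)] that(2) unfolding gaussian_process_def
    by (auto dest!: spec[of _ "{t}"] spec[of _ "\<lambda>_. 1"])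
  have Ym: "Y m t \<in> borel_measurable Q" if "m \<in> ?I" "t \<in> T" for m t
    using gY[OF that] unfolding gaussian_rv_def by blast
  have cen: "AE x in Q. G m x \<bullet> eta m t = Y m t x - b m t" if "m \<in> ?I" "t \<in> T" for m t
    using rep1[OF that] by eventually_elim simp
  have Gx: "(\<lambda>x. G m x \<bullet> v) \<in> borel_measurable Q" for m v using Gm by measurable
  have i1: "integrable Q (\<lambda>x. Y m t x - b m t)" if "m \<in> ?I" "t \<in> T" for m t
    using gaussian_rv_moments(1)[OF Q gY[OF that]] by simp
  have i2: "integrable Q (\<lambda>x. (Y m u x - b m u) * (Y m t x - b m t))" if m: "m \<in> ?I" and ut: "u \<in> T" "t \<in> T" for m u t
    by (intro integrable_mult_of_squares integrable_shifted_square borel_measurable_diff borel_measurable_const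
        Ym[OF m] gaussian_rv_moments(1,2)[OF Q gY[OF m]] ut)
  have prodAE: "AE x in Q. (G m x \<bullet> eta m u) * (G m x \<bullet> eta m t) = (Y m u x - b m u) * (Y m t x - b m t)"
    if "m \<in> ?I" "u \<in> T" "t \<in> T" for m u t
    using cen[OF that(1,2)] cen[OF that(1,3)] by eventually_elim simp
  show thesis
  proof (rule that[OF Gm dist rep])
    fix m assume m: "m \<in> ?I"
    show "integrable Q (\<lambda>x. norm (G m x) ^ 3)" using F(3)[OF m] GF[OF m] by simp
    show "(\<integral>x. norm (G m x) ^ 3 \<partial>Q) \<le> 2 * real CARD('d) ^ 4 * s ^ 3" using F(4)[OF m] GF[OF m] by simp
    fix t assume t: "t \<in> T"
    have mY: "(\<lambda>x. Y m t x - b m t) \<in> borel_measurable Q" using Ym[OF m t] by measurable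
    show "integrable Q (\<lambda>x. G m x \<bullet> eta m t)"
      using i1[OF m t] integrable_cong_AE[OF Gx mY cen[OF m t]] by simp
    show "(\<integral>x. G m x \<bullet> eta m t \<partial>Q) = 0"
      using integral_cong_AE[OF Gx mY cen[OF m t]] gaussian_rv_moments(1)[OF Q gY[OF m t]] mean[OF m t]
      by (simp add: prob_space)
    fix u assume u: "u \<in> T"
    have mY2: "(\<lambda>x. (Y m u x - b m u) * (Y m t x - b m t)) \<in> borel_measurable Q"
      using Ym[OF m t] Ym[OF m u] by measurable
    have mG2: "(\<lambda>x. (G m x \<bullet> eta m u) * (G m x \<bullet> eta m t)) \<in> borel_measurable Q" using Gx by measurable
    show "integrable Q (\<lambda>x. (G m x \<bullet> eta m u) * (G m x \<bullet> eta m t))"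
      using i2[OF m u t] integrable_cong_AE[OF mG2 mY2 prodAE[OF m u t]] by simp
    show "(\<integral>x. (G m x \<bullet> eta m u) * (G m x \<bullet> eta m t) \<partial>Q) = (S *v eta m u) \<bullet> eta m t"
      using integral_cong_AE[OF mG2 mY2 prodAE[OF m u t]] cov[OF m u t] mean[OF m u] mean[OF m t]
      unfolding covariance_def by simp
  qed
qed

section \<open>Comparison of the two free energies\<close>

text \<open>Here \<open>8\<close> is \<open>2\<^sup>3\<close>: replace both summands by the larger one.\<close>

lemma cube_add_le:
  fixes a b :: real
  assumes "0 \<le> a" "0 \<le> b"
  shows "(a + b) ^ 3 \<le> 8 * (a ^ 3 + b ^ 3)"
proof -
  have "(a + b) ^ 3 \<le> (2 * max a b) ^ 3" using assms by (intro power_mono) auto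
  also have "\<dots> = 8 * max a b ^ 3" by (simp add: power_mult_distrib)
  also have "max a b ^ 3 \<le> a ^ 3 + b ^ 3" using assms by (auto simp: max_def)
  finally show ?thesis by simp
qed

text \<open>The estimates for one site, in a form common to both laws. A site field is an inner product of
\<open>v - m\<close> with a feature plus a deterministic term \<open>e\<close> of second order; \<open>A\<close> is the displacement of the
mean of \<open>v\<close> from \<open>m\<close> to first order. In the second moment all terms containing \<open>e\<close> are products of two
quantities of second order, hence smaller than \<open>r\<^sup>3\<close>.\<close>

lemma linear_field_moments:
  fixes N :: "(real ^ 'd) measure" and h :: "'t \<Rightarrow> real ^ 'd"
  assumes N: "prob_space N" "sets N = sets borel"
    and r: "0 \<le> r" "r \<le> 1" and C: "0 \<le> C"
    and h: "\<And>t. t \<in> T \<Longrightarrow> norm (h t) \<le> r" and e: "\<And>t. t \<in> T \<Longrightarrow> \<bar>e t\<bar> \<le> C * r\<^sup>2" and A: "norm A \<le> C * r"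
    and i3: "integrable N (\<lambda>v. norm (v - m) ^ 3)" "(\<integral>v. norm (v - m) ^ 3 \<partial>N) \<le> C"
    and i1: "\<And>t. t \<in> T \<Longrightarrow> integrable N (\<lambda>v. (v - m) \<bullet> h t)"
      "\<And>t. t \<in> T \<Longrightarrow> \<bar>(\<integral>v. (v - m) \<bullet> h t \<partial>N) - A \<bullet> h t\<bar> \<le> C * r ^ 3"
    and i2: "\<And>s t. s \<in> T \<Longrightarrow> t \<in> T \<Longrightarrow> integrable N (\<lambda>v. ((v - m) \<bullet> h s) * ((v - m) \<bullet> h t))"
      "\<And>s t. s \<in> T \<Longrightarrow> t \<in> T \<Longrightarrow>
         \<bar>(\<integral>v. ((v - m) \<bullet> h s) * ((v - m) \<bullet> h t) \<partial>N) - (S *v h s) \<bullet> h t\<bar> \<le> C * r ^ 3"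
  defines "z \<equiv> \<lambda>v t. (v - m) \<bullet> h t + e t" and "B \<equiv> \<lambda>v. norm (v - m) * r + C * r\<^sup>2"
  shows "\<And>v t. t \<in> T \<Longrightarrow> \<bar>z v t\<bar> \<le> B v" and "B \<in> borel_measurable borel"
    and "integrable N (\<lambda>v. B v ^ 3)" and "(\<integral>v. B v ^ 3 \<partial>N) \<le> 8 * (C + C ^ 3) * r ^ 3"
    and "\<And>t. t \<in> T \<Longrightarrow> \<bar>(\<integral>v. z v t \<partial>N) - (A \<bullet> h t + e t)\<bar> \<le> C * r ^ 3"
    and "\<And>s t. s \<in> T \<Longrightarrow> t \<in> T \<Longrightarrow> \<bar>(\<integral>v. z v s * z v t \<partial>N) - (S *v h s) \<bullet> h t\<bar> \<le> (C + 5 * C\<^sup>2) * r ^ 3"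
proof -
  interpret prob_space N by fact
  have r4: "r ^ 4 \<le> r ^ 3" using power_decreasing[of 3 4 r] r by simp
  have r32: "r ^ 3 \<le> r\<^sup>2" using power_decreasing[of 2 3 r] r by simp
  have r6: "(r\<^sup>2) ^ 3 \<le> r ^ 3" using power_decreasing[of 3 6 r] r by (simp flip: power_mult)
  show "\<bar>z v t\<bar> \<le> B v" if "t \<in> T" for v t
  proof -
    have "\<bar>(v - m) \<bullet> h t\<bar> \<le> norm (v - m) * r"
      by (rule order_trans[OF Cauchy_Schwarz_ineq2]) (intro mult_left_mono h that norm_ge_zero)
    then show ?thesis using e[OF that] unfolding z_def B_def by linarith
  qed
  show Bm: "B \<in> borel_measurable borel" unfolding B_def by measurable
  have B3: "B v ^ 3 \<le> 8 * r ^ 3 * norm (v - m) ^ 3 + 8 * C ^ 3 * r ^ 3" and B0: "0 \<le> B v" for v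
  proof -
    show "0 \<le> B v" unfolding B_def using r C by simp
    have "B v ^ 3 \<le> 8 * ((norm (v - m) * r) ^ 3 + (C * r\<^sup>2) ^ 3)"
      unfolding B_def using r C by (intro cube_add_le) auto
    also have "(C * r\<^sup>2) ^ 3 \<le> C ^ 3 * r ^ 3"
      unfolding power_mult_distrib using C r6 by (intro mult_left_mono) auto
    finally show "B v ^ 3 \<le> 8 * r ^ 3 * norm (v - m) ^ 3 + 8 * C ^ 3 * r ^ 3"
      by (simp add: power_mult_distrib algebra_simps)
  qed
  have ib: "integrable N (\<lambda>v. 8 * r ^ 3 * norm (v - m) ^ 3 + 8 * C ^ 3 * r ^ 3)"
    using i3(1) by simp
  show iB: "integrable N (\<lambda>v. B v ^ 3)"
  proof (rule integrable_dominated[OF ib])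
    show "(\<lambda>v. B v ^ 3) \<in> borel_measurable N"
      using Bm by (simp add: measurable_cong_sets[OF N(2) refl])
    show "norm (B v ^ 3) \<le> 8 * r ^ 3 * norm (v - m) ^ 3 + 8 * C ^ 3 * r ^ 3" for v
      using B3[of v] B0[of v] by simp
  qed
  have "(\<integral>v. B v ^ 3 \<partial>N) \<le> (\<integral>v. 8 * r ^ 3 * norm (v - m) ^ 3 + 8 * C ^ 3 * r ^ 3 \<partial>N)"
    by (intro integral_mono iB ib B3)
  also have "\<dots> = 8 * r ^ 3 * (\<integral>v. norm (v - m) ^ 3 \<partial>N) + 8 * C ^ 3 * r ^ 3"
    using i3(1) by (simp add: prob_space)
  also have "\<dots> \<le> 8 * r ^ 3 * C + 8 * C ^ 3 * r ^ 3"
    using i3(2) r by (intro add_right_mono mult_left_mono) auto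
  finally show "(\<integral>v. B v ^ 3 \<partial>N) \<le> 8 * (C + C ^ 3) * r ^ 3" by (simp add: algebra_simps)
  show "\<bar>(\<integral>v. z v t \<partial>N) - (A \<bullet> h t + e t)\<bar> \<le> C * r ^ 3" if "t \<in> T" for t
    using i1[OF that] unfolding z_def by (simp add: prob_space)
  have lin: "\<bar>\<integral>v. (v - m) \<bullet> h t \<partial>N\<bar> \<le> 2 * C * r\<^sup>2" if "t \<in> T" for t
  proof -
    have "\<bar>A \<bullet> h t\<bar> \<le> (C * r) * r"
      by (rule order_trans[OF Cauchy_Schwarz_ineq2]) (use A h[OF that] r C in \<open>intro mult_mono, auto\<close>)
    moreover have "C * r ^ 3 \<le> C * r\<^sup>2" using r32 C by (rule mult_left_mono)
    ultimately show ?thesis using i1(2)[OF that] unfolding power2_eq_square by linarith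
  qed
  show "\<bar>(\<integral>v. z v s * z v t \<partial>N) - (S *v h s) \<bullet> h t\<bar> \<le> (C + 5 * C\<^sup>2) * r ^ 3" if st: "s \<in> T" "t \<in> T" for s t
  proof -
    let ?L = "\<lambda>t. \<integral>v. (v - m) \<bullet> h t \<partial>N"
    let ?P = "\<integral>v. ((v - m) \<bullet> h s) * ((v - m) \<bullet> h t) \<partial>N"
    have "(\<integral>v. z v s * z v t \<partial>N) = (\<integral>v. ((v - m) \<bullet> h s) * ((v - m) \<bullet> h t) + e t * ((v - m) \<bullet> h s) + e s * ((v - m) \<bullet> h t) + e s * e t \<partial>N)"
      unfolding z_def by (simp add: algebra_simps)
    also have "\<dots> = ?P + e t * ?L s + e s * ?L t + e s * e t"
      using i1(1)[OF st(1)] i1(1)[OF st(2)] i2(1)[OF st] by (simp add: prob_space)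
    finally have eq: "(\<integral>v. z v s * z v t \<partial>N) = ?P + e t * ?L s + e s * ?L t + e s * e t" .
    have mm: "\<bar>x * y\<bar> \<le> (c * d) * r ^ 3" if "\<bar>x\<bar> \<le> c * r\<^sup>2" "\<bar>y\<bar> \<le> d * r\<^sup>2" "0 \<le> c" "0 \<le> d" for x y c d
    proof -
      have "\<bar>x * y\<bar> \<le> (c * r\<^sup>2) * (d * r\<^sup>2)" unfolding abs_mult using that by (intro mult_mono) auto
      also have "\<dots> = (c * d) * r ^ 4" by (simp add: power_numeral_reduce)
      also have "\<dots> \<le> (c * d) * r ^ 3" using that r4 by (intro mult_left_mono) auto
      finally show ?thesis .
    qed
    have "\<bar>e t * ?L s\<bar> \<le> (C * (2 * C)) * r ^ 3" "\<bar>e s * ?L t\<bar> \<le> (C * (2 * C)) * r ^ 3" "\<bar>e s * e t\<bar> \<le> (C * C) * r ^ 3"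
      using e lin st C by (auto intro!: mm)
    moreover have "\<bar>?P - (S *v h s) \<bullet> h t\<bar> \<le> C * r ^ 3" by (rule i2(2)[OF st])
    moreover have "(C + 5 * C\<^sup>2) * r ^ 3 = C * r ^ 3 + (C * (2 * C)) * r ^ 3 + (C * (2 * C)) * r ^ 3 + (C * C) * r ^ 3"
      by (simp add: algebra_simps power2_eq_square)
    ultimately show ?thesis unfolding eq by linarith
  qed
qed

text \<open>The comparison at a fixed \<open>n\<close> and \<open>\<theta>\<close>, with a bound \<open>M * O(r\<^sup>3)\<close> whose constant comes from
\<open>moment_estimates\<close> and the dimension alone. For the data sites \<open>m = E W\<close> and
\<open>e = (E W) \<bullet> eta - \<Lambda>(eta)\<close>; for the Gaussian sites \<open>m = 0\<close>, \<open>A = 0\<close> and \<open>e\<close> is the mean of the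
process. The term \<open>2 * CARD('d) ^ 4 * C ^ 3\<close> in \<open>D\<close> bounds the third moment of the Gaussian vectors.\<close>

lemma free_energy_gap:
  fixes eta :: "nat \<Rightarrow> 'a :: topological_space \<Rightarrow> real ^ 'd" and Y :: "nat \<Rightarrow> 'a \<Rightarrow> 'q \<Rightarrow> real"
    and W U :: "'w \<Rightarrow> real ^ 'd"
  assumes base: "prob_space lam" "prob_space gam" "sets lam = sets gam"
    and W: "W \<in> borel_measurable gam" and U: "U \<in> borel_measurable gam"
    and me: "moment_estimates lam gam W U u0 C" and u0: "u0 \<le> 1" and C: "1 \<le> C"
    and T: "compact T" "metrizable_space (top_of_set T)"
    and prior: "prob_space prior" "sets prior = sets (restrict_space borel T)"
    and eta: "\<And>m. m \<in> {1..M} \<Longrightarrow> continuous_on T (eta m)"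
    and gc: "gaussian_comparison Q Y T M eta (cov_matrix gam W U) (cov_matrix gam W W) (cov_matrix lam W W) \<theta>"
    and M: "M \<ge> 1" and r: "0 \<le> r" "r \<le> u0"
    and etaT: "\<And>m t. m \<in> {1..M} \<Longrightarrow> t \<in> T \<Longrightarrow> norm (eta m t) \<le> r"
    and eta\<theta>: "\<And>m. m \<in> {1..M} \<Longrightarrow> norm (eta m \<theta>) \<le> r"
    and D: "D = 2 * C + 2 * real CARD('d) ^ 4 * C ^ 3"
  shows "\<bar>(\<integral>w. ln (\<integral>t. exp (model_loglik lam W M eta t w) \<partial>prior) \<partial>data_law gam U M eta \<theta>)
      - (\<integral>x. ln (\<integral>t. exp (\<Sum>m\<in>{1..M}. Y m t x) \<partial>prior) \<partial>Q)\<bar>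
      \<le> real M * (82 * ((8 * (D + D ^ 3) + 3 * D + 2 * (D + 5 * D\<^sup>2)) * r ^ 3))"
proof -
  let ?I = "{1..M}"
  define A where "A = cov_matrix gam W U"
  define S where "S = cov_matrix gam W W"
  define K where "K = cov_matrix lam W W"
  define m0 where "m0 = (\<integral>w. W w \<partial>gam)"
  define P where "P i = exp_tilt gam U (eta i \<theta>)" for i
  define b where "b i t = (A *v eta i \<theta>) \<bullet> eta i t - (1 / 2) * ((K *v eta i t) \<bullet> eta i t)" for i t
  define e0 where "e0 i t = m0 \<bullet> eta i t - cumulant lam W (eta i t)" for i t
  have Wl: "W \<in> borel_measurable lam" using W by (simp add: measurable_cong_sets[OF base(3) refl])
  have spT: "space prior = T" using sets_eq_imp_space_eq[OF prior(2)] by (simp add: space_restrict_space)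
  have r1: "r \<le> 1" using r u0 by linarith
  have D0: "0 \<le> D" "C \<le> D" "2 * C \<le> D" "2 * real CARD('d) ^ 4 * C ^ 3 \<le> D" unfolding D using C by auto
  have mat: "norm (A *v v) \<le> C * norm v" "norm (S *v v) \<le> C * norm v" "norm (K *v v) \<le> C * norm v" for v
    using me unfolding moment_estimates_def A_def S_def K_def by blast+
  have \<theta>u: "norm (eta i \<theta>) \<le> u0" if "i \<in> ?I" for i using eta\<theta>[OF that] r by linarith
  have tilt: "prob_space (P i)" "integrable (P i) (\<lambda>w. norm (W w - m0) ^ 3)" "(\<integral>w. norm (W w - m0) ^ 3 \<partial>P i) \<le> C"
    "\<And>x. integrable (P i) (\<lambda>w. (W w - m0) \<bullet> x)"
    "\<And>x. \<bar>(\<integral>w. (W w - m0) \<bullet> x \<partial>P i) - (A *v eta i \<theta>) \<bullet> x\<bar> \<le> C * ((norm (eta i \<theta>))\<^sup>2 * norm x)"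
    "\<And>x y. integrable (P i) (\<lambda>w. ((W w - m0) \<bullet> x) * ((W w - m0) \<bullet> y))"
    "\<And>x y. \<bar>(\<integral>w. ((W w - m0) \<bullet> x) * ((W w - m0) \<bullet> y) \<partial>P i) - (S *v x) \<bullet> y\<bar> \<le> C * (norm (eta i \<theta>) * norm x * norm y)"
    if "i \<in> ?I" for i
    using me \<theta>u[OF that] unfolding moment_estimates_def tilted_moment_bounds_def Let_def P_def m0_def A_def S_def
    by blast+
  have taylor: "\<bar>cumulant lam W x - m0 \<bullet> x - (1 / 2) * ((K *v x) \<bullet> x)\<bar> \<le> C * r ^ 3" if "norm x \<le> r" for x
  proof -
    have "\<bar>cumulant lam W x - m0 \<bullet> x - (1 / 2) * ((K *v x) \<bullet> x)\<bar> \<le> C * norm x ^ 3"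
      using me that r unfolding moment_estimates_def m0_def K_def by force
    also have "\<dots> \<le> C * r ^ 3" using that C by (intro mult_left_mono power_mono) auto
    finally show ?thesis .
  qed
  have quad: "\<bar>(B *v x) \<bullet> y\<bar> \<le> C * r\<^sup>2" if "norm x \<le> r" "norm y \<le> r" "\<And>v. norm (B *v v) \<le> C * norm v"
    for B :: "real ^ 'd ^ 'd" and x y
  proof -
    have "\<bar>(B *v x) \<bullet> y\<bar> \<le> norm (B *v x) * norm y" by (rule Cauchy_Schwarz_ineq2)
    also have "\<dots> \<le> (C * norm x) * norm y" by (intro mult_right_mono that norm_ge_zero)
    also have "\<dots> \<le> (C * r) * r" using that C r by (intro mult_mono) auto
    finally show ?thesis by (simp add: power2_eq_square)
  qed
  have r3: "C * r ^ 3 \<le> C * r\<^sup>2" using power_decreasing[of 2 3 r] r r1 C by (intro mult_left_mono) auto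
  have e_bound: "\<bar>e0 i t\<bar> \<le> D * r\<^sup>2" "\<bar>b i t\<bar> \<le> D * r\<^sup>2" if "i \<in> ?I" "t \<in> T" for i t
  proof -
    note k = quad[OF etaT[OF that] etaT[OF that] mat(3)]
    have D2: "2 * (C * r\<^sup>2) \<le> D * r\<^sup>2" using mult_right_mono[OF D0(3), of "r\<^sup>2"] by simp
    show "\<bar>e0 i t\<bar> \<le> D * r\<^sup>2"
      unfolding e0_def using taylor[OF etaT[OF that]] k r3 D2 by linarith
    show "\<bar>b i t\<bar> \<le> D * r\<^sup>2"
      unfolding b_def using quad[OF eta\<theta>[OF that(1)] etaT[OF that] mat(1)] k D2 by linarith
  qed
  have Ab: "norm (A *v eta i \<theta>) \<le> D * r" if "i \<in> ?I" for i
  proof -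
    have "norm (A *v eta i \<theta>) \<le> C * norm (eta i \<theta>)" by (rule mat)
    also have "\<dots> \<le> D * r" using eta\<theta>[OF that] D0 C by (intro mult_mono) auto
    finally show ?thesis .
  qed
  have CD: "C * r ^ 3 \<le> D * r ^ 3" using D0 r by (intro mult_right_mono) auto
  have S2: "(S *v v) \<bullet> v \<le> C\<^sup>2 * (norm v)\<^sup>2" for v
  proof -
    have "(S *v v) \<bullet> v \<le> norm (S *v v) * norm v" by (rule norm_cauchy_schwarz)
    also have "\<dots> \<le> (C * norm v) * norm v" by (intro mult_right_mono mat) auto
    also have "\<dots> = C * (norm v)\<^sup>2" by (simp add: power2_eq_square)
    also have "\<dots> \<le> C\<^sup>2 * (norm v)\<^sup>2" using C by (intro mult_right_mono) (auto simp: power2_eq_square)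
    finally show ?thesis .
  qed
  have C0: "0 \<le> C" using C by linarith
  obtain G :: "nat \<Rightarrow> 'q \<Rightarrow> real ^ 'd"
    where G: "\<And>m. G m \<in> borel_measurable Q"
      "distr Q (PiM ?I (\<lambda>_. borel)) (\<lambda>x. \<lambda>m\<in>?I. G m x) = PiM ?I (\<lambda>m. distr Q borel (G m))"
      "AE x in Q. \<forall>m\<in>?I. \<forall>t\<in>T. Y m t x = G m x \<bullet> eta m t + b m t"
      "\<And>m. m \<in> ?I \<Longrightarrow> integrable Q (\<lambda>x. norm (G m x) ^ 3)"
      "\<And>m. m \<in> ?I \<Longrightarrow> (\<integral>x. norm (G m x) ^ 3 \<partial>Q) \<le> 2 * real CARD('d) ^ 4 * C ^ 3"
      "\<And>m t. m \<in> ?I \<Longrightarrow> t \<in> T \<Longrightarrow> integrable Q (\<lambda>x. G m x \<bullet> eta m t)"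
      "\<And>m t. m \<in> ?I \<Longrightarrow> t \<in> T \<Longrightarrow> (\<integral>x. G m x \<bullet> eta m t \<partial>Q) = 0"
      "\<And>m u t. m \<in> ?I \<Longrightarrow> u \<in> T \<Longrightarrow> t \<in> T \<Longrightarrow> integrable Q (\<lambda>x. (G m x \<bullet> eta m u) * (G m x \<bullet> eta m t))"
      "\<And>m u t. m \<in> ?I \<Longrightarrow> u \<in> T \<Longrightarrow> t \<in> T \<Longrightarrow>
          (\<integral>x. (G m x \<bullet> eta m u) * (G m x \<bullet> eta m t) \<partial>Q) = (S *v eta m u) \<bullet> eta m t"
  proof (rule gaussian_comparison_linear[OF gc[folded A_def S_def K_def] T _ C0 _ M, folded b_def])
    show "continuous_on T (eta m)" if "m \<in> ?I" for m by (rule eta[OF that])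
    show "(S *v v) \<bullet> v \<le> C\<^sup>2 * (norm v)\<^sup>2" for v by (rule S2)
  qed (rule that)
  have Q: "prob_space Q" using gc unfolding gaussian_comparison_def by blast
  interpret Q: prob_space Q by fact
  interpret prior: prob_space prior by fact
  \<comment> \<open>\<open>True\<close> marks the data sites and \<open>False\<close> the Gaussian sites. The Dirac measure outside the index
      range is a default that keeps every \<open>N c i\<close> a probability measure.\<close>
  define N where "N c i = (if c then if i \<in> ?I then distr (P i) borel W else return borel 0
      else distr Q borel (G i))" for c i
  have WP: "W \<in> borel_measurable (P i)" for i
    unfolding P_def exp_tilt_def using W by simp
  have Nprob: "prob_space (N c i)" for c i
    unfolding N_def
    using prob_space.prob_space_distr[OF tilt(1) WP] Q.prob_space_distr[OF G(1)] prob_space_return[of 0 borel] by auto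
  have Nsets: "sets (N c i) = sets borel" for c i unfolding N_def by simp
  define mm where "mm c = (if c then m0 else 0)" for c
  define e where "e c = (if c then e0 else b)" for c
  define AA where "AA c i = (if c then A *v eta i \<theta> else 0)" for c i
  define z where "z c i v t = (v - mm c) \<bullet> eta i t + e c i t" for c i v t
  define B where "B c i v = norm (v - mm c) * r + D * r\<^sup>2" for c and i :: nat and v :: "real ^ 'd"
  have ec: "\<bar>e c i t\<bar> \<le> D * r\<^sup>2" if "i \<in> ?I" "t \<in> T" for c i t
    unfolding e_def using e_bound[OF that] by simp
  have AAb: "norm (AA c i) \<le> D * r" if "i \<in> ?I" for c i
    unfolding AA_def using Ab[OF that] D0(1) r(1) by simp
  have site: "integrable (N c i) (\<lambda>v. norm (v - mm c) ^ 3) \<and> (\<integral>v. norm (v - mm c) ^ 3 \<partial>N c i) \<le> D \<and>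
      (\<forall>t\<in>T. integrable (N c i) (\<lambda>v. (v - mm c) \<bullet> eta i t) \<and>
        \<bar>(\<integral>v. (v - mm c) \<bullet> eta i t \<partial>N c i) - AA c i \<bullet> eta i t\<bar> \<le> D * r ^ 3) \<and>
      (\<forall>s\<in>T. \<forall>t\<in>T. integrable (N c i) (\<lambda>v. ((v - mm c) \<bullet> eta i s) * ((v - mm c) \<bullet> eta i t)) \<and>
        \<bar>(\<integral>v. ((v - mm c) \<bullet> eta i s) * ((v - mm c) \<bullet> eta i t) \<partial>N c i) - (S *v eta i s) \<bullet> eta i t\<bar> \<le> D * r ^ 3)"
    if i: "i \<in> ?I" for c i
  proof (cases c)
    case True
    have NT: "N c i = distr (P i) borel W" "mm c = m0" "AA c i = A *v eta i \<theta>"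
      using True i unfolding N_def mm_def AA_def by auto
    have u2: "(norm (eta i \<theta>))\<^sup>2 \<le> r\<^sup>2" using eta\<theta>[OF i] by (intro power_mono) auto
    have l: "C * ((norm (eta i \<theta>))\<^sup>2 * norm (eta i t)) \<le> D * r ^ 3" if t: "t \<in> T" for t
    proof -
      have "(norm (eta i \<theta>))\<^sup>2 * norm (eta i t) \<le> r\<^sup>2 * r"
        using u2 etaT[OF i t] r by (intro mult_mono) auto
      then have "C * ((norm (eta i \<theta>))\<^sup>2 * norm (eta i t)) \<le> C * (r\<^sup>2 * r)" using C0 by (rule mult_left_mono)
      then show ?thesis using CD by (simp add: power2_eq_square power3_eq_cube)
    qed
    have q: "C * (norm (eta i \<theta>) * norm (eta i s) * norm (eta i t)) \<le> D * r ^ 3" if t: "s \<in> T" "t \<in> T" for s t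
    proof -
      have "norm (eta i \<theta>) * norm (eta i s) * norm (eta i t) \<le> r * r * r"
        using eta\<theta>[OF i] etaT[OF i t(1)] etaT[OF i t(2)] r by (intro mult_mono) auto
      then have "C * (norm (eta i \<theta>) * norm (eta i s) * norm (eta i t)) \<le> C * (r * r * r)" using C0 by (rule mult_left_mono)
      then show ?thesis using CD by (simp add: power3_eq_cube mult.assoc)
    qed
    show ?thesis
      unfolding NT
      using tilt(2,3,4,6)[OF i] order_trans[OF tilt(5)[OF i] l] order_trans[OF tilt(7)[OF i] q] D0(2) WP
      by (auto simp: integrable_distr_eq integral_distr intro: order_trans)
  next
    case False
    have NF: "N c i = distr Q borel (G i)" "mm c = 0" "AA c i = 0"
      using False i unfolding N_def mm_def AA_def by auto
    have "0 \<le> D * r ^ 3" using D0 r by simp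
    then show ?thesis
      unfolding NF using G(1) G(4-)[OF i] D0(4)
      by (auto simp: integrable_distr_eq integral_distr intro: order_trans)
  qed
  have mz: "case_prod (z c i) \<in> borel_measurable (borel \<Otimes>\<^sub>M prior)" if i: "i \<in> ?I" for c i
  proof -
    have [measurable]: "eta i \<in> borel_measurable prior"
      using borel_measurable_continuous_on_restrict[OF eta[OF i]]
      by (simp add: measurable_cong_sets[OF prior(2) refl])
    have [measurable]: "cumulant lam W \<in> borel_measurable borel" by (rule cumulant_measurable[OF base(1) Wl])
    have [measurable]: "(\<lambda>v. K *v v) \<in> borel_measurable borel"
      by (intro borel_measurable_continuous_onI linear_continuous_on matrix_vector_mul_bounded_linear)
    have "e0 i \<in> borel_measurable prior" "b i \<in> borel_measurable prior"
      unfolding e0_def[abs_def] b_def[abs_def] by measurable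
    then have "e c i \<in> borel_measurable prior" unfolding e_def by simp
    then show ?thesis unfolding z_def by measurable
  qed
  \<comment> \<open>The three summands pay for the envelopes, the first moments and the second moments.\<close>
  let ?E = "(8 * (D + D ^ 3) + 3 * D + 2 * (D + 5 * D\<^sup>2)) * r ^ 3"
  have Eb: "8 * (D + D ^ 3) * r ^ 3 \<le> ?E" "3 * (D * r ^ 3) \<le> ?E" "2 * ((D + 5 * D\<^sup>2) * r ^ 3) \<le> ?E"
  proof -
    have "0 \<le> 8 * (D + D ^ 3) * r ^ 3" "0 \<le> 3 * (D * r ^ 3)" "0 \<le> 2 * ((D + 5 * D\<^sup>2) * r ^ 3)" using D0 r by auto
    moreover have "?E = 8 * (D + D ^ 3) * r ^ 3 + 3 * (D * r ^ 3) + 2 * ((D + 5 * D\<^sup>2) * r ^ 3)"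
      by (simp add: algebra_simps)
    ultimately show "8 * (D + D ^ 3) * r ^ 3 \<le> ?E" "3 * (D * r ^ 3) \<le> ?E" "2 * ((D + 5 * D\<^sup>2) * r ^ 3) \<le> ?E" by linarith+
  qed
  have sm: "t \<in> T \<Longrightarrow> \<bar>z c i v t\<bar> \<le> B c i v" "B c i \<in> borel_measurable borel"
      "integrable (N c i) (\<lambda>v. B c i v ^ 3)" "(\<integral>v. B c i v ^ 3 \<partial>N c i) \<le> 8 * (D + D ^ 3) * r ^ 3"
      "t \<in> T \<Longrightarrow> \<bar>(\<integral>v. z c i v t \<partial>N c i) - (AA c i \<bullet> eta i t + e c i t)\<bar> \<le> D * r ^ 3"
      "s \<in> T \<Longrightarrow> t \<in> T \<Longrightarrow> \<bar>(\<integral>v. z c i v s * z c i v t \<partial>N c i) - (S *v eta i s) \<bullet> eta i t\<bar> \<le> (D + 5 * D\<^sup>2) * r ^ 3"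
    if i: "i \<in> ?I" for c i v s t
  proof -
    note s = site[OF i, of c]
    show "t \<in> T \<Longrightarrow> \<bar>z c i v t\<bar> \<le> B c i v" "B c i \<in> borel_measurable borel"
      "integrable (N c i) (\<lambda>v. B c i v ^ 3)" "(\<integral>v. B c i v ^ 3 \<partial>N c i) \<le> 8 * (D + D ^ 3) * r ^ 3"
      "t \<in> T \<Longrightarrow> \<bar>(\<integral>v. z c i v t \<partial>N c i) - (AA c i \<bullet> eta i t + e c i t)\<bar> \<le> D * r ^ 3"
      "s \<in> T \<Longrightarrow> t \<in> T \<Longrightarrow> \<bar>(\<integral>v. z c i v s * z c i v t \<partial>N c i) - (S *v eta i s) \<bullet> eta i t\<bar> \<le> (D + 5 * D\<^sup>2) * r ^ 3"
      unfolding z_def B_def[abs_def]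
      by (rule linear_field_moments[where T=T and A="AA c i" and S=S and C=D and r=r and h="eta i" and e="e c i" and N="N c i" and m="mm c"];
          use Nprob Nsets r(1) r1 D0(1) etaT[OF i] ec[OF i] AAb[OF i] s in blast)+
  qed
  have lind: "\<bar>(\<integral>v. ln (\<integral>t. exp (\<Sum>i\<in>?I. z True i (v i) t) \<partial>prior) \<partial>PiM ?I (N True)) -
          (\<integral>v. ln (\<integral>t. exp (\<Sum>i\<in>?I. z False i (v i) t) \<partial>prior) \<partial>PiM ?I (N False))\<bar> \<le> real (card ?I) * (82 * ?E)"
  proof (rule lindeberg_log_partition[where S=borel and B=B])
    fix c i assume i: "i \<in> ?I"
    show "(\<integral>v. B c i v ^ 3 \<partial>N c i) \<le> ?E" using sm(4)[OF i] Eb(1) by (rule order_trans)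
  next
    fix i t assume i: "i \<in> ?I" and t: "t \<in> space prior"
    then have t: "t \<in> T" by (simp add: spT)
    have "\<bar>(AA True i \<bullet> eta i t + e True i t) - (AA False i \<bullet> eta i t + e False i t)\<bar> \<le> C * r ^ 3"
      using taylor[OF etaT[OF i t]] unfolding AA_def e_def e0_def b_def by simp
    then show "\<bar>(\<integral>v. z True i v t \<partial>N True i) - (\<integral>v. z False i v t \<partial>N False i)\<bar> \<le> ?E"
      using sm(5)[OF i t, of True] sm(5)[OF i t, of False] Eb(2) CD by linarith
  next
    fix i s t assume i: "i \<in> ?I" and st: "s \<in> space prior" "t \<in> space prior"
    then have st: "s \<in> T" "t \<in> T" by (simp_all add: spT)
    show "\<bar>(\<integral>v. z True i v s * z True i v t \<partial>N True i) - (\<integral>v. z False i v s * z False i v t \<partial>N False i)\<bar> \<le> ?E"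
      using sm(6)[OF i st, of True] sm(6)[OF i st, of False] Eb(3) by linarith
  qed (use Nprob Nsets prior(1) mz sm(1-3) spT in auto)
  have X: "(\<integral>w. ln (\<integral>t. exp (model_loglik lam W M eta t w) \<partial>prior) \<partial>data_law gam U M eta \<theta>)
     = (\<integral>v. ln (\<integral>t. exp (\<Sum>i\<in>?I. z True i (v i) t) \<partial>prior) \<partial>PiM ?I (N True))"
  proof -
    let ?H = "\<lambda>v. ln (\<integral>t. exp (\<Sum>i\<in>?I. z True i (v i) t) \<partial>prior)"
    have Hm: "?H \<in> borel_measurable (PiM ?I (\<lambda>_. borel))"
      by (rule log_partition_measurable[OF prior(1) mz])
    have NT: "PiM ?I (N True) = PiM ?I (\<lambda>i. distr (P i) borel W)"
      by (intro PiM_cong refl) (simp add: N_def)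
    have cW: "compose ?I W \<in> measurable (PiM ?I P) (PiM ?I (\<lambda>_. borel))"
      unfolding compose_def[abs_def]
    proof (rule measurable_restrict)
      fix i assume i: "i \<in> ?I"
      show "(\<lambda>w. W (w i)) \<in> borel_measurable (PiM ?I P)"
        by (rule measurable_compose[OF measurable_component_singleton[OF i, of P] WP])
    qed
    \<comment> \<open>A probability measure stands in for \<open>borel\<close> as the target, of which only the \<sigma>-algebra matters.\<close>
    have "PiM ?I (N True) = PiM ?I (\<lambda>i. distr (P i) (return borel 0) W)"
      unfolding NT by (intro PiM_cong refl distr_cong) auto
    also have "\<dots> = distr (PiM ?I P) (PiM ?I (\<lambda>_. return borel 0)) (compose ?I W)"
      using tilt(1) WP prob_space_return[of "0 :: real ^ 'd" borel]
      by (intro distr_PiM_finite_prob_space'[symmetric]) auto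
    also have "\<dots> = distr (PiM ?I P) (PiM ?I (\<lambda>_. borel)) (compose ?I W)"
      by (intro distr_cong refl sets_PiM_cong) auto
    finally have "PiM ?I (N True) = distr (PiM ?I P) (PiM ?I (\<lambda>_. borel)) (compose ?I W)" .
    then have "(\<integral>v. ?H v \<partial>PiM ?I (N True)) = (\<integral>w. ?H (compose ?I W w) \<partial>PiM ?I P)"
      using integral_distr[OF cW Hm] by simp
    moreover have "data_law gam U M eta \<theta> = PiM ?I P"
      unfolding data_law_def P_def exp_tilt_def ..
    moreover have "(\<Sum>i\<in>?I. z True i (compose ?I W w i) t) = model_loglik lam W M eta t w" for w t
      unfolding model_loglik_def z_def e_def e0_def mm_def compose_def
      by (intro sum.cong refl) (simp add: inner_diff_left)
    ultimately show ?thesis by simp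
  qed
  have Yeq: "(\<integral>x. ln (\<integral>t. exp (\<Sum>m\<in>?I. Y m t x) \<partial>prior) \<partial>Q)
     = (\<integral>v. ln (\<integral>t. exp (\<Sum>i\<in>?I. z False i (v i) t) \<partial>prior) \<partial>PiM ?I (N False))"
  proof -
    let ?H = "\<lambda>v. ln (\<integral>t. exp (\<Sum>i\<in>?I. z False i (v i) t) \<partial>prior)"
    let ?G = "\<lambda>x. \<lambda>m\<in>?I. G m x"
    have Hm: "?H \<in> borel_measurable (PiM ?I (\<lambda>_. borel))"
      by (rule log_partition_measurable[OF prior(1) mz])
    have Gm: "?G \<in> measurable Q (PiM ?I (\<lambda>_. borel))" by (intro measurable_restrict G(1))
    have NF: "PiM ?I (N False) = distr Q (PiM ?I (\<lambda>_. borel)) ?G"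
      unfolding G(2) by (intro PiM_cong refl) (simp add: N_def)
    have "(\<lambda>(x, t). Y m t x) \<in> borel_measurable (Q \<Otimes>\<^sub>M prior)" if m: "m \<in> ?I" for m
    proof (rule caratheodory_measurable[OF T prior(2)])
      fix t assume t: "t \<in> T"
      have "gaussian_process Q T (Y m)" using gc m unfolding gaussian_comparison_def by blast
      then have "gaussian_rv Q (\<lambda>x. \<Sum>u\<in>{t}. 1 * Y m u x)"
        unfolding gaussian_process_def using t by (elim allE[of _ "{t}"] allE[of _ "\<lambda>_. 1"] impE) auto
      then show "Y m t \<in> borel_measurable Q" unfolding gaussian_rv_def by simp
    next
      show "continuous_on T (\<lambda>t. Y m t x)" if "x \<in> space Q" for x
        using gc m that unfolding gaussian_comparison_def by blast
    qed
    then have "(\<lambda>(x, t). \<Sum>m\<in>?I. Y m t x) \<in> borel_measurable (Q \<Otimes>\<^sub>M prior)"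
      unfolding case_prod_beta' by (rule borel_measurable_sum)
    then have "(\<lambda>(x, t). exp (\<Sum>m\<in>?I. Y m t x)) \<in> borel_measurable (Q \<Otimes>\<^sub>M prior)"
      unfolding case_prod_beta' by measurable
    then have "(\<lambda>x. \<integral>t. exp (\<Sum>m\<in>?I. Y m t x) \<partial>prior) \<in> borel_measurable Q"
      by (rule prior.borel_measurable_lebesgue_integral)
    then have m1: "(\<lambda>x. ln (\<integral>t. exp (\<Sum>m\<in>?I. Y m t x) \<partial>prior)) \<in> borel_measurable Q"
      by measurable
    have "AE x in Q. ln (\<integral>t. exp (\<Sum>m\<in>?I. Y m t x) \<partial>prior) = ?H (?G x)"
      using G(3)
    proof eventually_elim
      case (elim x)
      have "(\<Sum>m\<in>?I. Y m t x) = (\<Sum>i\<in>?I. z False i (?G x i) t)" if "t \<in> T" for t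
        unfolding z_def e_def mm_def using elim that by (intro sum.cong refl) auto
      then have "(\<integral>t. exp (\<Sum>m\<in>?I. Y m t x) \<partial>prior) = (\<integral>t. exp (\<Sum>i\<in>?I. z False i (?G x i) t) \<partial>prior)"
        by (intro Bochner_Integration.integral_cong refl) (simp add: spT)
      then show ?case by simp
    qed
    then have "(\<integral>x. ln (\<integral>t. exp (\<Sum>m\<in>?I. Y m t x) \<partial>prior) \<partial>Q) = (\<integral>x. ?H (?G x) \<partial>Q)"
      by (intro integral_cong_AE m1 measurable_compose[OF Gm Hm])
    also have "\<dots> = (\<integral>v. ?H v \<partial>PiM ?I (N False))"
      unfolding NF by (rule integral_distr[OF Gm Hm, symmetric])
    finally show ?thesis .
  qed
  show ?thesis using lind unfolding X Yeq by simp
qed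

text \<open>Compactness makes the suprema in the radius finite, which turns them into pointwise bounds.\<close>

lemma feature_radius_bounds:
  fixes eta :: "nat \<Rightarrow> 'a :: topological_space \<Rightarrow> real ^ 'd"
  assumes Theta: "compact Theta" "Theta \<noteq> {}" and M: "M \<ge> 1"
    and eta: "\<And>m. m \<in> {1..M} \<Longrightarrow> continuous_on Theta (eta m)"
  shows "0 \<le> feature_radius Theta M eta"
    and "\<And>m u. m \<in> {1..M} \<Longrightarrow> u \<in> Theta \<Longrightarrow> norm (eta m u) \<le> feature_radius Theta M eta"
proof -
  show b: "norm (eta m u) \<le> feature_radius Theta M eta" if m: "m \<in> {1..M}" and u: "u \<in> Theta" for m u
  proof -
    have "compact ((\<lambda>u. norm (eta m u)) ` Theta)"
      by (intro compact_continuous_image continuous_on_norm eta m Theta)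
    then have "bdd_above ((\<lambda>u. norm (eta m u)) ` Theta)"
      by (intro bounded_imp_bdd_above compact_imp_bounded)
    then have "norm (eta m u) \<le> (SUP u\<in>Theta. norm (eta m u))" using u by (intro cSUP_upper)
    also have "\<dots> \<le> feature_radius Theta M eta"
      unfolding feature_radius_def using m by (intro Max_ge) auto
    finally show ?thesis .
  qed
  obtain u where "u \<in> Theta" using Theta(2) by blast
  moreover have "1 \<in> {1..M}" using M by simp
  ultimately show "0 \<le> feature_radius Theta M eta" using b norm_ge_zero order_trans by blast
qed

theorem theorem6:
  fixes Theta T :: "nat \<Rightarrow> 'a::topological_space set"
    and prior :: "nat \<Rightarrow> 'a measure"
    and M :: "nat \<Rightarrow> nat"
    and lam gam :: "'w measure"
    and W0 W0s :: "'w \<Rightarrow> real ^ 'd"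
    and eta :: "nat \<Rightarrow> nat \<Rightarrow> 'a \<Rightarrow> real ^ 'd"
    and Q :: "nat \<Rightarrow> 'a \<Rightarrow> 'q measure"
    and Y :: "nat \<Rightarrow> 'a \<Rightarrow> nat \<Rightarrow> 'a \<Rightarrow> 'q \<Rightarrow> real"
  defines "A0 \<equiv> mixed_hessian (joint_cumulant gam W0 W0s) 0 0"
    and "\<Sigma>0 \<equiv> hessian (\<lambda>v. joint_cumulant gam W0 W0s v 0) 0"
    and "K0 \<equiv> hessian (cumulant lam W0) 0"
    and "r \<equiv> \<lambda>n. feature_radius (Theta n) (M n) (eta n)"
    and "F \<equiv> \<lambda>n \<theta>. free_energy n (data_law gam W0s (M n) (eta n) \<theta>) (prior n)
                 (model_loglik lam W0 (M n) (eta n))"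
    and "FG \<equiv> \<lambda>n \<theta>. free_energy n (Q n \<theta>) (prior n) (\<lambda>t x. \<Sum>m\<in>{1..M n}. Y n \<theta> m t x)"
  assumes Theta: "\<And>n. compact (Theta n)"
    and T: "\<And>n. T n \<subseteq> Theta n" "\<And>n. compact (T n)" "\<And>n. metrizable_space (top_of_set (T n))"
    and prior: "\<And>n. prob_space (prior n)" "\<And>n. sets (prior n) = sets (restrict_space borel (T n))"
    and base: "prob_space lam" "prob_space gam" "sets lam = sets gam"
    and W: "W0 \<in> borel_measurable gam" "W0s \<in> borel_measurable gam"
    and eta: "\<And>n m. m \<in> {1..M n} \<Longrightarrow> continuous_on (Theta n) (eta n m)"
    and regularity: "local_exp_family_regularity lam gam W0 W0s"
    and gaussian: "\<And>n \<theta>. \<theta> \<in> Theta n \<Longrightarrow>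
          gaussian_comparison (Q n \<theta>) (Y n \<theta>) (T n) (M n) (eta n) A0 \<Sigma>0 K0 \<theta>"
    and M_growth: "(\<lambda>n. real (M n)) \<in> \<omega>(\<lambda>n. real n)"
    and r_bound: "r \<in> O(\<lambda>n. sqrt (real n / real (M n)))"
  shows "(\<forall>\<^sub>F n in sequentially. bdd_above ((\<lambda>\<theta>. \<bar>F n \<theta> - FG n \<theta>\<bar>) ` Theta n)) \<and>
         (\<lambda>n. SUP \<theta>\<in>Theta n. \<bar>F n \<theta> - FG n \<theta>\<bar>) \<in> O(r)"
proof -
  have Theta_ne: "Theta n \<noteq> {}" for n
  proof -
    have "space (prior n) = T n"
      using sets_eq_imp_space_eq[OF prior(2)] by (simp add: space_restrict_space)
    then show ?thesis using prob_space.not_empty[OF prior(1)[of n]] T(1)[of n] by auto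
  qed
  obtain u0 C where u0: "0 < u0" "u0 \<le> 1" and C: "1 \<le> C" and me: "moment_estimates lam gam W0 W0s u0 C"
    using moment_estimates_exist[OF base W regularity] by blast
  define D where "D = 2 * C + 2 * real CARD('d) ^ 4 * C ^ 3"
  define E where "E = 82 * (8 * (D + D ^ 3) + 3 * D + 2 * (D + 5 * D\<^sup>2))"
  have D0: "0 \<le> D" unfolding D_def using C by simp
  have E0: "0 \<le> E" unfolding E_def using D0 by simp
  note cov = hessians_eq_cov_matrix[OF base W regularity]
  obtain c where c: "c > 0" "\<forall>\<^sub>F n in sequentially. \<bar>r n\<bar> \<le> c * sqrt (real n / real (M n))"
    using landau_o.bigE[OF r_bound] by (auto simp: abs_of_nonneg)
  \<comment> \<open>The growth of \<open>M\<close> makes \<open>n / M\<close> eventually small, which forces the radius below \<open>u0\<close>.\<close>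
  have M1: "\<forall>\<^sub>F n in sequentially. 1 \<le> n \<and> 1 \<le> M n \<and> (real n / real (M n)) * c\<^sup>2 \<le> u0\<^sup>2"
  proof -
    have k: "\<forall>\<^sub>F n in sequentially. (c\<^sup>2 / u0\<^sup>2) * real n \<le> real (M n)"
      using landau_omega.smallD[OF M_growth, of "c\<^sup>2 / u0\<^sup>2"] c(1) u0(1) by simp
    show ?thesis
      using k eventually_ge_at_top[of 1]
    proof eventually_elim
      case (elim n)
      have "0 < (c\<^sup>2 / u0\<^sup>2) * real n" using elim(2) c(1) u0(1) by simp
      then have M: "0 < real (M n)" using elim(1) by linarith
      have "c\<^sup>2 * real n \<le> u0\<^sup>2 * real (M n)" using elim(1) u0(1) by (simp add: field_simps)
      then have "(real n / real (M n)) * c\<^sup>2 \<le> u0\<^sup>2" using M by (simp add: field_simps)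
      then show ?case using M elim(2) by simp
    qed
  qed
  have main: "\<forall>\<^sub>F n in sequentially. 0 \<le> r n \<and> (\<forall>\<theta>\<in>Theta n. \<bar>F n \<theta> - FG n \<theta>\<bar> \<le> (E * c\<^sup>2) * r n)"
    using c(2) M1
  proof eventually_elim
    case (elim n)
    then have n: "1 \<le> n" and M: "1 \<le> M n" and small: "(real n / real (M n)) * c\<^sup>2 \<le> u0\<^sup>2" by auto
    have r0: "0 \<le> r n" using feature_radius_bounds(1)[OF Theta Theta_ne M eta] unfolding r_def .
    have rb: "norm (eta n m u) \<le> r n" if "m \<in> {1..M n}" "u \<in> Theta n" for m u
      using feature_radius_bounds(2)[OF Theta Theta_ne M eta that] unfolding r_def .
    have "(r n)\<^sup>2 \<le> (c * sqrt (real n / real (M n)))\<^sup>2" using elim(1) r0 by (intro power_mono) auto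
    also have "\<dots> = (real n / real (M n)) * c\<^sup>2" by (simp add: power_mult_distrib)
    finally have r2: "(r n)\<^sup>2 \<le> (real n / real (M n)) * c\<^sup>2" .
    then have "(r n)\<^sup>2 \<le> u0\<^sup>2" using small by linarith
    then have ru: "r n \<le> u0" by (rule power2_le_imp_le) (use u0(1) in simp)
    have "\<bar>F n \<theta> - FG n \<theta>\<bar> \<le> (E * c\<^sup>2) * r n" if \<theta>: "\<theta> \<in> Theta n" for \<theta>
    proof -
      let ?X = "\<integral>w. ln (\<integral>t. exp (model_loglik lam W0 (M n) (eta n) t w) \<partial>prior n) \<partial>data_law gam W0s (M n) (eta n) \<theta>"
      let ?Y = "\<integral>x. ln (\<integral>t. exp (\<Sum>m\<in>{1..M n}. Y n \<theta> m t x) \<partial>prior n) \<partial>Q n \<theta>"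
      have "\<bar>?X - ?Y\<bar> \<le> real (M n) * (82 * ((8 * (D + D ^ 3) + 3 * D + 2 * (D + 5 * D\<^sup>2)) * r n ^ 3))"
      proof (rule free_energy_gap[OF base W me u0(2) C T(2,3) prior _ _ M r0 ru _ _ D_def])
        show "continuous_on (T n) (eta n m)" if "m \<in> {1..M n}" for m
          by (rule continuous_on_subset[OF eta[OF that] T(1)])
        show "gaussian_comparison (Q n \<theta>) (Y n \<theta>) (T n) (M n) (eta n) (cov_matrix gam W0 W0s) (cov_matrix gam W0 W0) (cov_matrix lam W0 W0) \<theta>"
          using gaussian[OF \<theta>] unfolding A0_def \<Sigma>0_def K0_def cov .
      qed (use rb T(1) \<theta> in auto)
      also have "\<dots> = E * (real (M n) * (r n)\<^sup>2) * r n"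
        unfolding E_def by (simp add: power2_eq_square power3_eq_cube)
      \<comment> \<open>Here \<open>r\<^sup>2 \<le> c\<^sup>2 n / M\<close> cancels the number of sites and leaves one factor \<open>r\<close>.\<close>
      also have "\<dots> \<le> E * (real n * c\<^sup>2) * r n"
        using r2 M E0 r0 by (intro mult_right_mono mult_left_mono) (auto simp: field_simps)
      finally have gap: "\<bar>?X - ?Y\<bar> \<le> real n * ((E * c\<^sup>2) * r n)" by (simp add: mult_ac)
      have "F n \<theta> - FG n \<theta> = (?X - ?Y) / real n"
        unfolding F_def FG_def free_energy_def by (simp add: diff_divide_distrib)
      then have "\<bar>F n \<theta> - FG n \<theta>\<bar> = \<bar>?X - ?Y\<bar> / real n" by simp
      also have "\<dots> \<le> (E * c\<^sup>2) * r n" using gap n by (simp add: divide_le_eq mult.commute)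
      finally show ?thesis .
    qed
    then show ?case using r0 by blast
  qed
  have bdd: "\<forall>\<^sub>F n in sequentially. bdd_above ((\<lambda>\<theta>. \<bar>F n \<theta> - FG n \<theta>\<bar>) ` Theta n)"
    using main by eventually_elim (auto intro!: bdd_aboveI2)
  moreover have "(\<lambda>n. SUP \<theta>\<in>Theta n. \<bar>F n \<theta> - FG n \<theta>\<bar>) \<in> O(r)"
  proof (rule landau_o.bigI[of "E * c\<^sup>2 + 1"])
    show "0 < E * c\<^sup>2 + 1" using E0 c(1) by (simp add: add_nonneg_pos)
    show "\<forall>\<^sub>F n in sequentially. norm (SUP \<theta>\<in>Theta n. \<bar>F n \<theta> - FG n \<theta>\<bar>) \<le> (E * c\<^sup>2 + 1) * norm (r n)"
      using main bdd
    proof eventually_elim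
      case (elim n)
      obtain \<theta> where \<theta>: "\<theta> \<in> Theta n" using Theta_ne by blast
      have "0 \<le> \<bar>F n \<theta> - FG n \<theta>\<bar>" by simp
      also have "\<dots> \<le> (SUP \<theta>\<in>Theta n. \<bar>F n \<theta> - FG n \<theta>\<bar>)" by (rule cSUP_upper[OF \<theta> elim(2)])
      finally have "0 \<le> (SUP \<theta>\<in>Theta n. \<bar>F n \<theta> - FG n \<theta>\<bar>)" .
      moreover have "(SUP \<theta>\<in>Theta n. \<bar>F n \<theta> - FG n \<theta>\<bar>) \<le> (E * c\<^sup>2) * r n"
        using elim(1) by (intro cSUP_least Theta_ne) blast
      moreover have "(E * c\<^sup>2) * r n \<le> (E * c\<^sup>2 + 1) * r n" using elim(1) by (simp add: distrib_right)
      ultimately show ?case using elim(1) by simp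
    qed
  qed
  ultimately show ?thesis by blast
qed

end
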